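(* Let $d\ge 1$ and $a>0$. For every $n\ge1$, the unital bounded $n$-dimensional representations of $A(\mathcal{D}_a(\mathbb{B}_d))$ coincide with those of $A(\mathbb{B}_d)$; that is, every bounded unital homomorphism $A(\mathcal{D}_a(\mathbb{B}_d))\to M_n$ extends uniquely to a bounded unital homomorphism $A(\mathbb{B}_d)\to M_n$, and the restriction to $A(\mathcal{D}_a(\mathbb{B}_d))$ of every bounded unital homomorphism $A(\mathbb{B}_d)\to M_n$ is bounded with respect to the norm of $A(\mathcal{D}_a(\mathbb{B}_d))$. Moreover, every such representation $\pi$ is uniquely determined by a $d$-tuple $T=(T_1,\ldots,T_d)$ of commuting $n\times n$ matrices which is jointly similar to a row contraction and such that $\pi(p)=p(T)$ for every polynomial $p\in\mathbb{C}[z_1,\ldots,z_d]$.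
   Context: $\mathbb{B}_d$ is the open Euclidean unit ball of $\mathbb{C}^d$. $\mathcal{D}_a(\mathbb{B}_d)$ is the reproducing kernel Hilbert space on $\mathbb{B}_d$ with kernel $\frac{1}{(1-\langle z,w\rangle)^a}$; $\mathrm{Mult}(\mathcal{D}_a(\mathbb{B}_d))$ is its multiplier algebra with the operator norm of multiplication operators, and $A(\mathcal{D}_a(\mathbb{B}_d))$ is the norm closure of the polynomials in it. $A(\mathbb{B}_d)$ is the ball algebra: holomorphic functions on $\mathbb{B}_d$ extending continuously to $\overline{\mathbb{B}}_d$, with the supremum norm; since the multiplier norm dominates the supremum norm, $A(\mathcal{D}_a(\mathbb{B}_d))\subseteq A(\mathbb{B}_d)$ as function algebras. $M_n$ is the algebra of $n\times n$ complex matrices. A tuple $R=(R_1,\ldots,R_d)$ is a row contraction if $\|\sum_iR_iR_i^*\|^{1/2}\le1$; $T$ is jointly similar to $R$ if there is an invertible $S$ with $T_i=SR_iS^{-1}$ for all $i$. *)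

theory Defs
  imports "HOL-Analysis.Analysis" "HOL-Library.Poly_Mapping"
begin

section \<open>Functions on a set\<close>

text \<open>
  A complex function on a set \<open>X\<close> is represented by the total function that vanishes outside
  \<open>X\<close>. This makes the representation unique and keeps the pointwise operations.
\<close>

definition functions_on :: "'x set \<Rightarrow> ('x \<Rightarrow> complex) set" where
  "functions_on X = {f. \<forall>z. z \<notin> X \<longrightarrow> f z = 0}"

definition one_on :: "'x set \<Rightarrow> 'x \<Rightarrow> complex" where
  "one_on X = (\<lambda>z. if z \<in> X then 1 else 0)"

definition unit_ball :: "(complex ^ 'd) set" where
  "unit_ball = ball 0 1"


section \<open>Reproducing kernel Hilbert spaces and their multipliers\<close>

definition complex_inner_product ::
  "('x \<Rightarrow> complex) set \<Rightarrow> (('x \<Rightarrow> complex) \<Rightarrow> ('x \<Rightarrow> complex) \<Rightarrow> complex) \<Rightarrow> bool" where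
  "complex_inner_product H ip \<longleftrightarrow>
     (\<forall>f\<in>H. \<forall>g\<in>H. \<forall>h\<in>H. \<forall>c. ip (\<lambda>z. c * f z + g z) h = c * ip f h + ip g h) \<and>
     (\<forall>f\<in>H. \<forall>g\<in>H. ip g f = cnj (ip f g)) \<and>
     (\<forall>f\<in>H. 0 \<le> Re (ip f f)) \<and>
     (\<forall>f\<in>H. ip f f = 0 \<longrightarrow> f = (\<lambda>z. 0))"

definition ip_norm ::
  "(('x \<Rightarrow> complex) \<Rightarrow> ('x \<Rightarrow> complex) \<Rightarrow> complex) \<Rightarrow> ('x \<Rightarrow> complex) \<Rightarrow> real" where
  "ip_norm ip f = sqrt (Re (ip f f))"

definition ip_complete ::
  "('x \<Rightarrow> complex) set \<Rightarrow> (('x \<Rightarrow> complex) \<Rightarrow> ('x \<Rightarrow> complex) \<Rightarrow> complex) \<Rightarrow> bool" where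
  "ip_complete H ip \<longleftrightarrow>
     (\<forall>f :: nat \<Rightarrow> 'x \<Rightarrow> complex. (\<forall>n. f n \<in> H) \<longrightarrow>
        (\<forall>e>0. \<exists>N. \<forall>m\<ge>N. \<forall>n\<ge>N. ip_norm ip (\<lambda>z. f m z - f n z) < e) \<longrightarrow>
        (\<exists>g\<in>H. (\<lambda>n. ip_norm ip (\<lambda>z. f n z - g z)) \<longlonglongrightarrow> 0))"

text \<open>
  \<open>is_rkhs X K H ip\<close>: the functions in \<open>H\<close>, with inner product \<open>ip\<close> (linear in the first
  argument), form the reproducing kernel Hilbert space on \<open>X\<close> with kernel \<open>K\<close>. By the
  Moore-Aronszajn theorem, \<open>K\<close> determines \<open>H\<close>, and \<open>ip\<close> on \<open>H\<close>.
\<close>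

definition is_rkhs ::
  "'x set \<Rightarrow> ('x \<Rightarrow> 'x \<Rightarrow> complex) \<Rightarrow> ('x \<Rightarrow> complex) set \<Rightarrow>
    (('x \<Rightarrow> complex) \<Rightarrow> ('x \<Rightarrow> complex) \<Rightarrow> complex) \<Rightarrow> bool" where
  "is_rkhs X K H ip \<longleftrightarrow>
     H \<subseteq> functions_on X \<and>
     (\<lambda>z. 0) \<in> H \<and>
     (\<forall>f\<in>H. \<forall>g\<in>H. \<forall>c. (\<lambda>z. c * f z + g z) \<in> H) \<and>
     complex_inner_product H ip \<and>
     ip_complete H ip \<and>
     (\<forall>w\<in>X. (\<lambda>z. if z \<in> X then K z w else 0) \<in> H \<and>
        (\<forall>f\<in>H. f w = ip f (\<lambda>z. if z \<in> X then K z w else 0)))"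

text \<open>
  Boundedness of the multiplication operator is automatic by the closed graph theorem; it is
  spelled out because the supremum in \<open>mult_norm\<close> is only meaningful for bounded operators.
\<close>

definition multipliers ::
  "'x set \<Rightarrow> ('x \<Rightarrow> complex) set \<Rightarrow> (('x \<Rightarrow> complex) \<Rightarrow> ('x \<Rightarrow> complex) \<Rightarrow> complex) \<Rightarrow>
    ('x \<Rightarrow> complex) set" where
  "multipliers X H ip =
     {\<phi> \<in> functions_on X.
        (\<forall>f\<in>H. (\<lambda>z. \<phi> z * f z) \<in> H) \<and>
        (\<exists>C. \<forall>f\<in>H. ip_norm ip (\<lambda>z. \<phi> z * f z) \<le> C * ip_norm ip f)}"

definition mult_norm ::
  "('x \<Rightarrow> complex) set \<Rightarrow> (('x \<Rightarrow> complex) \<Rightarrow> ('x \<Rightarrow> complex) \<Rightarrow> complex) \<Rightarrow>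
    ('x \<Rightarrow> complex) \<Rightarrow> real" where
  "mult_norm H ip \<phi> = (SUP f \<in> {f \<in> H. ip_norm ip f \<le> 1}. ip_norm ip (\<lambda>z. \<phi> z * f z))"


section \<open>The function algebras\<close>

text \<open>
  The power is the principal branch, which is holomorphic here: if \<open>norm z < 1\<close> and
  \<open>norm w < 1\<close>, the base has positive real part.
\<close>

definition Da_kernel :: "real \<Rightarrow> complex ^ 'd \<Rightarrow> complex ^ 'd \<Rightarrow> complex" where
  "Da_kernel a z w = 1 / (1 - (\<Sum>i\<in>UNIV. z $ i * cnj (w $ i))) powr (of_real a)"

text \<open>
  Polynomials in \<open>z\<^sub>i\<close> (\<open>i :: 'd\<close>): finitely supported maps from exponent vectors to coefficients.
\<close>

type_synonym 'd cpoly = "('d \<Rightarrow>\<^sub>0 nat) \<Rightarrow>\<^sub>0 complex"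

definition poly_on_ball :: "'d cpoly \<Rightarrow> complex ^ 'd \<Rightarrow> complex" where
  "poly_on_ball p =
     (\<lambda>z. if z \<in> unit_ball
          then \<Sum>m\<in>Poly_Mapping.keys p. Poly_Mapping.lookup p m * (\<Prod>i\<in>UNIV. (z $ i) ^ Poly_Mapping.lookup m i) else 0)"

text \<open>The closure of the polynomials in the multiplier algebra of \<open>(H, ip)\<close>.\<close>

definition poly_closure ::
  "(complex ^ 'd \<Rightarrow> complex) set \<Rightarrow>
    ((complex ^ 'd \<Rightarrow> complex) \<Rightarrow> (complex ^ 'd \<Rightarrow> complex) \<Rightarrow> complex) \<Rightarrow>
    (complex ^ 'd \<Rightarrow> complex) set" where
  "poly_closure H ip =
     {\<phi> \<in> multipliers unit_ball H ip.
        \<forall>e>0. \<exists>p. poly_on_ball p \<in> multipliers unit_ball H ip \<and>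
          mult_norm H ip (\<lambda>z. \<phi> z - poly_on_ball p z) < e}"

text \<open>Holomorphic in several variables: Frechet differentiable with complex-linear derivative.\<close>

definition holomorphic_in :: "(complex ^ 'd \<Rightarrow> complex) \<Rightarrow> (complex ^ 'd) set \<Rightarrow> bool" where
  "holomorphic_in f U \<longleftrightarrow>
     (\<forall>z\<in>U. \<exists>L. (f has_derivative L) (at z) \<and> (\<forall>c v. L (c *s v) = c * L v))"

definition ball_algebra :: "(complex ^ 'd \<Rightarrow> complex) set" where
  "ball_algebra =
     {f \<in> functions_on unit_ball. holomorphic_in f unit_ball \<and>
        (\<exists>g. continuous_on (closure unit_ball) g \<and> (\<forall>z\<in>unit_ball. g z = f z))}"

definition ball_sup_norm :: "(complex ^ 'd \<Rightarrow> complex) \<Rightarrow> real" where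
  "ball_sup_norm f = (SUP z \<in> unit_ball. cmod (f z))"


section \<open>Matrices and representations\<close>

text \<open>
  The norm of the type \<open>complex ^ 'n ^ 'n\<close> is the Frobenius norm, so the operator norm with respect
  to the Euclidean norm is introduced separately.
\<close>

definition op_norm :: "complex ^ 'n ^ 'n \<Rightarrow> real" where
  "op_norm A = onorm ((*v) A)"

definition conj_transpose :: "complex ^ 'n ^ 'm \<Rightarrow> complex ^ 'm ^ 'n" where
  "conj_transpose A = (\<chi> i j. cnj (A $ j $ i))"

definition row_contraction :: "('d::finite \<Rightarrow> complex ^ 'n ^ 'n) \<Rightarrow> bool" where
  "row_contraction R \<longleftrightarrow> sqrt (op_norm (\<Sum>i\<in>UNIV. R i ** conj_transpose (R i))) \<le> 1"

definition jointly_similar ::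
  "('d::finite \<Rightarrow> complex ^ 'n ^ 'n) \<Rightarrow> ('d \<Rightarrow> complex ^ 'n ^ 'n) \<Rightarrow> bool" where
  "jointly_similar T R \<longleftrightarrow> (\<exists>S. invertible S \<and> (\<forall>i. T i = S ** R i ** matrix_inv S))"

definition commuting_tuple :: "('d::finite \<Rightarrow> complex ^ 'n ^ 'n) \<Rightarrow> bool" where
  "commuting_tuple T \<longleftrightarrow> (\<forall>i j. T i ** T j = T j ** T i)"

text \<open>The operation \<open>*\<close> on \<open>complex ^ 'n ^ 'n\<close> is entrywise, so \<open>^\<close> is not the matrix power.\<close>

definition mat_power :: "complex ^ 'n ^ 'n \<Rightarrow> nat \<Rightarrow> complex ^ 'n ^ 'n" where
  "mat_power A k = (((**) A) ^^ k) (mat 1)"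

text \<open>
  \<open>p(T)\<close> for a commuting tuple \<open>T\<close>. The fold is the product of the powers of the \<open>T\<^sub>i\<close> taken in
  any order; \<open>mat c\<close> is the scalar matrix \<open>c I\<close>.
\<close>

definition poly_mat :: "'d::finite cpoly \<Rightarrow> ('d \<Rightarrow> complex ^ 'n ^ 'n) \<Rightarrow> complex ^ 'n ^ 'n" where
  "poly_mat p T =
     (\<Sum>m\<in>Poly_Mapping.keys p. mat (Poly_Mapping.lookup p m) **
        Finite_Set.fold (\<lambda>i B. mat_power (T i) (Poly_Mapping.lookup m i) ** B) (mat 1) UNIV)"

text \<open>
  Bounded unital homomorphisms from an algebra \<open>A\<close> of functions on the ball, normed by \<open>N\<close>, to
  matrices. Values outside \<open>A\<close> are fixed by extensionality, so that equality of representations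
  is equality on \<open>A\<close>.
\<close>

definition bounded_unital_reps ::
  "(complex ^ 'd \<Rightarrow> complex) set \<Rightarrow> ((complex ^ 'd \<Rightarrow> complex) \<Rightarrow> real) \<Rightarrow>
    ((complex ^ 'd \<Rightarrow> complex) \<Rightarrow> complex ^ 'n ^ 'n) set" where
  "bounded_unital_reps A N =
     {\<pi> \<in> extensional A.
        (\<forall>f\<in>A. \<forall>g\<in>A. \<pi> (\<lambda>z. f z + g z) = \<pi> f + \<pi> g) \<and>
        (\<forall>f\<in>A. \<forall>c. \<pi> (\<lambda>z. c * f z) = mat c ** \<pi> f) \<and>
        (\<forall>f\<in>A. \<forall>g\<in>A. \<pi> (\<lambda>z. f z * g z) = \<pi> f ** \<pi> g) \<and>
        \<pi> (one_on unit_ball) = mat 1 \<and>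
        (\<exists>C. \<forall>f\<in>A. op_norm (\<pi> f) \<le> C * N f)}"



definition represents ::
  "('d::finite \<Rightarrow> complex ^ 'n ^ 'n) \<Rightarrow> ((complex ^ 'd \<Rightarrow> complex) \<Rightarrow> complex ^ 'n ^ 'n) \<Rightarrow> bool" where
  "represents T \<pi> \<longleftrightarrow>
     commuting_tuple T \<and> (\<exists>R. row_contraction R \<and> jointly_similar T R) \<and>
     (\<forall>p. \<pi> (poly_on_ball p) = poly_mat p T)"

end

theory Submission
  imports Defs "HOL-Complex_Analysis.Conformal_Mappings"
begin

text \<open>
  Write \<open>\<langle>z, u\<rangle> = \<Sum> z\<^sub>i cnj u\<^sub>i\<close>. A bounded unital representation \<open>\<pi>\<close> of either algebra is
  determined by the commuting tuple \<open>T\<^sub>i = \<pi> z\<^sub>i\<close>, because the polynomials are dense, and everything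
  about \<open>T\<close> follows from one growth estimate: for unit vectors \<open>u\<close>, the norm of
  \<open>\<langle>T, u\<rangle> ^ n = \<pi> (\<langle>z, u\<rangle> ^ n)\<close> is bounded, uniformly in \<open>u\<close>, by a sequence of order \<open>o(\<surd>n)\<close>
  (\<open>slow_growth\<close>).

  For the ball algebra the estimate is clear, since \<open>\<langle>z, u\<rangle>\<close> has modulus less than 1. For the closure of
  the polynomials in the multipliers, the binomial series writes the kernel as
  \<open>\<Sum> c\<^sub>m \<langle>z, w\<rangle> ^ m\<close> with positive \<open>c\<^sub>m = (a)\<^sub>m / m!\<close>, and
  \<open>\<langle>z, w\<rangle> ^ n - \<langle>z, u\<rangle> ^ n cnj (\<langle>w, u\<rangle> ^ n)\<close> is a positive kernel. Hence the square of the multiplier norm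
  of \<open>\<langle>z, u\<rangle> ^ n\<close> is at most the supremum of \<open>c\<^sub>m / c\<^sub>m\<^sub>+\<^sub>n\<close> over \<open>m\<close>, which is \<open>n! / (min a 1)\<^sub>n\<close>
  and grows more slowly than \<open>n\<close> for every \<open>a > 0\<close>
  (\<open>linear_form_power_multiplier\<close>, \<open>growth_little_o\<close>).

  Linear algebra translates the estimate into the structure of \<open>T\<close>. The space splits into \<open>T\<close>-invariant
  subspaces on each of which all \<open>T\<^sub>i - \<lambda>\<^sub>i\<close> are nilpotent (\<open>primary_induct\<close>). Slow growth forces
  \<open>norm \<lambda> \<le> 1\<close>. If \<open>norm \<lambda> = 1\<close>, then \<open>T = \<lambda>\<close> on the subspace: a nilpotent part in the direction of
  \<open>\<lambda>\<close> would let the powers grow like \<open>n\<close>, and a nilpotent part orthogonal to \<open>\<lambda>\<close> would let them grow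
  like \<open>\<surd>n\<close> once \<open>u\<close> is tilted away from \<open>\<lambda>\<close> by the angle \<open>1/\<surd>n\<close>
  (\<open>sphere_eigenvalue_semisimple\<close>). If \<open>norm \<lambda> < 1\<close>, a triangular basis can be rescaled until the
  off-diagonal entries are as small as desired. Therefore \<open>T\<close> is similar to a row contraction
  (\<open>similar_to_row_contraction\<close>). The same dichotomy bounds \<open>p(T)\<close> by the supremum of \<open>p\<close> over the ball
  (\<open>bounded_calculus\<close>): on a subspace with \<open>norm \<lambda> = 1\<close> it is the scalar \<open>p(\<lambda>)\<close>, and with
  \<open>norm \<lambda> < 1\<close> it depends on finitely many Taylor coefficients of \<open>p\<close> at the interior point \<open>\<lambda>\<close>.

  Since the polynomials are dense in the ball algebra (\<open>polynomials_dense_in_ball_algebra\<close>), this bound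
  extends \<open>p \<mapsto> p(T)\<close> to a bounded representation of the ball algebra, in exactly one way. Conversely, the
  multiplier norm dominates the supremum norm, so multiplier norm limits of polynomials lie in the ball
  algebra, and representations of the ball algebra restrict to bounded representations.
\<close>

section \<open>Polynomial functions and their values at a tuple of matrices\<close>

definition poly_eval :: "'d::finite cpoly \<Rightarrow> complex ^ 'd \<Rightarrow> complex" where
  "poly_eval p z = (\<Sum>m\<in>Poly_Mapping.keys p. Poly_Mapping.lookup p m * (\<Prod>i\<in>UNIV. (z $ i) ^ Poly_Mapping.lookup m i))"

lemma poly_on_ball_eq: "poly_on_ball p = (\<lambda>z. if z \<in> unit_ball then poly_eval p z else 0)"
  unfolding poly_on_ball_def poly_eval_def by simp

text \<open>
  The pairs \<open>(f, f(T))\<close> for polynomial functions \<open>f\<close>, generated by the algebra operations. Statements about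
  \<open>f(T)\<close> are proved by induction over this generation. Two formally different expressions for the same
  function \<open>f\<close> might a priori give two matrices; this is why it is a relation and not a function.
\<close>

inductive poly_calculus ::
  "('d::finite \<Rightarrow> complex ^ 'n ^ 'n) \<Rightarrow> (complex ^ 'd \<Rightarrow> complex) \<Rightarrow> complex ^ 'n ^ 'n \<Rightarrow> bool" for T where
  const: "poly_calculus T (\<lambda>z. c) (mat c)"
| coord: "poly_calculus T (\<lambda>z. z $ i) (T i)"
| add: "poly_calculus T f A \<Longrightarrow> poly_calculus T g B \<Longrightarrow> poly_calculus T (\<lambda>z. f z + g z) (A + B)"
| mult: "poly_calculus T f A \<Longrightarrow> poly_calculus T g B \<Longrightarrow> poly_calculus T (\<lambda>z. f z * g z) (A ** B)"

lemma mat_comm: "mat c ** A = A ** (mat c :: complex ^ 'n ^ 'n)"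
  by (simp add: matrix_matrix_mult_def mat_def vec_eq_iff if_distrib if_distribR mult.commute cong: if_cong)

lemma mat_mult_component: "(mat c ** A) $ i $ j = c * (A::complex ^ 'n ^ 'n) $ i $ j"
  by (simp add: matrix_matrix_mult_def mat_def if_distrib if_distribR cong: if_cong)

lemma mat_mult_mat: "mat c ** mat d = (mat (c * d) :: complex ^ 'n ^ 'n)"
proof -
  have "(mat c ** mat d) $ i $ j = (mat (c * d) :: complex ^ 'n ^ 'n) $ i $ j" for i j
    unfolding mat_mult_component by (simp add: mat_def)
  then show ?thesis by (simp add: vec_eq_iff)
qed

lemma mat_add_mat: "mat c + mat d = (mat (c + d) :: complex ^ 'n ^ 'n)"
  by (simp add: vec_eq_iff mat_def)

lemma matrix_add_rdistrib: "(A + B) ** C = A ** C + B ** (C :: complex ^ 'p ^ 'n)"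
  by (vector matrix_matrix_mult_def sum.distrib[symmetric] distrib_right)

lemma matrix_diff_ldistrib: "A ** (B - C) = A ** B - A ** (C :: complex ^ 'p ^ 'n)"
  by (vector matrix_matrix_mult_def sum_subtractf[symmetric] right_diff_distrib)

lemma matrix_diff_rdistrib: "(A - B) ** C = A ** C - B ** (C :: complex ^ 'p ^ 'n)"
  by (vector matrix_matrix_mult_def sum_subtractf[symmetric] left_diff_distrib)

lemma poly_calculus_mat_power:
  "poly_calculus T f A \<Longrightarrow> poly_calculus T (\<lambda>z. f z ^ n) (mat_power A n)"
proof (induction n)
  case 0 then show ?case using poly_calculus.const[of T 1] by (simp add: mat_power_def)
next
  case (Suc n) then show ?case
    using poly_calculus.mult[of T f A "\<lambda>z. f z ^ n" "mat_power A n"] by (simp add: mat_power_def)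
qed

lemma poly_calculus_sum:
  "finite I \<Longrightarrow> (\<And>i. i \<in> I \<Longrightarrow> poly_calculus T (f i) (A i)) \<Longrightarrow>
    poly_calculus T (\<lambda>z. \<Sum>i\<in>I. f i z) (\<Sum>i\<in>I. A i)"
proof (induction rule: finite_induct)
  case empty then show ?case using poly_calculus.const[of T 0] by simp
next
  case (insert x F) then show ?case
    using poly_calculus.add[of T "f x" "A x" "\<lambda>z. \<Sum>i\<in>F. f i z"] by simp
qed

lemma mat_power_commute:
  assumes "A ** B = B ** (A :: complex ^ 'n ^ 'n)"
  shows "mat_power A k ** mat_power B l = mat_power B l ** mat_power A k"
proof -
  have gen: "C ** mat_power A k = mat_power A k ** C" if "A ** C = C ** A" for A C :: "complex ^ 'n ^ 'n" and k
  proof (induction k)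
    case 0 show ?case by (simp add: mat_power_def)
  next
    case (Suc k)
    have "C ** mat_power A (Suc k) = (C ** A) ** mat_power A k" by (simp add: mat_power_def matrix_mul_assoc)
    also have "\<dots> = A ** (C ** mat_power A k)" by (simp add: that[symmetric] matrix_mul_assoc)
    also have "\<dots> = A ** (mat_power A k ** C)" by (simp only: Suc)
    also have "\<dots> = mat_power A (Suc k) ** C" by (simp add: mat_power_def matrix_mul_assoc)
    finally show ?case .
  qed
  show ?thesis by (rule gen[OF gen[OF assms]])
qed

lemma comp_fun_commute_mat_power:
  assumes T: "commuting_tuple T"
  shows "comp_fun_commute (\<lambda>i B. mat_power (T i) (m i) ** B)"
proof
  fix i j
  have "mat_power (T i) (m i) ** mat_power (T j) (m j) = mat_power (T j) (m j) ** mat_power (T i) (m i)"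
    using T by (intro mat_power_commute) (auto simp: commuting_tuple_def)
  then show "(**) (mat_power (T j) (m j)) \<circ> (**) (mat_power (T i) (m i))
      = (**) (mat_power (T i) (m i)) \<circ> (**) (mat_power (T j) (m j))"
    by (simp add: fun_eq_iff matrix_mul_assoc)
qed

text \<open>
  The fold in \<open>poly_mat\<close> is well behaved because the powers of the matrices commute.
\<close>

lemma poly_calculus_fold:
  assumes T: "commuting_tuple T" and "finite I"
  shows "poly_calculus T (\<lambda>z. \<Prod>i\<in>I. (z $ i) ^ m i)
     (Finite_Set.fold (\<lambda>i B. mat_power (T i) (m i) ** B) (mat 1) I)"
proof -
  interpret comp_fun_commute "\<lambda>i B. mat_power (T i) (m i) ** B" by (rule comp_fun_commute_mat_power[OF T])
  show ?thesis using \<open>finite I\<close>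
  proof (induction rule: finite_induct)
    case empty then show ?case using poly_calculus.const[of T 1] by simp
  next
    case (insert i I)
    then show ?case
      using poly_calculus.mult[OF poly_calculus_mat_power[OF poly_calculus.coord]] by simp
  qed
qed

lemma poly_calculus_poly:
  assumes T: "commuting_tuple T"
  shows "poly_calculus T (poly_eval p) (poly_mat p T)"
  unfolding poly_eval_def[abs_def] poly_mat_def
  by (intro poly_calculus_sum finite_keys poly_calculus.mult poly_calculus.const poly_calculus_fold T finite)

lemma poly_eval_single:
  "poly_eval (Poly_Mapping.single m c) z = c * (\<Prod>i\<in>UNIV. (z $ i) ^ Poly_Mapping.lookup m i)"
  unfolding poly_eval_def by (cases "c = 0") auto

lemma poly_eval_add: "poly_eval (p + q) z = poly_eval p z + poly_eval q z"
proof -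
  let ?K = "Poly_Mapping.keys p \<union> Poly_Mapping.keys q \<union> Poly_Mapping.keys (p + q)"
  have eq: "poly_eval r z = (\<Sum>m\<in>?K. Poly_Mapping.lookup r m * (\<Prod>i\<in>UNIV. (z $ i) ^ Poly_Mapping.lookup m i))"
    if "Poly_Mapping.keys r \<subseteq> ?K" for r
    unfolding poly_eval_def using that by (intro sum.mono_neutral_left) (auto simp: in_keys_iff)
  have sub: "Poly_Mapping.keys p \<subseteq> ?K" "Poly_Mapping.keys q \<subseteq> ?K" "Poly_Mapping.keys (p + q) \<subseteq> ?K"
    by auto
  show ?thesis
    unfolding eq[OF sub(1)] eq[OF sub(2)] eq[OF sub(3)] lookup_add distrib_right sum.distrib ..
qed

definition polynomial_fun :: "(complex ^ 'd::finite \<Rightarrow> complex) \<Rightarrow> bool" where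
  "polynomial_fun f \<longleftrightarrow> (\<exists>p. f = poly_eval p)"

lemma polynomial_fun_add:
  assumes "polynomial_fun f" "polynomial_fun g"
  shows "polynomial_fun (\<lambda>z. f z + g z)"
proof -
  obtain p q where "f = poly_eval p" "g = poly_eval q" using assms unfolding polynomial_fun_def by blast
  then have "(\<lambda>z. f z + g z) = poly_eval (p + q)" by (auto simp: poly_eval_add)
  then show ?thesis unfolding polynomial_fun_def by blast
qed

lemma polynomial_fun_monomial:
  "polynomial_fun (\<lambda>z. c * (\<Prod>i\<in>UNIV. (z $ i) ^ k i))"
proof -
  have "Poly_Mapping.lookup (Abs_poly_mapping k) = k" by (rule lookup_Abs_poly_mapping) simp
  then have "(\<lambda>z. c * (\<Prod>i\<in>UNIV. (z $ i) ^ k i)) = poly_eval (Poly_Mapping.single (Abs_poly_mapping k) c)"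
    unfolding poly_eval_single[abs_def] by simp
  then show ?thesis unfolding polynomial_fun_def by blast
qed

lemma polynomial_fun_const: "polynomial_fun (\<lambda>z. c)"
  using polynomial_fun_monomial[of c "\<lambda>_. 0"] by simp

lemma poly_eval_coord:
  fixes i :: "'d::finite"
  shows "poly_eval (Poly_Mapping.single (Poly_Mapping.single i 1) 1) = (\<lambda>z. z $ i)"
proof
  fix z :: "complex ^ 'd"
  have "(\<Prod>j\<in>UNIV. (z $ j) ^ Poly_Mapping.lookup (Poly_Mapping.single i 1) j) = (\<Prod>j\<in>UNIV. if j = i then z $ j else 1)"
    by (intro prod.cong refl) (simp add: lookup_single)
  then show "poly_eval (Poly_Mapping.single (Poly_Mapping.single i 1) 1) z = z $ i"
    by (simp add: poly_eval_single)
qed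

lemma polynomial_fun_coord: "polynomial_fun (\<lambda>z. z $ i)"
  unfolding polynomial_fun_def using poly_eval_coord[of i, symmetric] by (rule exI)

lemma polynomial_fun_sum:
  "finite I \<Longrightarrow> (\<And>i. i \<in> I \<Longrightarrow> polynomial_fun (f i)) \<Longrightarrow> polynomial_fun (\<lambda>z. \<Sum>i\<in>I. f i z)"
  by (induction rule: finite_induct) (simp_all add: polynomial_fun_const polynomial_fun_add)

text \<open>
  Polynomial functions are the finite sums of monomials, and a product of monomials is a monomial.
\<close>

lemma polynomial_fun_mult:
  assumes "polynomial_fun f" "polynomial_fun g"
  shows "polynomial_fun (\<lambda>z. f z * g z)"
proof -
  obtain p q where f: "f = poly_eval p" and g: "g = poly_eval q"
    using assms unfolding polynomial_fun_def by blast
  have "f z * g z = (\<Sum>m\<in>Poly_Mapping.keys p. \<Sum>l\<in>Poly_Mapping.keys q.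
      (Poly_Mapping.lookup p m * Poly_Mapping.lookup q l) *
      (\<Prod>i\<in>UNIV. (z $ i) ^ (Poly_Mapping.lookup m i + Poly_Mapping.lookup l i)))" for z
    unfolding f g poly_eval_def sum_product power_add prod.distrib
    by (intro sum.cong refl) (simp only: mult.assoc mult.commute mult.left_commute)
  then have "(\<lambda>z. f z * g z) = (\<lambda>z. \<Sum>m\<in>Poly_Mapping.keys p. \<Sum>l\<in>Poly_Mapping.keys q.
      (Poly_Mapping.lookup p m * Poly_Mapping.lookup q l) *
      (\<Prod>i\<in>UNIV. (z $ i) ^ (Poly_Mapping.lookup m i + Poly_Mapping.lookup l i)))" by (rule ext)
  then show ?thesis
    by (simp only:) (intro polynomial_fun_sum finite_keys polynomial_fun_monomial)
qed

lemma polynomial_fun_power: "polynomial_fun f \<Longrightarrow> polynomial_fun (\<lambda>z. f z ^ n)"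
  by (induction n) (simp_all add: polynomial_fun_const polynomial_fun_mult)

lemma polynomial_fun_prod:
  "finite I \<Longrightarrow> (\<And>i. i \<in> I \<Longrightarrow> polynomial_fun (f i)) \<Longrightarrow> polynomial_fun (\<lambda>z. \<Prod>i\<in>I. f i z)"
  by (induction rule: finite_induct) (simp_all add: polynomial_fun_const polynomial_fun_mult)

lemma polynomial_fun_if_calculus: "poly_calculus T f A \<Longrightarrow> polynomial_fun f"
  by (induction rule: poly_calculus.induct)
    (simp_all add: polynomial_fun_const polynomial_fun_coord polynomial_fun_add polynomial_fun_mult)

lemma poly_calculus_if_polynomial_fun:
  "polynomial_fun f \<Longrightarrow> commuting_tuple T \<Longrightarrow> \<exists>A. poly_calculus T f A"
  unfolding polynomial_fun_def using poly_calculus_poly by blast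

lemma poly_mat_coord:
  fixes T :: "'d::finite \<Rightarrow> complex ^ 'n ^ 'n"
  assumes T: "commuting_tuple T"
  shows "poly_mat (Poly_Mapping.single (Poly_Mapping.single i 1) 1) T = T i"
proof -
  let ?m = "Poly_Mapping.lookup (Poly_Mapping.single i (1::nat))"
  interpret comp_fun_commute "\<lambda>i B. mat_power (T i) (?m i) ** B" by (rule comp_fun_commute_mat_power[OF T])
  have "Finite_Set.fold (\<lambda>i B. mat_power (T i) (?m i) ** B) (mat 1) I = (if i \<in> I then T i else mat 1)"
    if "finite I" for I using that
  proof (induction rule: finite_induct)
    case empty then show ?case by simp
  next
    case (insert j I)
    show ?case unfolding fold_insert[OF insert.hyps] insert.IH
      using insert.hyps by (cases "j = i") (auto simp: lookup_single mat_power_def)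
  qed
  from this[of UNIV] show ?thesis unfolding poly_mat_def by simp
qed

section \<open>Reproducing kernel Hilbert spaces and multipliers\<close>

text \<open>
  Finite sums of kernels \<open>f z * cnj (f w)\<close>. They are positive semidefinite, and expanding a product of two
  such sums shows that it is again of this form.
\<close>

inductive sos_kernel :: "('x \<Rightarrow> 'x \<Rightarrow> complex) \<Rightarrow> bool" where
  zero: "sos_kernel (\<lambda>z w. 0)"
| step: "sos_kernel L \<Longrightarrow> sos_kernel (\<lambda>z w. f z * cnj (f w) + L z w)"

lemma sos_kernel_single: "sos_kernel (\<lambda>z w. f z * cnj (f w))"
  using sos_kernel.step[OF sos_kernel.zero, of f] by simp

lemma sos_kernel_add: "sos_kernel L \<Longrightarrow> sos_kernel L' \<Longrightarrow> sos_kernel (\<lambda>z w. L z w + L' z w)"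
proof (induction rule: sos_kernel.induct)
  case zero then show ?case by simp
next
  case (step L f)
  then show ?case using sos_kernel.step[of "\<lambda>z w. L z w + L' z w" f] by (simp add: add.assoc)
qed

lemma sos_kernel_mult_single:
  "sos_kernel L \<Longrightarrow> sos_kernel (\<lambda>z w. (f z * cnj (f w)) * L z w)"
proof (induction rule: sos_kernel.induct)
  case zero then show ?case using sos_kernel.zero by simp
next
  case (step L g)
  then show ?case using sos_kernel.step[of "\<lambda>z w. f z * cnj (f w) * L z w" "\<lambda>z. f z * g z"]
    by (simp add: algebra_simps)
qed

lemma sos_kernel_mult: "sos_kernel L \<Longrightarrow> sos_kernel L' \<Longrightarrow> sos_kernel (\<lambda>z w. L z w * L' z w)"
proof (induction rule: sos_kernel.induct)
  case zero then show ?case using sos_kernel.zero by simp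
next
  case (step L f)
  then show ?case
    using sos_kernel_add[OF sos_kernel_mult_single[of L' f], of "\<lambda>z w. L z w * L' z w"]
    by (simp add: algebra_simps)
qed

lemma sos_kernel_const: "c \<ge> 0 \<Longrightarrow> sos_kernel (\<lambda>z w. of_real c)"
  using sos_kernel_single[of "\<lambda>z. of_real (sqrt c)"] by (simp flip: of_real_mult)

lemma sos_kernel_scale: "c \<ge> 0 \<Longrightarrow> sos_kernel L \<Longrightarrow> sos_kernel (\<lambda>z w. of_real c * L z w)"
  using sos_kernel_mult[OF sos_kernel_const] by blast

lemma sos_kernel_power: "sos_kernel L \<Longrightarrow> sos_kernel (\<lambda>z w. L z w ^ n)"
  by (induction n) (use sos_kernel_const[of 1] sos_kernel_mult in auto)

lemma sos_kernel_sum: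
  "finite I \<Longrightarrow> (\<And>i. i \<in> I \<Longrightarrow> sos_kernel (L i)) \<Longrightarrow> sos_kernel (\<lambda>z w. \<Sum>i\<in>I. L i z w)"
  by (induction rule: finite_induct) (auto intro: sos_kernel.zero sos_kernel_add)

text \<open>
  \<open>Q ^ Suc n - x ^ Suc n = Q (Q ^ n - x ^ n) + (Q - x) x ^ n\<close>
\<close>

lemma sos_kernel_power_diff:
  assumes "sos_kernel x" "sos_kernel (\<lambda>z w. Q z w - x z w)"
  shows "sos_kernel (\<lambda>z w. Q z w ^ n - x z w ^ n)"
proof (induction n)
  case 0 then show ?case using sos_kernel.zero by simp
next
  case (Suc n)
  have Q: "sos_kernel Q" using sos_kernel_add[OF assms] by simp
  have "sos_kernel (\<lambda>z w. Q z w * (Q z w ^ n - x z w ^ n) + (Q z w - x z w) * x z w ^ n)"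
    by (intro sos_kernel_add sos_kernel_mult[OF Q Suc] sos_kernel_mult[OF assms(2)] sos_kernel_power assms)
  then show ?case by (simp add: algebra_simps)
qed

definition kernel_form :: "('x \<Rightarrow> 'x \<Rightarrow> complex) \<Rightarrow> 'x set \<Rightarrow> ('x \<Rightarrow> complex) \<Rightarrow> complex" where
  "kernel_form L F c = (\<Sum>z\<in>F. \<Sum>w\<in>F. cnj (c z) * L z w * c w)"

lemma kernel_form_sos_nonneg:
  "sos_kernel L \<Longrightarrow> 0 \<le> Re (kernel_form L F c)"
proof (induction rule: sos_kernel.induct)
  case zero then show ?case by (simp add: kernel_form_def)
next
  case (step L f)
  let ?s = "\<Sum>z\<in>F. cnj (c z) * f z"
  have "kernel_form (\<lambda>z w. f z * cnj (f w) + L z w) F c = ?s * cnj ?s + kernel_form L F c"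
    unfolding kernel_form_def cnj_sum sum_product
    by (simp add: algebra_simps sum.distrib)
  moreover have "0 \<le> Re (?s * cnj ?s)" by (simp add: complex_mult_cnj del: cnj_sum)
  ultimately show ?case using step by simp
qed

locale rkhs =
  fixes X :: "'x set" and K :: "'x \<Rightarrow> 'x \<Rightarrow> complex" and H :: "('x \<Rightarrow> complex) set"
    and ip :: "('x \<Rightarrow> complex) \<Rightarrow> ('x \<Rightarrow> complex) \<Rightarrow> complex"
  assumes rkhs: "is_rkhs X K H ip"
begin

abbreviation kf :: "'x \<Rightarrow> 'x \<Rightarrow> complex" where
  "kf w \<equiv> (\<lambda>z. if z \<in> X then K z w else 0)"

abbreviation nrm :: "('x \<Rightarrow> complex) \<Rightarrow> real" where "nrm \<equiv> ip_norm ip"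

lemma zero_mem: "(\<lambda>z. 0) \<in> H"
  and lin_mem: "f \<in> H \<Longrightarrow> g \<in> H \<Longrightarrow> (\<lambda>z. c * f z + g z) \<in> H"
  and vanish: "f \<in> H \<Longrightarrow> z \<notin> X \<Longrightarrow> f z = 0"
  and kf_mem: "w \<in> X \<Longrightarrow> kf w \<in> H"
  and repro: "w \<in> X \<Longrightarrow> f \<in> H \<Longrightarrow> ip f (kf w) = f w"
  and ip_lin: "f \<in> H \<Longrightarrow> g \<in> H \<Longrightarrow> h \<in> H \<Longrightarrow> ip (\<lambda>z. c * f z + g z) h = c * ip f h + ip g h"
  and ip_swap: "f \<in> H \<Longrightarrow> g \<in> H \<Longrightarrow> ip g f = cnj (ip f g)"
  and ip_nonneg: "f \<in> H \<Longrightarrow> 0 \<le> Re (ip f f)"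
  and ip_definite: "f \<in> H \<Longrightarrow> ip f f = 0 \<Longrightarrow> f = (\<lambda>z. 0)"
  and complete: "ip_complete H ip"
proof -
  note d = rkhs[unfolded is_rkhs_def complex_inner_product_def functions_on_def]
  show "(\<lambda>z. 0) \<in> H" "f \<in> H \<Longrightarrow> g \<in> H \<Longrightarrow> (\<lambda>z. c * f z + g z) \<in> H"
    "f \<in> H \<Longrightarrow> z \<notin> X \<Longrightarrow> f z = 0" "w \<in> X \<Longrightarrow> kf w \<in> H"
    "f \<in> H \<Longrightarrow> g \<in> H \<Longrightarrow> h \<in> H \<Longrightarrow> ip (\<lambda>z. c * f z + g z) h = c * ip f h + ip g h"
    "f \<in> H \<Longrightarrow> g \<in> H \<Longrightarrow> ip g f = cnj (ip f g)"
    "f \<in> H \<Longrightarrow> 0 \<le> Re (ip f f)"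
    "f \<in> H \<Longrightarrow> ip f f = 0 \<Longrightarrow> f = (\<lambda>z. 0)"
    "ip_complete H ip"
    using d by blast+
  show "w \<in> X \<Longrightarrow> f \<in> H \<Longrightarrow> ip f (kf w) = f w"
    using d by metis
qed

lemma scale_mem: "f \<in> H \<Longrightarrow> (\<lambda>z. c * f z) \<in> H"
  using lin_mem[OF _ zero_mem, of f c] by simp

lemma add_mem: "f \<in> H \<Longrightarrow> g \<in> H \<Longrightarrow> (\<lambda>z. f z + g z) \<in> H"
  using lin_mem[of f g 1] by simp

lemma diff_mem: "f \<in> H \<Longrightarrow> g \<in> H \<Longrightarrow> (\<lambda>z. f z - g z) \<in> H"
  using lin_mem[of g f "-1"] by simp

lemma ip_zero_left: "f \<in> H \<Longrightarrow> ip (\<lambda>z. 0) f = 0"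
  using ip_lin[OF zero_mem zero_mem, of f 1] by simp

lemma ip_add_left: "f \<in> H \<Longrightarrow> g \<in> H \<Longrightarrow> h \<in> H \<Longrightarrow> ip (\<lambda>z. f z + g z) h = ip f h + ip g h"
  using ip_lin[of f g h 1] by simp

lemma ip_scale_left: "f \<in> H \<Longrightarrow> h \<in> H \<Longrightarrow> ip (\<lambda>z. c * f z) h = c * ip f h"
  using ip_lin[OF _ zero_mem, of f h c] ip_zero_left by simp

lemma ip_diff_left: "f \<in> H \<Longrightarrow> g \<in> H \<Longrightarrow> h \<in> H \<Longrightarrow> ip (\<lambda>z. f z - g z) h = ip f h - ip g h"
  using ip_lin[of g f h "-1"] by simp

lemma ip_zero_right: "f \<in> H \<Longrightarrow> ip f (\<lambda>z. 0) = 0"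
  using ip_swap[OF zero_mem, of f] ip_zero_left by simp

lemma ip_add_right: "f \<in> H \<Longrightarrow> g \<in> H \<Longrightarrow> h \<in> H \<Longrightarrow> ip h (\<lambda>z. f z + g z) = ip h f + ip h g"
  using ip_add_left[of f g h] ip_swap[OF add_mem[of f g], of h] ip_swap[of f h] ip_swap[of g h] by simp

lemma ip_scale_right: "f \<in> H \<Longrightarrow> h \<in> H \<Longrightarrow> ip h (\<lambda>z. c * f z) = cnj c * ip h f"
  using ip_scale_left[of f h c] ip_swap[OF scale_mem[of f c], of h] ip_swap[of f h] by simp

lemma ip_diff_right: "f \<in> H \<Longrightarrow> g \<in> H \<Longrightarrow> h \<in> H \<Longrightarrow> ip h (\<lambda>z. f z - g z) = ip h f - ip h g"
  using ip_diff_left[of f g h] ip_swap[OF diff_mem[of f g], of h] ip_swap[of f h] ip_swap[of g h] by simp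

lemma nrm_nonneg: "f \<in> H \<Longrightarrow> 0 \<le> nrm f"
  unfolding ip_norm_def using ip_nonneg by simp

lemma ip_self: "f \<in> H \<Longrightarrow> ip f f = of_real ((nrm f)\<^sup>2)"
proof -
  assume f: "f \<in> H"
  have "Im (ip f f) = 0" using arg_cong[OF ip_swap[OF f f], of Im] by simp
  then show ?thesis unfolding ip_norm_def using ip_nonneg[OF f] by (simp add: complex_eq_iff)
qed

lemma nrm_sq: "f \<in> H \<Longrightarrow> (nrm f)\<^sup>2 = Re (ip f f)"
  unfolding ip_norm_def using ip_nonneg by simp

lemma nrm_scale: "f \<in> H \<Longrightarrow> nrm (\<lambda>z. c * f z) = cmod c * nrm f"
proof -
  assume f: "f \<in> H"
  have "ip (\<lambda>z. c * f z) (\<lambda>z. c * f z) = (c * cnj c) * ip f f"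
    using ip_scale_left[OF f scale_mem[OF f], of c c] ip_scale_right[OF f f, of c] by simp
  also have "\<dots> = of_real ((cmod c * nrm f)\<^sup>2)"
    unfolding ip_self[OF f] complex_norm_square[symmetric] by (simp add: power_mult_distrib)
  finally have "(nrm (\<lambda>z. c * f z))\<^sup>2 = (cmod c * nrm f)\<^sup>2"
    using nrm_sq[OF scale_mem[OF f]] by simp
  then show ?thesis using nrm_nonneg[OF f] nrm_nonneg[OF scale_mem[OF f]] by (simp add: power2_eq_iff_nonneg)
qed

lemma cauchy_schwarz:
  assumes f: "f \<in> H" and g: "g \<in> H"
  shows "cmod (ip f g) \<le> nrm f * nrm g"
proof (cases "nrm g = 0")
  case True
  then have "g = (\<lambda>z. 0)" using ip_self[OF g] ip_definite[OF g] by simp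
  then show ?thesis using ip_zero_right[OF f] nrm_nonneg[OF f] nrm_nonneg[OF g] by simp
next
  case False
  then have pos: "nrm g > 0" using nrm_nonneg[OF g] by simp
  define t where "t = ip f g / ip g g"
  define h where "h = (\<lambda>z. f z - t * g z)"
  have tg: "(\<lambda>z. t * g z) \<in> H" by (rule scale_mem[OF g])
  have h: "h \<in> H" unfolding h_def by (rule diff_mem[OF f tg])
  have gg: "ip g g \<noteq> 0" using ip_self[OF g] pos by simp
  have hg: "ip h g = 0"
    using ip_diff_left[OF f tg g] ip_scale_left[OF g g, of t] gg by (simp add: h_def) (simp add: t_def)
  have "ip h h = ip h f - cnj t * ip h g"
    unfolding h_def[of] using ip_diff_right[OF f tg h] ip_scale_right[OF g h] by (simp add: h_def)
  also have "\<dots> = ip f f - t * ip g f"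
    unfolding hg using ip_diff_left[OF f tg f] ip_scale_left[OF g f] by (simp add: h_def)
  also have "t * ip g f = of_real ((cmod (ip f g))\<^sup>2 / (nrm g)\<^sup>2)"
    unfolding t_def ip_swap[OF f g] ip_self[OF g] complex_norm_square of_real_divide by simp
  finally have "0 \<le> (nrm f)\<^sup>2 - (cmod (ip f g))\<^sup>2 / (nrm g)\<^sup>2"
    using ip_nonneg[OF h] ip_self[OF f] by simp
  then have "(cmod (ip f g))\<^sup>2 \<le> (nrm f * nrm g)\<^sup>2" using pos by (simp add: field_simps)
  then show ?thesis by (rule power2_le_imp_le) (use nrm_nonneg[OF f] pos in simp)
qed

lemma nrm_add_sq:
  assumes f: "f \<in> H" and g: "g \<in> H"
  shows "(nrm (\<lambda>z. f z + g z))\<^sup>2 = (nrm f)\<^sup>2 + 2 * Re (ip f g) + (nrm g)\<^sup>2"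
  unfolding nrm_sq[OF add_mem[OF f g]] ip_add_left[OF f g add_mem[OF f g]]
    ip_add_right[OF f g f] ip_add_right[OF f g g] ip_swap[OF f g] ip_self[OF f] ip_self[OF g]
  by simp

lemma nrm_diff_sq:
  assumes f: "f \<in> H" and g: "g \<in> H"
  shows "(nrm (\<lambda>z. f z - g z))\<^sup>2 = (nrm f)\<^sup>2 - 2 * Re (ip f g) + (nrm g)\<^sup>2"
  unfolding nrm_sq[OF diff_mem[OF f g]] ip_diff_left[OF f g diff_mem[OF f g]]
    ip_diff_right[OF f g f] ip_diff_right[OF f g g] ip_swap[OF f g] ip_self[OF f] ip_self[OF g]
  by simp

lemma nrm_triangle:
  assumes f: "f \<in> H" and g: "g \<in> H"
  shows "nrm (\<lambda>z. f z + g z) \<le> nrm f + nrm g"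
proof -
  have "Re (ip f g) \<le> nrm f * nrm g"
    using cauchy_schwarz[OF f g] complex_Re_le_cmod order_trans by blast
  then have "(nrm (\<lambda>z. f z + g z))\<^sup>2 \<le> (nrm f + nrm g)\<^sup>2"
    unfolding nrm_add_sq[OF f g] by (simp add: power2_sum)
  then show ?thesis by (rule power2_le_imp_le) (use nrm_nonneg[OF f] nrm_nonneg[OF g] in simp)
qed

end

context rkhs begin

text \<open>
  The pairs \<open>(x, l)\<close> of a linear combination \<open>x\<close> of kernel functions and the value \<open>l\<close> that the inner
  product of \<open>h\<close> with \<open>x\<close> must have, by the reproducing property, if \<open>h\<close> lies in the space.
\<close>

definition span_values :: "('x \<Rightarrow> complex) \<Rightarrow> (('x \<Rightarrow> complex) \<times> complex) set" where
  "span_values h = {(x, l). \<exists>F c. finite F \<and> F \<subseteq> X \<and>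
     x = (\<lambda>z. \<Sum>w\<in>F. c w * kf w z) \<and> l = (\<Sum>w\<in>F. cnj (c w) * h w)}"

lemma span_values_combine:
  assumes "(x, l) \<in> span_values h" "(y, m) \<in> span_values h"
  shows "((\<lambda>z. t * x z + y z), cnj t * l + m) \<in> span_values h"
proof -
  obtain F c where F: "finite F" "F \<subseteq> X" "x = (\<lambda>z. \<Sum>w\<in>F. c w * kf w z)" "l = (\<Sum>w\<in>F. cnj (c w) * h w)"
    using assms(1) unfolding span_values_def by blast
  obtain G d where G: "finite G" "G \<subseteq> X" "y = (\<lambda>z. \<Sum>w\<in>G. d w * kf w z)" "m = (\<Sum>w\<in>G. cnj (d w) * h w)"
    using assms(2) unfolding span_values_def by blast
  define e where "e w = t * (if w \<in> F then c w else 0) + (if w \<in> G then d w else 0)" for w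
  have xF: "(\<Sum>w\<in>F. c w * u w) = (\<Sum>w\<in>F \<union> G. (if w \<in> F then c w else 0) * u w)" for u
    using F(1) G(1) by (intro sum.mono_neutral_cong_left) auto
  have yG: "(\<Sum>w\<in>G. d w * u w) = (\<Sum>w\<in>F \<union> G. (if w \<in> G then d w else 0) * u w)" for u
    using F(1) G(1) by (intro sum.mono_neutral_cong_left) auto
  have xF': "(\<Sum>w\<in>F. cnj (c w) * u w) = (\<Sum>w\<in>F \<union> G. cnj (if w \<in> F then c w else 0) * u w)" for u
    using F(1) G(1) by (intro sum.mono_neutral_cong_left) auto
  have yG': "(\<Sum>w\<in>G. cnj (d w) * u w) = (\<Sum>w\<in>F \<union> G. cnj (if w \<in> G then d w else 0) * u w)" for u
    using F(1) G(1) by (intro sum.mono_neutral_cong_left) auto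
  have "(\<lambda>z. t * x z + y z) = (\<lambda>z. \<Sum>w\<in>F \<union> G. e w * kf w z)"
    unfolding F(3) G(3) xF yG e_def sum_distrib_left sum.distrib[symmetric]
    by (intro ext sum.cong refl) (simp only: distrib_right mult.assoc)
  moreover have "cnj t * l + m = (\<Sum>w\<in>F \<union> G. cnj (e w) * h w)"
    unfolding F(4) G(4) xF' yG' e_def sum_distrib_left sum.distrib[symmetric]
    by (intro sum.cong refl) (simp only: distrib_right mult.assoc complex_cnj_add complex_cnj_mult)
  ultimately show ?thesis unfolding span_values_def using F(1,2) G(1,2) by blast
qed

lemma span_values_kf: "w \<in> X \<Longrightarrow> (kf w, h w) \<in> span_values h"
  unfolding span_values_def mem_Collect_eq case_prod_conv
  by (rule exI[of _ "{w}"], rule exI[of _ "\<lambda>_. 1"]) auto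

lemma span_values_zero: "((\<lambda>z. 0), 0) \<in> span_values h"
  unfolding span_values_def mem_Collect_eq case_prod_conv by (rule exI[of _ "{}"]) auto

lemma sum_kf_mem: "finite F \<Longrightarrow> F \<subseteq> X \<Longrightarrow> (\<lambda>z. \<Sum>w\<in>F. c w * kf w z) \<in> H"
proof (induction rule: finite_induct)
  case empty then show ?case using zero_mem by simp
next
  case (insert v F)
  then show ?case using lin_mem[OF kf_mem[of v], of "\<lambda>z. \<Sum>w\<in>F. c w * kf w z" "c v"] by simp
qed

lemma span_values_mem: "(x, l) \<in> span_values h \<Longrightarrow> x \<in> H"
  unfolding span_values_def using sum_kf_mem by blast

text \<open>
  A Riesz representation argument. The bound says that \<open>x \<mapsto> l\<close> is a bounded conjugate-linear functional on
  the combinations of kernel functions. A sequence of pairs that minimizes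
  \<open>(nrm x)\<^sup>2 - 2 * Re l\<close> is Cauchy by the parallelogram law, and its limit represents the functional.
  Testing the representation with kernel functions identifies the limit with \<open>h\<close>.
\<close>

lemma mem_if_bounded_on_kernels:
  assumes D: "D \<ge> 0" and hX: "\<And>z. z \<notin> X \<Longrightarrow> h z = 0"
    and bound: "\<And>F c. finite F \<Longrightarrow> F \<subseteq> X \<Longrightarrow>
       cmod (\<Sum>w\<in>F. cnj (c w) * h w) \<le> D * nrm (\<lambda>z. \<Sum>w\<in>F. c w * kf w z)"
  shows "h \<in> H" and "nrm h \<le> D"
proof -
  let ?V = "span_values h"
  have bd: "cmod l \<le> D * nrm x" if "(x, l) \<in> ?V" for x l
    using that bound unfolding span_values_def by blast
  define J where "J = (\<lambda>(x, l). (nrm x)\<^sup>2 - 2 * Re l)"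
  have J_ge: "J p \<ge> - D\<^sup>2" if "p \<in> ?V" for p
  proof -
    obtain x l where p: "p = (x, l)" by force
    have "Re l \<le> D * nrm x" using bd[of x l] that p complex_Re_le_cmod[of l] by simp
    moreover have "0 \<le> (nrm x - D)\<^sup>2" by simp
    ultimately show ?thesis unfolding p J_def by (simp add: power2_diff mult.commute[of D])
  qed
  define m where "m = Inf (J ` ?V)"
  have bdd: "bdd_below (J ` ?V)" using J_ge by (intro bdd_belowI2)
  have m_le: "m \<le> J p" if "p \<in> ?V" for p unfolding m_def using bdd that by (simp add: cINF_lower)
  have "\<exists>p\<in>?V. J p < m + 1 / real (Suc n)" for n
  proof -
    have "J ` ?V \<noteq> {}" using span_values_zero by blast
    then have "\<exists>a\<in>J ` ?V. a < m + 1 / real (Suc n)"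
      unfolding m_def by (intro cInf_lessD) auto
    then show ?thesis by blast
  qed
  then obtain p where pV: "\<And>n. p n \<in> ?V" and pJ: "\<And>n. J (p n) < m + 1 / real (Suc n)" by metis
  define x where "x n = fst (p n)" for n
  define l where "l n = snd (p n)" for n
  have xl: "(x n, l n) \<in> ?V" for n using pV[of n] unfolding x_def l_def by simp
  have Jxl: "(nrm (x n))\<^sup>2 - 2 * Re (l n) < m + 1 / real (Suc n)" for n
    using pJ[of n] unfolding J_def x_def l_def by (simp add: case_prod_unfold)
  have xH: "x n \<in> H" for n using xl span_values_mem by blast
  have diff: "(nrm (\<lambda>z. x i z - x j z))\<^sup>2 \<le> 2 / real (Suc i) + 2 / real (Suc j)" for i j
  proof -
    have "((\<lambda>z. 1 * x i z + x j z), cnj 1 * l i + l j) \<in> ?V"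
      by (rule span_values_combine[OF xl xl])
    from span_values_combine[OF this span_values_zero, of "1/2"]
    have V: "((\<lambda>z. (1/2) * (x i z + x j z)), (1/2) * (l i + l j)) \<in> ?V" by simp
    have half: "nrm (\<lambda>z. (1/2) * (x i z + x j z)) = nrm (\<lambda>z. x i z + x j z) / 2"
      using nrm_scale[OF add_mem[OF xH[of i] xH[of j]], of "1/2"] by (simp del: times_divide_eq_left)
    have "m \<le> (nrm (\<lambda>z. x i z + x j z))\<^sup>2 / 4 - Re (l i + l j)"
      using m_le[OF V] unfolding J_def case_prod_conv half by (simp add: power_divide add_divide_distrib)
    moreover have "2 / real (Suc k) = 2 * (1 / real (Suc k))" for k by simp
    ultimately show ?thesis
      using Jxl[of i] Jxl[of j] unfolding nrm_add_sq[OF xH xH] nrm_diff_sq[OF xH xH] plus_complex.sel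
      by argo
  qed
  have cauchy: "\<exists>N. \<forall>i\<ge>N. \<forall>j\<ge>N. nrm (\<lambda>z. x i z - x j z) < e" if "e > 0" for e
  proof -
    obtain N where N: "4 / e\<^sup>2 < real N" using reals_Archimedean2 by blast
    have "nrm (\<lambda>z. x i z - x j z) < e" if "i \<ge> N" "j \<ge> N" for i j
    proof -
      have "0 < 4 / e\<^sup>2" using \<open>e > 0\<close> by simp
      then have Npos: "real N > 0" using N by linarith
      have "2 / real (Suc i) \<le> 2 / real N" "2 / real (Suc j) \<le> 2 / real N"
        using that Npos by (intro divide_left_mono; simp)+
      then have "(nrm (\<lambda>z. x i z - x j z))\<^sup>2 \<le> 4 / real N" using diff[of i j] by linarith
      also have "\<dots> < e\<^sup>2" using N Npos \<open>e > 0\<close> by (simp add: field_simps)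
      finally show ?thesis using \<open>e > 0\<close> by (simp add: power_less_imp_less_base)
    qed
    then show ?thesis by blast
  qed
  obtain g where g: "g \<in> H" and lim: "(\<lambda>n. nrm (\<lambda>z. x n z - g z)) \<longlonglongrightarrow> 0"
    using complete xH cauchy unfolding ip_complete_def by blast
  have ip_g: "ip g y = k" if yk: "(y, k) \<in> ?V" for y k
  proof (rule ccontr)
    assume neq: "ip g y \<noteq> k"
    have yH: "y \<in> H" using span_values_mem[OF yk] .
    define q where "q = k - ip g y"
    have limip: "(\<lambda>n. ip (x n) y) \<longlonglongrightarrow> ip g y"
    proof (rule LIM_zero_cancel, rule Lim_null_comparison)
      show "\<forall>\<^sub>F n in sequentially. cmod (ip (x n) y - ip g y) \<le> nrm (\<lambda>z. x n z - g z) * nrm y"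
        using cauchy_schwarz[OF diff_mem[OF xH g] yH] ip_diff_left[OF xH g yH] by simp
      show "(\<lambda>n. nrm (\<lambda>z. x n z - g z) * nrm y) \<longlonglongrightarrow> 0" using tendsto_mult_left_zero[OF lim] .
    qed
    have key: "2 * Re (cnj t * q) \<le> (cmod t)\<^sup>2 * (nrm y)\<^sup>2" for t
    proof (rule LIMSEQ_le)
      show "\<exists>N. \<forall>n\<ge>N. 2 * Re (cnj t * (k - ip (x n) y)) \<le> 1 / real (Suc n) + (cmod t)\<^sup>2 * (nrm y)\<^sup>2"
      proof (intro exI allI impI)
        fix n
        have V: "((\<lambda>z. t * y z + x n z), cnj t * k + l n) \<in> ?V" by (rule span_values_combine[OF yk xl])
        have "(nrm (\<lambda>z. t * y z + x n z))\<^sup>2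
            = (cmod t)\<^sup>2 * (nrm y)\<^sup>2 + 2 * Re (cnj t * ip (x n) y) + (nrm (x n))\<^sup>2"
          unfolding nrm_add_sq[OF scale_mem[OF yH] xH] nrm_scale[OF yH] ip_scale_left[OF yH xH]
            ip_swap[OF xH yH] by (simp add: power_mult_distrib)
        then show "2 * Re (cnj t * (k - ip (x n) y)) \<le> 1 / real (Suc n) + (cmod t)\<^sup>2 * (nrm y)\<^sup>2"
          using m_le[OF V] Jxl[of n] unfolding J_def by (simp add: algebra_simps)
      qed
      show "(\<lambda>n. 2 * Re (cnj t * (k - ip (x n) y))) \<longlonglongrightarrow> 2 * Re (cnj t * q)"
        unfolding q_def by (intro tendsto_intros limip)
      show "(\<lambda>n. 1 / real (Suc n) + (cmod t)\<^sup>2 * (nrm y)\<^sup>2) \<longlonglongrightarrow> (cmod t)\<^sup>2 * (nrm y)\<^sup>2"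
        using tendsto_add[OF LIMSEQ_inverse_real_of_nat tendsto_const, of "(cmod t)\<^sup>2 * (nrm y)\<^sup>2"]
        by (simp add: inverse_eq_divide)
    qed
    \<comment> \<open>The variation of the minimum in the direction \<open>q\<close>: a small step already violates minimality.\<close>
    define s where "s = 1 / ((nrm y)\<^sup>2 + 1)"
    have s: "s > 0" "s * (nrm y)\<^sup>2 < 1" using add_nonneg_pos[OF zero_le_power2[of "nrm y"] zero_less_one]
      unfolding s_def by (simp_all add: field_simps)
    have q0: "(cmod q)\<^sup>2 > 0" using neq unfolding q_def by auto
    have "Re (cnj (of_real s * q) * q) = s * (cmod q)\<^sup>2"
      by (simp add: cmod_power2) (simp add: power2_eq_square algebra_simps)
    then have "2 * (s * (cmod q)\<^sup>2) \<le> (s * (cmod q)\<^sup>2) * (s * (nrm y)\<^sup>2)"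
      using key[of "of_real s * q"] s(1)
      by (simp add: norm_mult power_mult_distrib power2_eq_square algebra_simps)
    moreover have "(s * (cmod q)\<^sup>2) * (s * (nrm y)\<^sup>2) \<le> (s * (cmod q)\<^sup>2) * 1"
      using s q0 by (intro mult_left_mono) auto
    ultimately show False using mult_pos_pos[OF s(1) q0] by linarith
  qed
  have "h = g"
  proof
    fix z show "h z = g z"
    proof (cases "z \<in> X")
      case True then show ?thesis using ip_g[OF span_values_kf[OF True]] repro[OF True g] by simp
    next
      case False then show ?thesis using hX vanish[OF g] by simp
    qed
  qed
  with g show "h \<in> H" by simp
  have "(nrm g)\<^sup>2 \<le> D * nrm g"
  proof (rule LIMSEQ_le_const)
    show "\<exists>N. \<forall>n\<ge>N. (nrm g)\<^sup>2 \<le> D * nrm g + (D + nrm g) * nrm (\<lambda>z. x n z - g z)"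
    proof (intro exI allI impI)
      fix n
      let ?d = "\<lambda>z. x n z - g z"
      have d: "?d \<in> H" by (rule diff_mem[OF xH g])
      have xn: "x n = (\<lambda>z. g z + ?d z)" by auto
      have "ip g g = l n - ip g ?d" using ip_g[OF xl] ip_diff_right[OF xH g g] by simp
      then have "cmod (ip g g) \<le> cmod (l n) + cmod (ip g ?d)" using norm_triangle_ineq4 by metis
      also have "\<dots> \<le> D * nrm (x n) + nrm g * nrm ?d"
        by (intro add_mono bd[OF xl] cauchy_schwarz[OF g d])
      also have "\<dots> \<le> D * (nrm g + nrm ?d) + nrm g * nrm ?d"
        using nrm_triangle[OF g d] D by (subst xn) (intro add_right_mono mult_left_mono)
      finally show "(nrm g)\<^sup>2 \<le> D * nrm g + (D + nrm g) * nrm ?d"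
        unfolding ip_self[OF g] by (simp add: algebra_simps norm_power)
    qed
    show "(\<lambda>n. D * nrm g + (D + nrm g) * nrm (\<lambda>z. x n z - g z)) \<longlonglongrightarrow> D * nrm g"
      using tendsto_add[OF tendsto_const tendsto_mult_right_zero[OF lim], of "D * nrm g" "D + nrm g"] by simp
  qed
  then have "nrm g \<le> D" using nrm_nonneg[OF g] D
    by (cases "nrm g = 0") (auto simp: power2_eq_square)
  then show "nrm h \<le> D" using \<open>h = g\<close> by simp
qed

lemma ip_sum_kf:
  assumes F: "finite F" "F \<subseteq> X" and f: "f \<in> H"
  shows "ip f (\<lambda>z. \<Sum>w\<in>F. c w * kf w z) = (\<Sum>w\<in>F. cnj (c w) * f w)"
  using F
proof (induction rule: finite_induct)
  case empty then show ?case using ip_zero_right[OF f] by simp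
next
  case (insert v F)
  then have v: "v \<in> X" and G: "(\<lambda>z. \<Sum>w\<in>F. c w * kf w z) \<in> H" using sum_kf_mem by auto
  show ?case using insert ip_add_right[OF scale_mem[OF kf_mem[OF v]] G f, of "c v"]
      ip_scale_right[OF kf_mem[OF v] f, of "c v"] repro[OF v f] by simp
qed

lemma nrm_sum_kf_sq:
  assumes F: "finite F" "F \<subseteq> X"
  shows "(nrm (\<lambda>z. \<Sum>w\<in>F. c w * kf w z))\<^sup>2 = Re (kernel_form K F c)"
proof -
  let ?x = "\<lambda>z. \<Sum>w\<in>F. c w * kf w z"
  have "ip ?x ?x = (\<Sum>z\<in>F. cnj (c z) * ?x z)" by (rule ip_sum_kf[OF F sum_kf_mem[OF F]])
  also have "\<dots> = kernel_form K F c"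
    unfolding kernel_form_def sum_distrib_left using F
    by (intro sum.cong refl) (auto simp: algebra_simps subset_iff)
  finally show ?thesis using nrm_sq[OF sum_kf_mem[OF F]] by simp
qed

text \<open>
  The adjoint of multiplication by \<open>\<phi>\<close> should send \<open>kf w\<close> to \<open>cnj (\<phi> w)\<close> times \<open>kf w\<close>. Positivity of
  the kernel says that this map is bounded by \<open>D\<close> on the combinations of kernel functions; so the inner product
  with \<open>\<phi> f\<close> is a bounded functional on them.
\<close>

lemma multiplier_if_kernel_nonneg:
  assumes D: "D \<ge> 0" and \<phi>: "\<phi> \<in> functions_on X"
    and psd: "\<And>F c. finite F \<Longrightarrow> F \<subseteq> X \<Longrightarrow>
       0 \<le> Re (kernel_form (\<lambda>z w. (of_real (D\<^sup>2) - \<phi> z * cnj (\<phi> w)) * K z w) F c)"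
    and f: "f \<in> H"
  shows "(\<lambda>z. \<phi> z * f z) \<in> H" and "nrm (\<lambda>z. \<phi> z * f z) \<le> D * nrm f"
proof -
  have D': "D * nrm f \<ge> 0" using D nrm_nonneg[OF f] by simp
  have v: "\<And>z. z \<notin> X \<Longrightarrow> \<phi> z * f z = 0" using vanish[OF f] by simp
  have bound: "cmod (\<Sum>w\<in>F. cnj (c w) * (\<phi> w * f w)) \<le> (D * nrm f) * nrm (\<lambda>z. \<Sum>w\<in>F. c w * kf w z)"
    if F: "finite F" "F \<subseteq> X" for F c
  proof -
    let ?x = "\<lambda>z. \<Sum>w\<in>F. c w * kf w z"
    let ?y = "\<lambda>z. \<Sum>w\<in>F. (c w * cnj (\<phi> w)) * kf w z"
    have "kernel_form (\<lambda>z w. (of_real (D\<^sup>2) - \<phi> z * cnj (\<phi> w)) * K z w) F c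
       = of_real (D\<^sup>2) * kernel_form K F c - kernel_form K F (\<lambda>w. c w * cnj (\<phi> w))"
      unfolding kernel_form_def sum_distrib_left sum_subtractf[symmetric]
      by (intro sum.cong refl) (simp add: algebra_simps)
    then have "(nrm ?y)\<^sup>2 \<le> (D * nrm ?x)\<^sup>2"
      using psd[OF F, of c] unfolding power_mult_distrib nrm_sum_kf_sq[OF F] by simp
    then have y: "nrm ?y \<le> D * nrm ?x"
      by (rule power2_le_imp_le) (use D nrm_nonneg[OF sum_kf_mem[OF F]] in simp)
    have "(\<Sum>w\<in>F. cnj (c w) * (\<phi> w * f w)) = ip f ?y"
      unfolding ip_sum_kf[OF F f] by (simp add: mult.assoc)
    also have "cmod \<dots> \<le> nrm f * nrm ?y" by (rule cauchy_schwarz[OF f sum_kf_mem[OF F]])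
    also have "\<dots> \<le> nrm f * (D * nrm ?x)" by (intro mult_left_mono y nrm_nonneg f)
    finally show ?thesis by (simp add: algebra_simps)
  qed
  show "(\<lambda>z. \<phi> z * f z) \<in> H" by (rule mem_if_bounded_on_kernels(1)[OF D' v bound])
  show "nrm (\<lambda>z. \<phi> z * f z) \<le> D * nrm f" by (rule mem_if_bounded_on_kernels(2)[OF D' v bound])
qed

abbreviation M :: "('x \<Rightarrow> complex) set" where "M \<equiv> multipliers X H ip"
abbreviation mnorm :: "('x \<Rightarrow> complex) \<Rightarrow> real" where "mnorm \<equiv> mult_norm H ip"

lemma mult_norm_le:
  assumes D: "D \<ge> 0" and "\<And>f. f \<in> H \<Longrightarrow> nrm (\<lambda>z. \<phi> z * f z) \<le> D * nrm f"
  shows "mnorm \<phi> \<le> D"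
  unfolding mult_norm_def
proof (rule cSUP_least)
  have "nrm (\<lambda>z. 0) = 0" unfolding ip_norm_def ip_zero_left[OF zero_mem] by simp
  then have "(\<lambda>z. 0) \<in> {f \<in> H. nrm f \<le> 1}" using zero_mem by simp
  then show "{f \<in> H. nrm f \<le> 1} \<noteq> {}" by blast
  fix f assume f: "f \<in> {f \<in> H. nrm f \<le> 1}"
  then have "nrm (\<lambda>z. \<phi> z * f z) \<le> D * nrm f" by (intro assms(2)) simp
  also have "\<dots> \<le> D * 1" using f D by (intro mult_left_mono) auto
  finally show "nrm (\<lambda>z. \<phi> z * f z) \<le> D" by simp
qed

lemma multiplier_mem: "\<phi> \<in> M \<Longrightarrow> f \<in> H \<Longrightarrow> (\<lambda>z. \<phi> z * f z) \<in> H"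
  unfolding multipliers_def by blast

lemma nrm_multiplier_le:
  assumes \<phi>: "\<phi> \<in> M" and f: "f \<in> H"
  shows "nrm (\<lambda>z. \<phi> z * f z) \<le> mnorm \<phi> * nrm f"
proof (cases "nrm f = 0")
  case True
  then have "f = (\<lambda>z. 0)" using ip_definite[OF f] ip_self[OF f] by simp
  then show ?thesis using True by simp
next
  case False
  then have pos: "nrm f > 0" using nrm_nonneg[OF f] by simp
  obtain C where C: "\<And>f. f \<in> H \<Longrightarrow> nrm (\<lambda>z. \<phi> z * f z) \<le> C * nrm f"
    using \<phi> unfolding multipliers_def by blast
  have bdd: "bdd_above ((\<lambda>f. nrm (\<lambda>z. \<phi> z * f z)) ` {f \<in> H. nrm f \<le> 1})"
  proof (rule bdd_aboveI2[where M = "\<bar>C\<bar>"])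
    fix f assume f: "f \<in> {f \<in> H. nrm f \<le> 1}"
    then have "nrm (\<lambda>z. \<phi> z * f z) \<le> C * nrm f" using C by simp
    also have "\<dots> \<le> \<bar>C\<bar> * 1" using f nrm_nonneg[of f] by (intro mult_mono) auto
    finally show "nrm (\<lambda>z. \<phi> z * f z) \<le> \<bar>C\<bar>" by simp
  qed
  define c where "c = complex_of_real (1 / nrm f)"
  have g: "(\<lambda>z. c * f z) \<in> {f \<in> H. nrm f \<le> 1}"
    using scale_mem[OF f, of c] nrm_scale[OF f, of c] pos by simp (simp add: c_def norm_divide)
  have "nrm (\<lambda>z. \<phi> z * (c * f z)) \<le> mnorm \<phi>"
    unfolding mult_norm_def using cSUP_upper[OF g bdd] by simp
  moreover have "(\<lambda>z. \<phi> z * (c * f z)) = (\<lambda>z. c * (\<phi> z * f z))" by (simp add: algebra_simps)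
  ultimately have "cmod c * nrm (\<lambda>z. \<phi> z * f z) \<le> mnorm \<phi>"
    using nrm_scale[OF multiplier_mem[OF \<phi> f], of c] by simp
  then show ?thesis using pos by (simp add: c_def field_simps norm_divide)
qed

lemma mult_norm_nonneg: "\<phi> \<in> M \<Longrightarrow> 0 \<le> mnorm \<phi>"
proof -
  assume \<phi>: "\<phi> \<in> M"
  show ?thesis
  proof (cases "\<exists>f\<in>H. nrm f \<noteq> 0")
    case True
    then obtain f where f: "f \<in> H" "nrm f > 0" using nrm_nonneg by (metis less_eq_real_def)
    then have "0 \<le> mnorm \<phi> * nrm f"
      using nrm_multiplier_le[OF \<phi> f(1)] nrm_nonneg[OF multiplier_mem[OF \<phi> f(1)]] by linarith
    then show ?thesis using f(2) by (simp add: zero_le_mult_iff)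
  next
    case False
    then have "\<And>f. f \<in> H \<Longrightarrow> nrm (\<lambda>z. \<phi> z * f z) = 0" using multiplier_mem[OF \<phi>] by blast
    then have "(\<lambda>f. nrm (\<lambda>z. \<phi> z * f z)) ` {f \<in> H. nrm f \<le> 1} = {0}"
      using zero_mem False by force
    then show ?thesis unfolding mult_norm_def by simp
  qed
qed

lemma multiplierI:
  assumes "\<phi> \<in> functions_on X" "\<And>f. f \<in> H \<Longrightarrow> (\<lambda>z. \<phi> z * f z) \<in> H"
    "\<And>f. f \<in> H \<Longrightarrow> nrm (\<lambda>z. \<phi> z * f z) \<le> D * nrm f"
  shows "\<phi> \<in> M"
  using assms unfolding multipliers_def by blast

lemma multiplier_add:
  assumes "\<phi> \<in> M" "\<psi> \<in> M"
  shows "(\<lambda>z. \<phi> z + \<psi> z) \<in> M" and "mnorm (\<lambda>z. \<phi> z + \<psi> z) \<le> mnorm \<phi> + mnorm \<psi>"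
proof -
  have eq: "(\<lambda>z. (\<phi> z + \<psi> z) * f z) = (\<lambda>z. \<phi> z * f z + \<psi> z * f z)" for f
    by (simp add: algebra_simps)
  have le: "nrm (\<lambda>z. (\<phi> z + \<psi> z) * f z) \<le> (mnorm \<phi> + mnorm \<psi>) * nrm f" if f: "f \<in> H" for f
    unfolding eq using nrm_triangle[OF multiplier_mem[OF assms(1) f] multiplier_mem[OF assms(2) f]]
      nrm_multiplier_le[OF assms(1) f] nrm_multiplier_le[OF assms(2) f] by (simp add: algebra_simps)
  show "(\<lambda>z. \<phi> z + \<psi> z) \<in> M"
  proof (rule multiplierI[OF _ _ le])
    show "(\<lambda>z. \<phi> z + \<psi> z) \<in> functions_on X" using assms by (simp add: multipliers_def functions_on_def)
    show "(\<lambda>z. (\<phi> z + \<psi> z) * f z) \<in> H" if "f \<in> H" for f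
      unfolding eq by (intro add_mem multiplier_mem assms that)
  qed
  show "mnorm (\<lambda>z. \<phi> z + \<psi> z) \<le> mnorm \<phi> + mnorm \<psi>"
    using mult_norm_nonneg assms by (intro mult_norm_le le) auto
qed

lemma multiplier_scale:
  assumes "\<phi> \<in> M"
  shows "(\<lambda>z. c * \<phi> z) \<in> M" and "mnorm (\<lambda>z. c * \<phi> z) \<le> cmod c * mnorm \<phi>"
proof -
  have eq: "(\<lambda>z. (c * \<phi> z) * f z) = (\<lambda>z. c * (\<phi> z * f z))" for f
    by (simp add: algebra_simps)
  have le: "nrm (\<lambda>z. (c * \<phi> z) * f z) \<le> (cmod c * mnorm \<phi>) * nrm f" if f: "f \<in> H" for f
    unfolding eq nrm_scale[OF multiplier_mem[OF assms(1) f]]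
    using mult_left_mono[OF nrm_multiplier_le[OF assms(1) f], of "cmod c"] by (simp add: mult.assoc)
  show "(\<lambda>z. c * \<phi> z) \<in> M"
  proof (rule multiplierI[OF _ _ le])
    show "(\<lambda>z. c * \<phi> z) \<in> functions_on X" using assms by (simp add: multipliers_def functions_on_def)
    show "(\<lambda>z. (c * \<phi> z) * f z) \<in> H" if "f \<in> H" for f
      unfolding eq by (intro scale_mem multiplier_mem assms that)
  qed
  show "mnorm (\<lambda>z. c * \<phi> z) \<le> cmod c * mnorm \<phi>"
    using mult_norm_nonneg assms by (intro mult_norm_le le) auto
qed

lemma multiplier_diff:
  assumes "\<phi> \<in> M" "\<psi> \<in> M"
  shows "(\<lambda>z. \<phi> z - \<psi> z) \<in> M"
  using multiplier_add(1)[OF assms(1) multiplier_scale(1)[OF assms(2), of "-1"]] by simp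

lemma multiplier_mult:
  assumes "\<phi> \<in> M" "\<psi> \<in> M"
  shows "(\<lambda>z. \<phi> z * \<psi> z) \<in> M" and "mnorm (\<lambda>z. \<phi> z * \<psi> z) \<le> mnorm \<phi> * mnorm \<psi>"
proof -
  have eq: "(\<lambda>z. (\<phi> z * \<psi> z) * f z) = (\<lambda>z. \<phi> z * (\<psi> z * f z))" for f
    by (simp add: algebra_simps)
  have le: "nrm (\<lambda>z. (\<phi> z * \<psi> z) * f z) \<le> (mnorm \<phi> * mnorm \<psi>) * nrm f" if f: "f \<in> H" for f
    unfolding eq mult.assoc
    by (rule order_trans[OF nrm_multiplier_le[OF assms(1) multiplier_mem[OF assms(2) f]]])
      (intro mult_left_mono nrm_multiplier_le[OF assms(2) f] mult_norm_nonneg[OF assms(1)])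
  show "(\<lambda>z. \<phi> z * \<psi> z) \<in> M"
  proof (rule multiplierI[OF _ _ le])
    show "(\<lambda>z. \<phi> z * \<psi> z) \<in> functions_on X" using assms by (simp add: multipliers_def functions_on_def)
    show "(\<lambda>z. (\<phi> z * \<psi> z) * f z) \<in> H" if "f \<in> H" for f
      unfolding eq by (intro multiplier_mem assms that)
  qed
  show "mnorm (\<lambda>z. \<phi> z * \<psi> z) \<le> mnorm \<phi> * mnorm \<psi>"
    using mult_norm_nonneg assms by (intro mult_norm_le le) auto
qed

text \<open>
  The kernel function at \<open>w\<close> turns multiplication into a value of \<open>\<phi>\<close>: the inner product of
  \<open>\<phi> * kf w\<close> with \<open>kf w\<close> is \<open>\<phi> w * K w w\<close>.
\<close>

lemma sup_le_mult_norm: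
  assumes \<phi>: "\<phi> \<in> M" and w: "w \<in> X" and K: "K w w \<noteq> 0"
  shows "cmod (\<phi> w) \<le> mnorm \<phi>"
proof -
  note k = kf_mem[OF w]
  have kk: "ip (kf w) (kf w) = K w w" using repro[OF w k] w by simp
  have pos: "(nrm (kf w))\<^sup>2 > 0" using K unfolding kk[symmetric] ip_self[OF k] by simp
  have "ip (\<lambda>z. \<phi> z * kf w z) (kf w) = \<phi> w * ip (kf w) (kf w)"
    unfolding kk repro[OF w multiplier_mem[OF \<phi> k]] using w by simp
  then have "cmod (\<phi> w) * (nrm (kf w))\<^sup>2 \<le> nrm (\<lambda>z. \<phi> z * kf w z) * nrm (kf w)"
    using cauchy_schwarz[OF multiplier_mem[OF \<phi> k] k] unfolding ip_self[OF k]
    by (simp add: norm_mult norm_power)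
  also have "\<dots> \<le> (mnorm \<phi> * nrm (kf w)) * nrm (kf w)"
    by (intro mult_right_mono nrm_multiplier_le[OF \<phi> k] nrm_nonneg[OF k])
  finally have "cmod (\<phi> w) * (nrm (kf w))\<^sup>2 \<le> mnorm \<phi> * (nrm (kf w))\<^sup>2"
    by (simp add: power2_eq_square mult.assoc)
  then show ?thesis using pos by (simp del: zero_less_power2)
qed

end

section \<open>Multiplier norms of powers of linear forms\<close>

definition cinner :: "complex ^ 'd \<Rightarrow> complex ^ 'd::finite \<Rightarrow> complex" where
  "cinner z w = (\<Sum>i\<in>UNIV. z $ i * cnj (w $ i))"

lemma cinner_cmod_le: "cmod (cinner z w) \<le> norm z * norm w"
proof -
  have "cmod (cinner z w) \<le> (\<Sum>i\<in>UNIV. \<bar>norm (z $ i)\<bar> * \<bar>norm (w $ i)\<bar>)"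
    unfolding cinner_def by (rule order_trans[OF norm_sum]) (simp add: norm_mult)
  also have "\<dots> \<le> norm z * norm w" unfolding norm_vec_def by (rule L2_set_mult_ineq)
  finally show ?thesis .
qed

lemma cinner_self: "cinner z z = of_real ((norm z)\<^sup>2)"
proof -
  have "cinner z z = (\<Sum>i\<in>UNIV. of_real ((norm (z $ i))\<^sup>2))"
    unfolding cinner_def by (intro sum.cong refl) (rule complex_norm_square[symmetric])
  also have "\<dots> = of_real ((norm z)\<^sup>2)"
    unfolding norm_vec_def L2_set_def by (simp add: sum_nonneg)
  finally show ?thesis .
qed

lemma cinner_cnj: "cnj (cinner z w) = cinner w z"
  unfolding cinner_def by (simp add: mult.commute)

lemma cinner_ball: "z \<in> unit_ball \<Longrightarrow> w \<in> unit_ball \<Longrightarrow> cmod (cinner z w) < 1"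
proof -
  assume "z \<in> unit_ball" "w \<in> unit_ball"
  then have n: "norm z < 1" "norm w < 1" by (auto simp: unit_ball_def)
  have "norm z * norm w \<le> norm z * 1" using n by (intro mult_left_mono) auto
  then show ?thesis using cinner_cmod_le[of z w] n by linarith
qed

definition binom_coeff :: "real \<Rightarrow> nat \<Rightarrow> real" where
  "binom_coeff a m = pochhammer a m / fact m"

lemma binom_coeff_pos: "a > 0 \<Longrightarrow> binom_coeff a m > 0"
  unfolding binom_coeff_def by (simp add: pochhammer_pos)

text \<open>
  The binomial series with exponent \<open>-a\<close>.
\<close>

lemma Da_kernel_sums:
  assumes "z \<in> unit_ball" "w \<in> unit_ball"
  shows "(\<lambda>m. of_real (binom_coeff a m) * cinner z w ^ m) sums Da_kernel a z w"
proof -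
  have n: "cmod (- cinner z w) < 1" using cinner_ball[OF assms] by simp
  have "((- of_real a :: complex) gchoose m) * (- cinner z w) ^ m = of_real (binom_coeff a m) * cinner z w ^ m" for m
  proof -
    have "((- of_real a :: complex) gchoose m) = (-1) ^ m * of_real (binom_coeff a m)"
      unfolding gbinomial_pochhammer binom_coeff_def by (simp add: pochhammer_of_real)
    moreover have "(- cinner z w) ^ m = (-1) ^ m * cinner z w ^ m" by (rule power_minus)
    moreover have "((-1) ^ m * (-1) ^ m :: complex) = 1" by (simp add: power_mult_distrib[symmetric])
    ultimately show ?thesis by (metis (no_types, lifting) mult.assoc mult.left_commute mult_1)
  qed
  moreover have "(1 + (- cinner z w)) powr (- of_real a) = Da_kernel a z w"
    unfolding Da_kernel_def cinner_def[symmetric] by (simp add: powr_minus inverse_eq_divide)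
  ultimately show ?thesis using gen_binomial_complex[OF n, of "- of_real a"] by simp
qed

text \<open>
  The supremum over \<open>m\<close> of \<open>binom_coeff a m / binom_coeff a (m + n)\<close>: for \<open>a \<ge> 1\<close> the quotients are at
  most 1, and for \<open>a < 1\<close> the largest one belongs to \<open>m = 0\<close>.
\<close>

definition growth :: "real \<Rightarrow> nat \<Rightarrow> real" where
  "growth a n = fact n / pochhammer (min a 1) n"

lemma growth_nonneg: "a > 0 \<Longrightarrow> growth a n \<ge> 0"
  unfolding growth_def by (simp add: pochhammer_nonneg)

lemma binom_coeff_le_growth:
  assumes a: "a > 0"
  shows "binom_coeff a m \<le> growth a n * binom_coeff a (m + n)"
proof (induction n)
  case 0 then show ?case by (simp add: growth_def)
next
  case (Suc n)
  have g: "growth a (Suc n) = growth a n * ((1 + n) / (min a 1 + n))"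
    using a unfolding growth_def pochhammer_Suc by (simp add: field_simps)
  have b: "binom_coeff a (m + Suc n) = binom_coeff a (m + n) * ((a + (m + n)) / (1 + (m + n)))"
    unfolding binom_coeff_def by (simp add: pochhammer_Suc field_simps)
  have "real m * (min a 1 + real n) \<le> real m * (1 + real n)" by (intro mult_left_mono) auto
  moreover have "(min a 1) * (1 + real n) \<le> a * (1 + real n)" by (intro mult_right_mono) auto
  ultimately have "(1 + real (m + n)) * (min a 1 + real n) \<le> (1 + real n) * (a + real (m + n))"
    by (simp add: algebra_simps)
  then have "1 \<le> ((1 + real n) / (min a 1 + real n)) * ((a + real (m + n)) / (1 + real (m + n)))"
    using a by (simp add: divide_simps mult.commute)
  then have "growth a n * binom_coeff a (m + n) * 1 \<le> growth a n * binom_coeff a (m + n) *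
     (((1 + real n) / (min a 1 + real n)) * ((a + real (m + n)) / (1 + real (m + n))))"
    by (rule mult_left_mono[OF _ mult_nonneg_nonneg[OF growth_nonneg[OF a] less_imp_le[OF binom_coeff_pos[OF a]]]])
  then show ?case using Suc unfolding g b by (simp add: mult_ac)
qed

text \<open>
  With \<open>b = min a 1\<close>, the quotient is \<open>1/b\<close> times the reciprocal of the product of the \<open>1 + b/j\<close> over
  \<open>j < n\<close>, and this product is at least \<open>1 + b\<close> times a harmonic number.
\<close>

lemma growth_little_o:
  assumes a: "a > 0"
  shows "(\<lambda>n. growth a n / real n) \<longlonglongrightarrow> 0"
proof -
  define b where "b = min a 1"
  have b: "b > 0" using a unfolding b_def by simp
  have harm_top: "filterlim (\<lambda>n. 1 + b * harm n) at_top sequentially"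
    using b by (intro filterlim_tendsto_add_at_top[OF tendsto_const]
        filterlim_tendsto_pos_mult_at_top[OF tendsto_const] harm_at_top)
  have le: "(1 + b * harm n) * fact n \<le> pochhammer (1 + b) n" for n
  proof (induction n)
    case 0 then show ?case by (simp add: harm_def)
  next
    case (Suc n)
    have "(1 + b * harm (Suc n)) * (1 + real n) = (1 + b * harm n) * (1 + real n) + b"
      by (simp add: harm_Suc field_simps)
    also have "\<dots> \<le> (1 + b * harm n) * (1 + real n) + b * (1 + b * harm n)"
      using b harm_nonneg[of n, where ?'a = real] by simp
    also have "\<dots> = (1 + b * harm n) * (1 + b + real n)" by (simp add: algebra_simps)
    finally have "(1 + b * harm (Suc n)) * (1 + real n) * fact n \<le> (1 + b * harm n) * (1 + b + real n) * fact n"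
      by (intro mult_right_mono) auto
    also have "\<dots> = ((1 + b * harm n) * fact n) * (1 + b + real n)" by (simp add: mult_ac)
    also have "\<dots> \<le> pochhammer (1 + b) n * (1 + b + real n)" using Suc b by (intro mult_right_mono) auto
    finally show ?case by (simp add: pochhammer_Suc mult_ac add_ac)
  qed
  have bound: "growth a (Suc n) / real (Suc n) \<le> (1 / b) * (1 / (1 + b * harm n))" for n
  proof -
    have pos: "1 + b * harm n > 0" using b harm_nonneg[of n, where ?'a = real] by (simp add: add_pos_nonneg)
    have eq: "growth a (Suc n) / real (Suc n) = (1 / b) * (fact n / pochhammer (1 + b) n)"
      unfolding growth_def b_def[symmetric] pochhammer_rec by (simp add: add_ac)
    have le': "fact n / pochhammer (1 + b) n \<le> 1 / (1 + b * harm n)"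
      using le[of n] pos b by (simp add: divide_simps pochhammer_pos mult_ac)
    show ?thesis unfolding eq by (rule mult_left_mono[OF le']) (use b in simp)
  qed
  have "(\<lambda>n. (1 / b) * (1 / (1 + b * harm n))) \<longlonglongrightarrow> (1 / b) * 0"
    using harm_top by (intro tendsto_mult tendsto_const tendsto_divide_0) (auto intro: filterlim_at_top_imp_at_infinity)
  then have lim0: "(\<lambda>n. (1 / b) * (1 / (1 + b * harm n))) \<longlonglongrightarrow> 0" by simp
  have "(\<lambda>n. growth a (Suc n) / real (Suc n)) \<longlonglongrightarrow> 0"
    by (rule tendsto_sandwich[OF _ _ tendsto_const lim0])
      (use bound growth_nonneg[OF a] in \<open>auto intro!: always_eventually simp del: of_nat_Suc\<close>)
  then show ?thesis by (rule LIMSEQ_imp_Suc)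
qed

lemma sos_cinner: "sos_kernel cinner"
  unfolding cinner_def[abs_def] by (rule sos_kernel_sum[OF finite sos_kernel_single])

text \<open>
  The kernel is the inner product of the components of \<open>z\<close> and \<open>w\<close> orthogonal to \<open>u\<close>.
\<close>

lemma sos_cinner_minus:
  assumes u: "norm u = 1"
  shows "sos_kernel (\<lambda>z w. cinner z w - cinner z u * cnj (cinner w u))"
proof -
  have uu: "(\<Sum>i\<in>UNIV. u $ i * cnj (u $ i)) = 1" using cinner_self[of u] u unfolding cinner_def by simp
  have "cinner z w - cinner z u * cnj (cinner w u)
     = (\<Sum>i\<in>UNIV. (z $ i - u $ i * cinner z u) * cnj (w $ i - u $ i * cinner w u))" for z w
  proof -
    have "(\<Sum>i\<in>UNIV. (z $ i - u $ i * cinner z u) * cnj (w $ i - u $ i * cinner w u))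
      = cinner z w - cnj (cinner w u) * (\<Sum>i\<in>UNIV. z $ i * cnj (u $ i))
        - cinner z u * (\<Sum>i\<in>UNIV. u $ i * cnj (w $ i))
        + cinner z u * cnj (cinner w u) * (\<Sum>i\<in>UNIV. u $ i * cnj (u $ i))"
      unfolding cinner_def[of z w]
      by (simp add: algebra_simps sum.distrib sum_subtractf sum_distrib_left)
    then show ?thesis unfolding uu cinner_cnj by (simp add: cinner_def)
  qed
  then have "(\<lambda>z w. cinner z w - cinner z u * cnj (cinner w u))
     = (\<lambda>z w. \<Sum>i\<in>UNIV. (z $ i - u $ i * cinner z u) * cnj (w $ i - u $ i * cinner w u))" by (intro ext)
  then show ?thesis by (simp only:) (rule sos_kernel_sum[OF finite sos_kernel_single])
qed

text \<open>
  With \<open>Q = \<langle>z, w\<rangle>\<close> and \<open>x = \<langle>z, u\<rangle> cnj \<langle>w, u\<rangle>\<close>, the partial sums of the binomial series regroup as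
  \<open>M \<Sum> c\<^sub>m Q ^ m + \<Sum> (M c\<^sub>m\<^sub>+\<^sub>n - c\<^sub>m) Q ^ (m + n) + \<Sum> c\<^sub>m Q ^ m (Q ^ n - x ^ n)\<close>, where the first sum runs
  over \<open>m < n\<close> and \<open>M\<close> is the growth constant. All three are sums of squares.
\<close>

lemma Da_kernel_form_nonneg:
  fixes u :: "complex ^ 'd"
  assumes a: "a > 0" and u: "norm u = 1" and F: "finite F" "F \<subseteq> unit_ball"
  shows "0 \<le> Re (kernel_form (\<lambda>z w. (of_real (growth a n) - cinner z u ^ n * cnj (cinner w u ^ n)) * Da_kernel a z w) F c)"
proof -
  define Q where "Q = (cinner :: complex ^ 'd \<Rightarrow> _)"
  define x where "x = (\<lambda>z w. cinner z u * cnj (cinner w u))"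
  define S where "S N = (\<lambda>z w. of_real (growth a n) * (\<Sum>m<N + n. of_real (binom_coeff a m) * Q z w ^ m)
      - (\<Sum>m<N. of_real (binom_coeff a m) * Q z w ^ m) * x z w ^ n)" for N
  have x: "sos_kernel x" unfolding x_def by (rule sos_kernel_single)
  have Q: "sos_kernel Q" unfolding Q_def by (rule sos_cinner)
  have Qx: "sos_kernel (\<lambda>z w. Q z w - x z w)" unfolding Q_def x_def by (rule sos_cinner_minus[OF u])
  have sos: "sos_kernel (S N)" for N
  proof -
    have split: "(\<Sum>m<N + n. g m) = (\<Sum>m<n. g m) + (\<Sum>m<N. g (m + n))" for g :: "nat \<Rightarrow> complex"
      by (induction N) (simp_all add: add_ac)
    have "S N = (\<lambda>z w. of_real (growth a n) * (\<Sum>m<n. of_real (binom_coeff a m) * Q z w ^ m)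
        + (\<Sum>m<N. of_real (growth a n * binom_coeff a (m + n) - binom_coeff a m) * Q z w ^ (m + n)
              + of_real (binom_coeff a m) * (Q z w ^ m * (Q z w ^ n - x z w ^ n))))"
      unfolding S_def split
      by (intro ext) (simp add: algebra_simps sum.distrib sum_subtractf sum_distrib_left power_add)
    then show ?thesis
      using a growth_nonneg[OF a, of n] binom_coeff_pos[OF a] binom_coeff_le_growth[OF a]
      by (simp only:) (intro sos_kernel_add sos_kernel_scale sos_kernel_sum sos_kernel_power
          sos_kernel_mult sos_kernel_power_diff Q x Qx finite_lessThan; auto intro: less_imp_le)
  qed
  have lim: "(\<lambda>N. S N z w) \<longlonglongrightarrow> (of_real (growth a n) - cinner z u ^ n * cnj (cinner w u ^ n)) * Da_kernel a z w"
    if "z \<in> F" "w \<in> F" for z w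
  proof -
    have s: "(\<lambda>N. \<Sum>m<N. of_real (binom_coeff a m) * Q z w ^ m) \<longlonglongrightarrow> Da_kernel a z w"
      using Da_kernel_sums[of z w a] that F unfolding sums_def Q_def by blast
    have s': "(\<lambda>N. \<Sum>m<N + n. of_real (binom_coeff a m) * Q z w ^ m) \<longlonglongrightarrow> Da_kernel a z w"
      using LIMSEQ_ignore_initial_segment[OF s, of n] .
    have "(\<lambda>N. S N z w) \<longlonglongrightarrow> of_real (growth a n) * Da_kernel a z w - Da_kernel a z w * x z w ^ n"
      unfolding S_def by (intro tendsto_intros s s')
    then show ?thesis unfolding x_def by (simp add: algebra_simps power_mult_distrib)
  qed
  have "(\<lambda>N. Re (kernel_form (S N) F c)) \<longlonglongrightarrow>
     Re (kernel_form (\<lambda>z w. (of_real (growth a n) - cinner z u ^ n * cnj (cinner w u ^ n)) * Da_kernel a z w) F c)"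
    unfolding kernel_form_def by (intro tendsto_intros lim)
  then show ?thesis by (rule LIMSEQ_le_const) (use kernel_form_sos_nonneg[OF sos] in blast)
qed

lemma linear_form_power_multiplier:
  fixes u :: "complex ^ 'd" and n :: nat
  assumes H: "is_rkhs (unit_ball :: (complex ^ 'd) set) (Da_kernel a) H ip"
    and a: "a > 0" and u: "norm u = 1"
  defines "\<phi> \<equiv> (\<lambda>z. if z \<in> unit_ball then cinner z u ^ n else 0)"
  shows "\<phi> \<in> multipliers unit_ball H ip" and "mult_norm H ip \<phi> \<le> sqrt (growth a n)"
proof -
  interpret rkhs unit_ball "Da_kernel a" H ip by unfold_locales (rule H)
  have \<phi>: "\<phi> \<in> functions_on unit_ball" unfolding \<phi>_def functions_on_def by auto
  have D: "sqrt (growth a n) \<ge> 0" using growth_nonneg[OF a] by simp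
  have psd: "0 \<le> Re (kernel_form (\<lambda>z w. (of_real ((sqrt (growth a n))\<^sup>2) - \<phi> z * cnj (\<phi> w)) * Da_kernel a z w) F c)"
    if F: "finite F" "F \<subseteq> unit_ball" for F c
  proof -
    have "kernel_form (\<lambda>z w. (of_real ((sqrt (growth a n))\<^sup>2) - \<phi> z * cnj (\<phi> w)) * Da_kernel a z w) F c
      = kernel_form (\<lambda>z w. (of_real (growth a n) - cinner z u ^ n * cnj (cinner w u ^ n)) * Da_kernel a z w) F c"
      unfolding kernel_form_def \<phi>_def using F(2) growth_nonneg[OF a, of n]
      by (intro sum.cong refl) (auto simp: subset_iff)
    then show ?thesis using Da_kernel_form_nonneg[OF a u F] by simp
  qed
  note m = multiplier_if_kernel_nonneg[OF D \<phi> psd]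
  show "\<phi> \<in> multipliers unit_ball H ip" by (rule multiplierI[OF \<phi> m])
  show "mult_norm H ip \<phi> \<le> sqrt (growth a n)" by (rule mult_norm_le[OF D m(2)])
qed

lemma Da_kernel_diag_nonzero: "w \<in> unit_ball \<Longrightarrow> Da_kernel a w w \<noteq> 0"
proof -
  assume "w \<in> unit_ball"
  then have "cinner w w \<noteq> 1" using cinner_ball[of w w] by auto
  then show ?thesis unfolding Da_kernel_def cinner_def[symmetric] by simp
qed

section \<open>Uniform limits of polynomials on the ball\<close>

lemma norm_scale_vec: "norm (c *s v) = cmod c * norm (v :: complex ^ 'd)"
  unfolding norm_vec_def by (simp add: norm_mult L2_set_right_distrib)

lemma bounded_linear_scale_vec: "bounded_linear (\<lambda>c. c *s (v :: complex ^ 'd))"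
  by (rule bounded_linear_intro[where K = "norm v"])
    (simp_all add: vec_eq_iff distrib_right norm_scale_vec)

lemma open_unit_ball: "open (unit_ball :: (complex ^ 'd) set)"
  unfolding unit_ball_def by simp

lemma closure_unit_ball: "closure unit_ball = (cball 0 1 :: (complex ^ 'd) set)"
  unfolding unit_ball_def by simp

text \<open>
  The calculus of any commuting tuple generates all polynomial functions; the zero tuple serves here.
\<close>

lemma polynomial_fun_induct [consumes 1, case_names const coord add mult]:
  assumes "polynomial_fun f" and "\<And>c. P (\<lambda>z. c)" and "\<And>i. P (\<lambda>z. z $ i)"
    and "\<And>f g. P f \<Longrightarrow> P g \<Longrightarrow> P (\<lambda>z. f z + g z)" and "\<And>f g. P f \<Longrightarrow> P g \<Longrightarrow> P (\<lambda>z. f z * g z)"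
  shows "P f"
proof -
  define T where "T = (\<lambda>i::'a. 0 :: complex ^ 1 ^ 1)"
  have "commuting_tuple T" unfolding T_def commuting_tuple_def by simp
  then obtain A where "poly_calculus T f A" using poly_calculus_if_polynomial_fun assms(1) by blast
  then show ?thesis by (induction rule: poly_calculus.induct) (use assms(2-) in simp_all)
qed

definition complex_differentiable :: "(complex ^ 'd \<Rightarrow> complex) \<Rightarrow> complex ^ 'd \<Rightarrow> bool" where
  "complex_differentiable f z \<longleftrightarrow> (\<exists>L. (f has_derivative L) (at z) \<and> (\<forall>c v. L (c *s v) = c * L v))"

lemma holomorphic_in_iff: "holomorphic_in f U \<longleftrightarrow> (\<forall>z\<in>U. complex_differentiable f z)"
  unfolding holomorphic_in_def complex_differentiable_def by simp

lemma complex_differentiable_const: "complex_differentiable (\<lambda>z. c) z"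
  unfolding complex_differentiable_def by (rule exI[of _ "\<lambda>_. 0"]) simp

lemma complex_differentiable_coord: "complex_differentiable (\<lambda>z. z $ i) z"
  unfolding complex_differentiable_def
  by (rule exI[of _ "\<lambda>z. z $ i"]) (simp add: bounded_linear_vec_nth bounded_linear_imp_has_derivative)

lemma complex_differentiable_add:
  assumes "complex_differentiable f z" "complex_differentiable g z"
  shows "complex_differentiable (\<lambda>z. f z + g z) z"
proof -
  obtain L M where "(f has_derivative L) (at z)" "\<forall>c v. L (c *s v) = c * L v"
    "(g has_derivative M) (at z)" "\<forall>c v. M (c *s v) = c * M v"
    using assms unfolding complex_differentiable_def by blast
  then show ?thesis unfolding complex_differentiable_def
    by (intro exI[of _ "\<lambda>v. L v + M v"]) (simp add: has_derivative_add distrib_left)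
qed

lemma complex_differentiable_mult:
  assumes "complex_differentiable f z" "complex_differentiable g z"
  shows "complex_differentiable (\<lambda>z. f z * g z) z"
proof -
  obtain L M where "(f has_derivative L) (at z)" "\<forall>c v. L (c *s v) = c * L v"
    "(g has_derivative M) (at z)" "\<forall>c v. M (c *s v) = c * M v"
    using assms unfolding complex_differentiable_def by blast
  then show ?thesis unfolding complex_differentiable_def
    by (intro exI[of _ "\<lambda>v. f z * M v + L v * g z"] conjI has_derivative_mult)
      (simp_all add: algebra_simps)
qed

lemma polynomial_fun_complex_differentiable:
  "polynomial_fun f \<Longrightarrow> complex_differentiable f z"
  by (induction rule: polynomial_fun_induct)
    (simp_all add: complex_differentiable_const complex_differentiable_coord
      complex_differentiable_add complex_differentiable_mult)

lemma polynomial_fun_continuous: "polynomial_fun f \<Longrightarrow> continuous_on S f"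
  using polynomial_fun_complex_differentiable unfolding complex_differentiable_def
  by (metis continuous_at_imp_continuous_on has_derivative_continuous)

text \<open>
  Elements of the function algebras vanish outside the ball, so polynomial functions have to be cut off.
\<close>

definition on_ball :: "(complex ^ 'd \<Rightarrow> complex) \<Rightarrow> complex ^ 'd \<Rightarrow> complex" where
  "on_ball f = (\<lambda>z. if z \<in> unit_ball then f z else 0)"

lemma complex_differentiable_on_ball:
  assumes "z \<in> unit_ball" "complex_differentiable f z"
  shows "complex_differentiable (on_ball f) z"
proof -
  obtain L where "(f has_derivative L) (at z)" "\<forall>c v. L (c *s v) = c * L v"
    using assms unfolding complex_differentiable_def by blast
  moreover from this(1) have "(on_ball f has_derivative L) (at z)"
    by (rule has_derivative_transform_within_open[OF _ open_unit_ball assms(1)]) (simp add: on_ball_def)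
  ultimately show ?thesis unfolding complex_differentiable_def by blast
qed

lemma ball_algebraI:
  assumes "f \<in> functions_on unit_ball" "\<And>z. z \<in> unit_ball \<Longrightarrow> complex_differentiable f z"
    "continuous_on (cball 0 1) g" "\<And>z. z \<in> unit_ball \<Longrightarrow> g z = f z"
  shows "f \<in> ball_algebra"
  using assms unfolding ball_algebra_def holomorphic_in_iff closure_unit_ball by blast

lemma ball_algebraE:
  assumes "f \<in> ball_algebra"
  obtains g where "f \<in> functions_on unit_ball" "\<And>z. z \<in> unit_ball \<Longrightarrow> complex_differentiable f z"
    "continuous_on (cball 0 1) g" "\<And>z. z \<in> unit_ball \<Longrightarrow> g z = f z"
  using assms unfolding ball_algebra_def holomorphic_in_iff closure_unit_ball by blast

lemma ball_algebra_add:
  assumes "f \<in> ball_algebra" "g \<in> ball_algebra"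
  shows "(\<lambda>z. f z + g z) \<in> ball_algebra"
proof -
  obtain f' where f: "f \<in> functions_on unit_ball" "\<And>z. z \<in> unit_ball \<Longrightarrow> complex_differentiable f z"
    "continuous_on (cball 0 1) f'" "\<And>z. z \<in> unit_ball \<Longrightarrow> f' z = f z"
    using ball_algebraE[OF assms(1)] by blast
  obtain g' where g: "g \<in> functions_on unit_ball" "\<And>z. z \<in> unit_ball \<Longrightarrow> complex_differentiable g z"
    "continuous_on (cball 0 1) g'" "\<And>z. z \<in> unit_ball \<Longrightarrow> g' z = g z"
    using ball_algebraE[OF assms(2)] by blast
  show ?thesis
    by (rule ball_algebraI[of _ "\<lambda>z. f' z + g' z"])
      (use f g in \<open>auto simp: functions_on_def intro!: complex_differentiable_add continuous_intros\<close>)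
qed

lemma ball_algebra_mult:
  assumes "f \<in> ball_algebra" "g \<in> ball_algebra"
  shows "(\<lambda>z. f z * g z) \<in> ball_algebra"
proof -
  obtain f' where f: "f \<in> functions_on unit_ball" "\<And>z. z \<in> unit_ball \<Longrightarrow> complex_differentiable f z"
    "continuous_on (cball 0 1) f'" "\<And>z. z \<in> unit_ball \<Longrightarrow> f' z = f z"
    using ball_algebraE[OF assms(1)] by blast
  obtain g' where g: "g \<in> functions_on unit_ball" "\<And>z. z \<in> unit_ball \<Longrightarrow> complex_differentiable g z"
    "continuous_on (cball 0 1) g'" "\<And>z. z \<in> unit_ball \<Longrightarrow> g' z = g z"
    using ball_algebraE[OF assms(2)] by blast
  show ?thesis
    by (rule ball_algebraI[of _ "\<lambda>z. f' z * g' z"])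
      (use f g in \<open>auto simp: functions_on_def intro!: complex_differentiable_mult continuous_intros\<close>)
qed

lemma polynomial_on_ball_mem_ball_algebra:
  assumes "polynomial_fun f" shows "on_ball f \<in> ball_algebra"
  by (rule ball_algebraI[of _ f])
    (use assms in \<open>simp_all add: functions_on_def on_ball_def[of f] polynomial_fun_continuous
      complex_differentiable_on_ball[unfolded on_ball_def] polynomial_fun_complex_differentiable\<close>)

lemma ball_algebra_scale:
  assumes "f \<in> ball_algebra" shows "(\<lambda>z. c * f z) \<in> ball_algebra"
proof -
  have "(\<lambda>z. c * f z) = (\<lambda>z. on_ball (\<lambda>z. c) z * f z)"
    using assms unfolding ball_algebra_def functions_on_def on_ball_def by (auto simp: fun_eq_iff)
  then show ?thesis
    using ball_algebra_mult[OF polynomial_on_ball_mem_ball_algebra[OF polynomial_fun_const] assms] by simp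
qed

lemma ball_algebra_bounded:
  assumes "f \<in> ball_algebra"
  shows "bdd_above ((\<lambda>z. cmod (f z)) ` unit_ball)"
proof -
  obtain g where g: "continuous_on (cball 0 1) g" "\<And>z. z \<in> unit_ball \<Longrightarrow> g z = f z"
    using assms unfolding ball_algebra_def closure_unit_ball by blast
  have "compact (g ` cball 0 1)" by (intro compact_continuous_image g compact_cball)
  then obtain B where B: "\<forall>w\<in>g ` cball 0 1. cmod w \<le> B"
    using compact_imp_bounded bounded_iff by metis
  show ?thesis
  proof (rule bdd_aboveI2[where M = B])
    fix z :: "complex ^ 'a" assume z: "z \<in> unit_ball"
    then have "z \<in> cball 0 1" by (simp add: unit_ball_def)
    then show "cmod (f z) \<le> B" using B g(2)[OF z] by force
  qed
qed

lemma cmod_le_ball_sup_norm: "f \<in> ball_algebra \<Longrightarrow> z \<in> unit_ball \<Longrightarrow> cmod (f z) \<le> ball_sup_norm f"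
  unfolding ball_sup_norm_def by (rule cSUP_upper[OF _ ball_algebra_bounded])

lemma zero_mem_unit_ball: "0 \<in> unit_ball" unfolding unit_ball_def by simp

lemma ball_sup_norm_le:
  assumes "\<And>z. z \<in> unit_ball \<Longrightarrow> cmod (f z) \<le> B" shows "ball_sup_norm f \<le> B"
  unfolding ball_sup_norm_def
proof (rule cSUP_least)
  show "unit_ball \<noteq> {}" using zero_mem_unit_ball by blast
  show "cmod (f z) \<le> B" if "z \<in> unit_ball" for z by (rule assms[OF that])
qed

lemma slice_holomorphic:
  assumes "\<And>t. t \<in> S \<Longrightarrow> complex_differentiable f (v + t *s h)" and "open S"
  shows "(\<lambda>t. f (v + t *s h)) holomorphic_on S"
    and "\<And>t L. t \<in> S \<Longrightarrow> (f has_derivative L) (at (v + t *s h)) \<Longrightarrow> (\<And>c v. L (c *s v) = c * L v) \<Longrightarrow>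
       deriv (\<lambda>t. f (v + t *s h)) t = L h"
proof -
  have der: "((\<lambda>t. f (v + t *s h)) has_field_derivative L h) (at t)"
    if L: "(f has_derivative L) (at (v + t *s h))" "\<And>c v. L (c *s v) = c * L v" for t L
  proof -
    have "((\<lambda>t. v + t *s h) has_derivative (\<lambda>s. s *s h)) (at t)"
      using has_derivative_add[OF has_derivative_const bounded_linear_imp_has_derivative[OF bounded_linear_scale_vec[of h]], of v]
      by simp
    from diff_chain_at[OF this L(1)] show ?thesis
      unfolding has_field_derivative_def o_def L(2) mult_commute_abs .
  qed
  show "(\<lambda>t. f (v + t *s h)) holomorphic_on S"
    unfolding holomorphic_on_open[OF assms(2)]
    using assms(1) der unfolding complex_differentiable_def by blast
  show "deriv (\<lambda>t. f (v + t *s h)) t = L h"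
    if "t \<in> S" "(f has_derivative L) (at (v + t *s h))" "\<And>c v. L (c *s v) = c * L v" for t L
    using der[OF that(2,3)] by (rule DERIV_imp_deriv)
qed

text \<open>
  Cauchy's inequality on the complex line through \<open>x\<close> in the direction \<open>h\<close>.
\<close>

lemma polynomial_derivative_bound:
  assumes q: "polynomial_fun q" and L: "(q has_derivative L) (at x)" "\<And>c v. L (c *s v) = c * L v"
    and B: "\<And>z. z \<in> unit_ball \<Longrightarrow> cmod (q z) \<le> B" and d: "d > 0" "ball x (2 * d) \<subseteq> unit_ball"
  shows "cmod (L h) \<le> B / d * norm h"
proof (cases "h = 0")
  case True
  then show ?thesis using L(2)[of 0 0] by simp
next
  case False
  define r where "r = d / norm h"
  have r: "r > 0" using False d unfolding r_def by simp
  have hol: "(\<lambda>t. q (x + t *s h)) holomorphic_on UNIV"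
    by (rule slice_holomorphic(1)) (use polynomial_fun_complex_differentiable[OF q] in auto)
  have der: "deriv (\<lambda>t. q (x + t *s h)) 0 = L h"
    by (rule slice_holomorphic(2)[of UNIV]) (use polynomial_fun_complex_differentiable[OF q] L in auto)
  have "cmod ((deriv ^^ 1) (\<lambda>t. q (x + t *s h)) 0) \<le> fact 1 * B / r ^ 1"
  proof (rule Cauchy_inequality)
    show "(\<lambda>t. q (x + t *s h)) holomorphic_on ball 0 r" using hol holomorphic_on_subset by blast
    show "continuous_on (cball 0 r) (\<lambda>t. q (x + t *s h))"
      using hol holomorphic_on_subset holomorphic_on_imp_continuous_on by blast
    show "r > 0" by fact
    fix t :: complex assume "norm (0 - t) = r"
    then have "norm (t *s h) = d" using False unfolding norm_scale_vec r_def by simp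
    then have "x + t *s h \<in> ball x (2 * d)" using d by (simp add: dist_norm)
    then show "cmod (q (x + t *s h)) \<le> B" using B d by blast
  qed
  then show ?thesis unfolding r_def using der by (simp add: field_simps)
qed

lemma inverse_Suc_tendsto_zero: "(\<lambda>k. 1 / real (Suc k)) \<longlonglongrightarrow> 0"
  using LIMSEQ_inverse_real_of_nat by (simp add: inverse_eq_divide)

lemma Cauchy_if_diff_le_inverse:
  fixes x :: "nat \<Rightarrow> 'a :: real_normed_vector"
  assumes D: "D \<ge> 0" and diff: "\<And>k l. norm (x k - x l) \<le> D * (1 / real (Suc k) + 1 / real (Suc l))"
  shows "Cauchy x"
  unfolding Cauchy_def
proof (intro allI impI)
  fix e :: real assume e: "e > 0"
  have "(\<lambda>k. D * (2 * (1 / real (Suc k)))) \<longlonglongrightarrow> D * (2 * 0)"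
    by (intro tendsto_intros inverse_Suc_tendsto_zero)
  then have "\<forall>\<^sub>F k in sequentially. D * (2 * (1 / real (Suc k))) < e" using e by (intro order_tendstoD(2)) auto
  then obtain K where K: "D * (2 * (1 / real (Suc K))) < e" unfolding eventually_sequentially by blast
  have "dist (x m) (x n) < e" if "m \<ge> K" "n \<ge> K" for m n
  proof -
    have "1 / real (Suc m) \<le> 1 / real (Suc K)" "1 / real (Suc n) \<le> 1 / real (Suc K)"
      using that by (auto simp: field_simps)
    then have "D * (1 / real (Suc m) + 1 / real (Suc n)) \<le> D * (2 * (1 / real (Suc K)))"
      using D by (intro mult_left_mono) auto
    then show ?thesis unfolding dist_norm using diff[of m n] K by linarith
  qed
  then show "\<exists>M. \<forall>m\<ge>M. \<forall>n\<ge>M. dist (x m) (x n) < e" by blast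
qed

lemma uniform_limit_if_le_inverse:
  fixes f :: "'a \<Rightarrow> 'b :: real_normed_vector"
  assumes "\<And>k z. z \<in> S \<Longrightarrow> norm (f z - g k z) \<le> 1 / real (Suc k)"
  shows "uniform_limit S g f sequentially"
proof (rule uniform_limitI)
  fix e :: real assume "e > 0"
  then have "\<forall>\<^sub>F k in sequentially. 1 / real (Suc k) < e" by (intro order_tendstoD(2)[OF inverse_Suc_tendsto_zero])
  then show "\<forall>\<^sub>F k in sequentially. \<forall>z\<in>S. dist (g k z) (f z) < e"
  proof (rule eventually_mono, intro ballI)
    fix k z assume "1 / real (Suc k) < e" "z \<in> S"
    then show "dist (g k z) (f z) < e" using assms[of z k] by (simp add: dist_norm norm_minus_commute)
  qed
qed

text \<open>
  The Weierstrass theorem in several variables. Polynomials are uniformly continuous on the closed ball, so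
  \<open>f\<close> is uniformly continuous and extends to the closure. By Cauchy's inequality the derivatives of the
  approximating polynomials converge uniformly on small balls, so the limit is differentiable and its derivative
  is complex linear.
\<close>

lemma uniform_limit_of_polynomials_mem_ball_algebra:
  fixes f :: "complex ^ 'd \<Rightarrow> complex"
  assumes f: "f \<in> functions_on unit_ball"
    and lim: "\<And>e. e > 0 \<Longrightarrow> \<exists>p. polynomial_fun p \<and> (\<forall>z\<in>unit_ball. cmod (f z - p z) \<le> e)"
  shows "f \<in> ball_algebra"
proof -
  have uc: "uniformly_continuous_on unit_ball f"
    unfolding uniformly_continuous_on_def
  proof (intro allI impI)
    fix e :: real assume "e > 0"
    then obtain p where p: "polynomial_fun p" "\<And>z. z \<in> unit_ball \<Longrightarrow> cmod (f z - p z) \<le> e / 4"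
      using lim[of "e / 4"] by auto
    have "uniformly_continuous_on (cball 0 1) p"
      by (intro compact_uniformly_continuous polynomial_fun_continuous p compact_cball)
    then obtain d where d: "d > 0"
      "\<And>x y. x \<in> cball 0 1 \<Longrightarrow> y \<in> cball 0 1 \<Longrightarrow> dist y x < d \<Longrightarrow> dist (p y) (p x) < e / 4"
      unfolding uniformly_continuous_on_def using \<open>e > 0\<close> by (metis divide_pos_pos zero_less_numeral)
    have "dist (f y) (f x) < e" if "x \<in> unit_ball" "y \<in> unit_ball" "dist y x < d" for x y
    proof -
      have "dist (p y) (p x) < e / 4" using that by (intro d) (auto simp: unit_ball_def)
      moreover have "dist (f y) (f x) \<le> cmod (f y - p y) + dist (p y) (p x) + cmod (f x - p x)"
        unfolding dist_norm by norm
      ultimately show ?thesis using p(2)[OF that(1)] p(2)[OF that(2)] \<open>e > 0\<close> by linarith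
    qed
    then show "\<exists>d>0. \<forall>x\<in>unit_ball. \<forall>x'\<in>unit_ball. dist x' x < d \<longrightarrow> dist (f x') (f x) < e"
      using d(1) by blast
  qed
  obtain g where g: "uniformly_continuous_on (closure unit_ball) g" "\<And>x. x \<in> unit_ball \<Longrightarrow> f x = g x"
    by (rule uniformly_continuous_on_extension_on_closure[OF uc], rule that)
  have "\<exists>p. polynomial_fun p \<and> (\<forall>z\<in>unit_ball. cmod (f z - p z) \<le> 1 / real (Suc k))" for k
    by (rule lim) simp
  then obtain p where p: "\<And>k. polynomial_fun (p k)"
    and pf: "\<And>k z. z \<in> unit_ball \<Longrightarrow> cmod (f z - p k z) \<le> 1 / real (Suc k)" by metis
  have "\<exists>L. (p k has_derivative L) (at x) \<and> (\<forall>c v. L (c *s v) = c * L v)" for k x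
    using polynomial_fun_complex_differentiable[OF p] unfolding complex_differentiable_def by blast
  then obtain p' where p': "\<And>k x. (p k has_derivative p' k x) (at x)"
    "\<And>k x c v. p' k x (c *s v) = c * p' k x v" by metis
  have "complex_differentiable f x" if x: "x \<in> unit_ball" for x
  proof -
    obtain d where d: "d > 0" "ball x (3 * d) \<subseteq> unit_ball"
    proof -
      obtain e where "e > 0" "ball x e \<subseteq> unit_ball" using open_unit_ball x openE by blast
      then show thesis using that[of "e / 3"] by simp
    qed
    let ?S = "ball x d"
    have S: "?S \<subseteq> unit_ball" using d by (auto intro!: subset_trans[OF _ d(2)] subset_ball)
    have diff: "cmod (p' k y h - p' l y h) \<le> (1 / real (Suc k) + 1 / real (Suc l)) / d * norm h"
      if y: "y \<in> ?S" for y and h :: "complex ^ 'd" and k l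
    proof -
      have "polynomial_fun (\<lambda>z. p k z + (-1) * p l z)"
        by (intro polynomial_fun_add polynomial_fun_mult polynomial_fun_const p)
      then have q: "polynomial_fun (\<lambda>z. p k z - p l z)" by simp
      show ?thesis
      proof (rule polynomial_derivative_bound[OF q, of "\<lambda>h. p' k y h - p' l y h" y])
        show "((\<lambda>z. p k z - p l z) has_derivative (\<lambda>h. p' k y h - p' l y h)) (at y)"
          by (intro has_derivative_diff p')
        show "p' k y (c *s v) - p' l y (c *s v) = c * (p' k y v - p' l y v)" for c v
          unfolding p'(2) by (simp add: algebra_simps)
        show "cmod (p k z - p l z) \<le> 1 / real (Suc k) + 1 / real (Suc l)" if "z \<in> unit_ball" for z
        proof -
          have "cmod (p k z - p l z) \<le> cmod (f z - p k z) + cmod (f z - p l z)" by norm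
          then show ?thesis using pf[OF that, of k] pf[OF that, of l] by linarith
        qed
        show "d > 0" by fact
        have "ball y (2 * d) \<subseteq> ball x (3 * d)"
        proof
          fix w assume "w \<in> ball y (2 * d)"
          then show "w \<in> ball x (3 * d)" using y dist_triangle[of x w y] by simp
        qed
        then show "ball y (2 * d) \<subseteq> unit_ball" using d(2) by blast
      qed
    qed
    note inv0 = inverse_Suc_tendsto_zero
    have "Cauchy (\<lambda>k. p' k y h)" if y: "y \<in> ?S" for y and h :: "complex ^ 'd"
      by (rule Cauchy_if_diff_le_inverse[where D = "norm h / d"])
        (use diff[OF y] d in \<open>simp_all add: mult.commute\<close>)
    then have "\<exists>l. (\<lambda>k. p' k y h) \<longlonglongrightarrow> l" if "y \<in> ?S" for y h
      using that Cauchy_convergent unfolding convergent_def by blast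
    then obtain g' where g': "\<And>y h. y \<in> ?S \<Longrightarrow> (\<lambda>k. p' k y h) \<longlonglongrightarrow> g' y h" by metis
    have close: "cmod (p' k y h - g' y h) \<le> (1 / real (Suc k)) / d * norm h" if y: "y \<in> ?S" for y and h :: "complex ^ 'd" and k
    proof (rule LIMSEQ_le)
      show "(\<lambda>l. cmod (p' k y h - p' l y h)) \<longlonglongrightarrow> cmod (p' k y h - g' y h)"
        by (intro tendsto_intros g' y)
      have "(\<lambda>l. (1 / real (Suc k) + 1 / real (Suc l)) / d * norm h) \<longlonglongrightarrow> (1 / real (Suc k) + 0) / d * norm h"
        by (intro tendsto_intros inv0) (use d in auto)
      then show "(\<lambda>l. (1 / real (Suc k) + 1 / real (Suc l)) / d * norm h) \<longlonglongrightarrow> (1 / real (Suc k)) / d * norm h"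
        by simp
      show "\<exists>N. \<forall>n\<ge>N. cmod (p' k y h - p' n y h) \<le> (1 / real (Suc k) + 1 / real (Suc n)) / d * norm h"
        using diff[OF y] by blast
    qed
    have plim: "(\<lambda>k. p k y) \<longlonglongrightarrow> f y" if "y \<in> unit_ball" for y
    proof (rule LIM_zero_cancel, rule Lim_null_comparison[OF _ inv0])
      show "\<forall>\<^sub>F k in sequentially. norm (p k y - f y) \<le> 1 / real (Suc k)"
        using pf[OF that] by (simp add: norm_minus_commute)
    qed
    have xS: "x \<in> ?S" using d by simp
    have "\<exists>G. \<forall>y\<in>?S. (\<lambda>k. p k y) \<longlonglongrightarrow> G y \<and> (G has_derivative g' y) (at y within ?S)"
    proof (rule has_derivative_sequence[where f' = p'])
      show "convex ?S" by simp
      show "(p n has_derivative p' n y) (at y within ?S)" for n y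
        using p'(1) has_derivative_at_withinI by blast
      show "\<forall>\<^sub>F n in sequentially. \<forall>y\<in>?S. \<forall>h. norm (p' n y h - g' y h) \<le> e * norm h" if "e > 0" for e
      proof -
        have "(\<lambda>k. (1 / real (Suc k)) / d) \<longlonglongrightarrow> 0 / d" by (intro tendsto_intros inv0) (use d in auto)
        then have "\<forall>\<^sub>F k in sequentially. (1 / real (Suc k)) / d < e"
          using that by (intro order_tendstoD(2)) auto
        then show ?thesis
        proof (rule eventually_mono, intro ballI allI)
          fix k y and h :: "complex ^ 'd" assume k: "(1 / real (Suc k)) / d < e" and y: "y \<in> ?S"
          have "(1 / real (Suc k)) / d * norm h \<le> e * norm h" using k by (intro mult_right_mono) auto
          then show "norm (p' k y h - g' y h) \<le> e * norm h" using close[OF y, of k h] by linarith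
        qed
      qed
      show "x \<in> ?S" by (rule xS)
      show "(\<lambda>n. p n x) \<longlonglongrightarrow> f x" by (rule plim[OF x])
    qed
    then obtain G where G: "\<And>y. y \<in> ?S \<Longrightarrow> (\<lambda>k. p k y) \<longlonglongrightarrow> G y"
      "\<And>y. y \<in> ?S \<Longrightarrow> (G has_derivative g' y) (at y within ?S)" by blast
    have "G y = f y" if "y \<in> ?S" for y
      using LIMSEQ_unique[OF G(1)[OF that] plim] that S by blast
    moreover have "(G has_derivative g' x) (at x)"
      using G(2)[OF xS] at_within_open[OF xS open_ball] by simp
    ultimately have "(f has_derivative g' x) (at x)"
      using has_derivative_transform_within_open[OF _ open_ball xS] by metis
    moreover have "g' x (c *s v) = c * g' x v" for c v
    proof (rule LIMSEQ_unique[OF g'[OF xS]])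
      show "(\<lambda>k. p' k x (c *s v)) \<longlonglongrightarrow> c * g' x v"
        unfolding p'(2) by (intro tendsto_intros g' xS)
    qed
    ultimately show ?thesis unfolding complex_differentiable_def by blast
  qed
  then show ?thesis
    using g uniformly_continuous_imp_continuous[OF g(1)] unfolding closure_unit_ball
    by (intro ball_algebraI[OF f, of g]) auto
qed

section \<open>Density of the polynomials in the ball algebra\<close>

definition update_coord :: "complex ^ 'd \<Rightarrow> 'd \<Rightarrow> complex \<Rightarrow> complex ^ 'd" where
  "update_coord z i t = (\<chi> j. if j = i then t else z $ j)"

definition lagrange_basis :: "nat \<Rightarrow> nat \<Rightarrow> complex \<Rightarrow> complex" where
  "lagrange_basis k j t = (\<Prod>i\<in>{..k} - {j}. (t - of_nat i) / (of_nat j - of_nat i))"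

lemma lagrange_basis_node:
  "l \<le> k \<Longrightarrow> j \<le> k \<Longrightarrow> lagrange_basis k j (of_nat l) = (if l = j then 1 else 0)"
  unfolding lagrange_basis_def by (auto intro!: prod.neutral)

lemma lagrange_interpolation:
  fixes c :: "nat \<Rightarrow> complex"
  shows "(\<Sum>m\<le>k. c m * t ^ m) = (\<Sum>j\<le>k. (\<Sum>m\<le>k. c m * of_nat j ^ m) * lagrange_basis k j t)"
proof -
  \<comment> \<open>Both sides are polynomials of degree at most \<open>k\<close> that agree at the \<open>k + 1\<close> nodes.\<close>
  define p where "p = (\<Sum>m\<le>k. monom (c m) m)"
  define b where "b j = (\<Prod>i\<in>{..k} - {j}. smult (1 / (of_nat j - of_nat i)) [:- of_nat i, 1 :: complex:])" for j
  define q where "q = (\<Sum>j\<le>k. smult (poly p (of_nat j)) (b j))"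
  have p: "poly p t = (\<Sum>m\<le>k. c m * t ^ m)" for t by (simp add: p_def poly_sum poly_monom)
  have b: "poly (b j) t = lagrange_basis k j t" for j t
    unfolding b_def lagrange_basis_def poly_prod by (intro prod.cong refl) (simp add: diff_divide_distrib)
  have q: "poly q t = (\<Sum>j\<le>k. poly p (of_nat j) * lagrange_basis k j t)" for t
    by (simp add: q_def poly_sum b)
  have "degree p \<le> k" unfolding p_def
    by (intro degree_sum_le) (auto intro: order_trans[OF degree_monom_le])
  moreover have "degree q \<le> k" unfolding q_def
  proof (intro degree_sum_le)
    fix j assume "j \<in> {..k}"
    have "degree (b j) \<le> (\<Sum>i\<in>{..k} - {j}. degree (smult (1 / (of_nat j - of_nat i)) [:- of_nat i, 1 :: complex:]))"
      unfolding b_def by (rule order_trans[OF degree_prod_sum_le]) (simp_all add: o_def)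
    also have "\<dots> \<le> (\<Sum>i\<in>{..k} - {j}. 1)" by (intro sum_mono) simp
    also have "\<dots> \<le> k" using \<open>j \<in> {..k}\<close> by simp
    finally show "degree (smult (poly p (of_nat j)) (b j)) \<le> k"
      using degree_smult_le order_trans by blast
  qed simp
  moreover have "card (of_nat ` {..k} :: complex set) = Suc k" by (subst card_image) (auto simp: inj_on_def)
  moreover have "poly p x = poly q x" if x: "x \<in> of_nat ` {..k}" for x
  proof -
    obtain l where l: "l \<le> k" "x = of_nat l" using x by auto
    have "poly q x = (\<Sum>j\<le>k. poly p (of_nat j) * (if l = j then 1 else 0))"
      unfolding q l(2) using l(1) by (intro sum.cong refl) (simp add: lagrange_basis_node)
    also have "\<dots> = poly p x"
      using l by (simp add: if_distrib[of "\<lambda>y. _ * y"] cong: if_cong)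
    finally show ?thesis by simp
  qed
  ultimately have "p = q" by (intro poly_eqI_degree[of "of_nat ` {..k}"]) auto
  then show ?thesis using p[of t] q[of t] p by simp
qed

lemma polynomial_fun_lagrange_basis: "polynomial_fun (\<lambda>z. lagrange_basis k j (z $ i))"
proof -
  have "polynomial_fun (\<lambda>z. (z $ i - of_nat l) / (of_nat j - of_nat l))" for l
  proof -
    have "(\<lambda>z :: complex ^ 'a. (z $ i - of_nat l) / (of_nat j - of_nat l))
        = (\<lambda>z. (1 / (of_nat j - of_nat l)) * (z $ i + (- of_nat l)))" by auto
    then show ?thesis
      by (simp only:) (intro polynomial_fun_mult polynomial_fun_const polynomial_fun_add polynomial_fun_coord)
  qed
  then show ?thesis unfolding lagrange_basis_def by (intro polynomial_fun_prod) auto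
qed

text \<open>
  Lagrange interpolation at \<open>0, \<dots>, k\<close> in one coordinate writes \<open>F\<close> as a sum of products of a polynomial in
  that coordinate with functions that no longer depend on it. Doing this for all coordinates in turn leaves
  constants.
\<close>

lemma polynomial_fun_if_separately_polynomial:
  fixes F :: "complex ^ 'd \<Rightarrow> complex"
  assumes sep: "\<And>z i. \<exists>c. \<forall>t. F (update_coord z i t) = (\<Sum>m\<le>k. c m * t ^ m)"
  shows "polynomial_fun F"
proof -
  have gen: "polynomial_fun F"
    if "finite I" and "\<And>z z'. (\<And>i. i \<in> I \<Longrightarrow> z $ i = z' $ i) \<Longrightarrow> F z = F z'"
      and "\<And>z i. \<exists>c. \<forall>t. F (update_coord z i t) = (\<Sum>m\<le>k. c m * t ^ m)" for I and F :: "complex ^ 'd \<Rightarrow> complex"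
    using that
  proof (induction I arbitrary: F rule: finite_induct)
    case empty
    have "F = (\<lambda>z. F 0)" using empty.prems(1) by blast
    then show ?case using polynomial_fun_const by metis
  next
    case (insert i I)
    have F: "F z = (\<Sum>j\<le>k. F (update_coord z i (of_nat j)) * lagrange_basis k j (z $ i))" for z
    proof -
      obtain c where c: "\<And>t. F (update_coord z i t) = (\<Sum>m\<le>k. c m * t ^ m)" using insert.prems(2) by blast
      have "update_coord z i (z $ i) = z" by (simp add: update_coord_def vec_eq_iff)
      then show ?thesis using c[of "z $ i"] lagrange_interpolation[where c = c and k = k and t = "z $ i"] c by simp
    qed
    have "polynomial_fun (\<lambda>z. F (update_coord z i (of_nat j)))" for j
    proof (rule insert.IH)
      show "F (update_coord z i (of_nat j)) = F (update_coord z' i (of_nat j))"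
        if "\<And>i. i \<in> I \<Longrightarrow> z $ i = z' $ i" for z z'
        by (rule insert.prems(1)) (use that in \<open>auto simp: update_coord_def\<close>)
      show "\<exists>c. \<forall>t. F (update_coord (update_coord z l t) i (of_nat j)) = (\<Sum>m\<le>k. c m * t ^ m)" for z l
      proof (cases "l = i")
        case True
        then have "update_coord (update_coord z l t) i (of_nat j) = update_coord z i (of_nat j)" for t
          by (simp add: update_coord_def vec_eq_iff)
        then show ?thesis
          by (intro exI[of _ "\<lambda>m. if m = 0 then F (update_coord z i (of_nat j)) else 0"])
            (simp add: if_distrib if_distribR cong: if_cong)
      next
        case False
        then have "update_coord (update_coord z l t) i (of_nat j) = update_coord (update_coord z i (of_nat j)) l t" for t
          by (auto simp: update_coord_def vec_eq_iff)
        then show ?thesis using insert.prems(2) by metis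
      qed
    qed
    then have "polynomial_fun (\<lambda>z. \<Sum>j\<le>k. F (update_coord z i (of_nat j)) * lagrange_basis k j (z $ i))"
      by (intro polynomial_fun_sum polynomial_fun_mult polynomial_fun_lagrange_basis) auto
    moreover have "(\<lambda>z. \<Sum>j\<le>k. F (update_coord z i (of_nat j)) * lagrange_basis k j (z $ i)) = F"
      by (rule ext) (rule F[symmetric])
    ultimately show ?case by (simp only:)
  qed
  show ?thesis
  proof (rule gen[of "UNIV :: 'd set"])
    show "finite (UNIV :: 'd set)" by simp
    show "F z = F z'" if "\<And>i. i \<in> UNIV \<Longrightarrow> z $ i = z' $ i" for z z'
    proof -
      have "z = z'" using that by (simp add: vec_eq_iff)
      then show ?thesis by simp
    qed
  qed (rule sep)
qed

text \<open>
  The homogeneous part of degree \<open>k\<close> in the Taylor expansion of \<open>f\<close> at 0, read off from the slices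
  \<open>t \<mapsto> f (t z)\<close>. The definition makes sense for all \<open>z\<close>, even if \<open>f\<close> is only given on the ball, since a
  slice is needed only near \<open>t = 0\<close>.
\<close>

definition homogeneous_part :: "(complex ^ 'd \<Rightarrow> complex) \<Rightarrow> nat \<Rightarrow> complex ^ 'd \<Rightarrow> complex" where
  "homogeneous_part f k z = (deriv ^^ k) (\<lambda>t. f (t *s z)) 0 / fact k"

lemma open_slice: "open {t. v + t *s h \<in> (unit_ball :: (complex ^ 'd) set)}"
proof -
  have "continuous_on UNIV (\<lambda>t. v + t *s h)"
    by (intro continuous_intros linear_continuous_on bounded_linear_scale_vec)
  from open_vimage[OF open_unit_ball this] show ?thesis by (simp add: vimage_def)
qed

context
  fixes f :: "complex ^ 'd \<Rightarrow> complex" and B :: real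
  assumes diff: "\<And>z. z \<in> unit_ball \<Longrightarrow> complex_differentiable f z"
    and bound: "\<And>z. z \<in> unit_ball \<Longrightarrow> cmod (f z) \<le> B"
begin

lemma radial_slice_holomorphic: "(\<lambda>t. f (t *s z)) holomorphic_on {t. t *s z \<in> unit_ball}"
  using slice_holomorphic(1)[of "{t. 0 + t *s z \<in> unit_ball}" f 0 z] diff open_slice[of 0 z] by simp

lemma homogeneous_part_scale: "homogeneous_part f k (c *s z) = c ^ k * homogeneous_part f k z"
proof -
  have o: "open {t. (c * t) *s z \<in> unit_ball}"
    using open_slice[of 0 "c *s z"] by (simp add: mult.commute)
  have "(deriv ^^ k) (\<lambda>w. f ((c * w) *s z)) 0 = c ^ k * (deriv ^^ k) (\<lambda>t. f (t *s z)) (c * 0)"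
    by (rule higher_deriv_compose_linear[OF radial_slice_holomorphic o])
      (use open_slice[of 0 z] zero_mem_unit_ball in simp_all)
  then show ?thesis unfolding homogeneous_part_def by (simp add: mult.commute)
qed

lemma homogeneous_part_bound_ball:
  assumes z: "z \<in> unit_ball" shows "cmod (homogeneous_part f k z) \<le> B"
proof -
  have sub: "cball 0 1 \<subseteq> {t. t *s z \<in> unit_ball}"
  proof
    fix t :: complex assume "t \<in> cball 0 1"
    then have "cmod t * norm z \<le> 1 * norm z" by (intro mult_right_mono) auto
    then show "t \<in> {t. t *s z \<in> unit_ball}" using z by (simp add: unit_ball_def norm_scale_vec)
  qed
  have hol: "(\<lambda>t. f (t *s z)) holomorphic_on cball 0 1"
    by (rule holomorphic_on_subset[OF radial_slice_holomorphic sub])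
  have "cmod ((deriv ^^ k) (\<lambda>t. f (t *s z)) 0) \<le> fact k * B / 1 ^ k"
  proof (rule Cauchy_inequality)
    show "(\<lambda>t. f (t *s z)) holomorphic_on ball 0 1" by (rule holomorphic_on_subset[OF hol]) auto
    show "continuous_on (cball 0 1) (\<lambda>t. f (t *s z))" by (rule holomorphic_on_imp_continuous_on[OF hol])
    show "cmod (f (t *s z)) \<le> B" if "norm (0 - t) = 1" for t
    proof (rule bound)
      have "t \<in> cball 0 1" using that by simp
      then show "t *s z \<in> unit_ball" using sub by blast
    qed
  qed simp
  then show ?thesis unfolding homogeneous_part_def by (simp add: norm_divide field_simps)
qed

text \<open>
  Scale \<open>z\<close> into the ball by the factor \<open>1 + norm z\<close> and use homogeneity.
\<close>

lemma homogeneous_part_growth: "cmod (homogeneous_part f k z) \<le> B * (1 + norm z) ^ k"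
proof -
  define r where "r = 1 + norm z"
  have r: "r > 0" unfolding r_def by (simp add: add_pos_nonneg)
  define w where "w = complex_of_real (1 / r) *s z"
  have w: "w \<in> unit_ball" using r by (simp add: w_def unit_ball_def norm_scale_vec norm_divide) (simp add: r_def)
  have "z = complex_of_real r *s w" using r unfolding w_def by (simp add: vec_eq_iff)
  then have "homogeneous_part f k z = of_real r ^ k * homogeneous_part f k w"
    using homogeneous_part_scale by metis
  then have "cmod (homogeneous_part f k z) = r ^ k * cmod (homogeneous_part f k w)"
    using r by (simp add: norm_mult norm_power)
  also have "\<dots> \<le> r ^ k * B" using homogeneous_part_bound_ball[OF w] r by (intro mult_left_mono) auto
  finally show ?thesis unfolding r_def by (simp add: mult.commute)
qed

lemma homogeneous_expansion_tail:
  assumes z: "z \<in> unit_ball" and t: "cmod t < 1"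
  shows "cmod (f (t *s z) - (\<Sum>k<N. t ^ k * homogeneous_part f k z)) \<le> B * cmod t ^ N / (1 - cmod t)"
proof -
  have sub: "ball 0 1 \<subseteq> {t. t *s z \<in> unit_ball}"
  proof
    fix t :: complex assume "t \<in> ball 0 1"
    then have "cmod t * norm z \<le> 1 * norm z" by (intro mult_right_mono) auto
    then show "t \<in> {t. t *s z \<in> unit_ball}" using z by (simp add: unit_ball_def norm_scale_vec)
  qed
  have "(\<lambda>k. (deriv ^^ k) (\<lambda>t. f (t *s z)) 0 / fact k * (t - 0) ^ k) sums f (t *s z)"
    by (rule holomorphic_power_series[of _ 0 1])
      (use holomorphic_on_subset[OF radial_slice_holomorphic sub] t in auto)
  then have "(\<lambda>k. t ^ k * homogeneous_part f k z) sums f (t *s z)"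
    unfolding homogeneous_part_def by (simp add: mult.commute)
  then have s: "(\<lambda>k. t ^ (k + N) * homogeneous_part f (k + N) z) sums (f (t *s z) - (\<Sum>k<N. t ^ k * homogeneous_part f k z))"
    by (rule sums_split_initial_segment)
  have g: "(\<lambda>k. (B * cmod t ^ N) * cmod t ^ k) sums ((B * cmod t ^ N) * (1 / (1 - cmod t)))"
    by (intro sums_mult geometric_sums) (use t in simp)
  have "cmod (f (t *s z) - (\<Sum>k<N. t ^ k * homogeneous_part f k z)) \<le> (B * cmod t ^ N) * (1 / (1 - cmod t))"
  proof (rule norm_sums_le[OF s g])
    fix k
    have "cmod (t ^ (k + N) * homogeneous_part f (k + N) z) \<le> cmod t ^ (k + N) * B"
      unfolding norm_mult norm_power by (intro mult_left_mono homogeneous_part_bound_ball z) auto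
    then show "cmod (t ^ (k + N) * homogeneous_part f (k + N) z) \<le> (B * cmod t ^ N) * cmod t ^ k"
      by (simp add: power_add mult_ac)
  qed
  then show ?thesis by simp
qed

lemma B_nonneg: "B \<ge> 0"
  using bound[OF zero_mem_unit_ball] norm_ge_zero order_trans by blast

text \<open>
  Write \<open>f\<^sub>m\<close> for the homogeneous parts. By the bound on the tail of the expansion, \<open>f\<^sub>k\<close> is the uniform
  limit on the ball, as \<open>t\<close> tends to 0, of \<open>(f (t z) - \<Sum> t ^ m f\<^sub>m z) / t ^ k\<close>, where the sum runs over
  \<open>m < k\<close>. By induction these functions are holomorphic on every complex line.
\<close>

lemma homogeneous_part_slice_holomorphic_ball:
  "(\<lambda>t. homogeneous_part f k (v + t *s h)) holomorphic_on {t. v + t *s h \<in> unit_ball}"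
proof (induction k rule: less_induct)
  case (less k)
  let ?S = "{t. v + t *s h \<in> unit_ball}"
  \<comment> \<open>A null sequence with values at most \<open>1/2\<close>, so that the geometric series in the tail sums to at most 2.\<close>
  define a where "a n = complex_of_real (1 / (real n + 2))" for n
  have a: "cmod (a n) = 1 / (real n + 2)" "a n \<noteq> 0" for n
    unfolding a_def norm_of_real by (simp_all only: of_real_eq_0_iff) auto
  have a2: "cmod (a n) \<le> 1 / 2" for n unfolding a(1) by (simp add: field_simps)
  define G where "G n t = (f (a n *s (v + t *s h)) - (\<Sum>m<k. a n ^ m * homogeneous_part f m (v + t *s h))) / a n ^ k" for n t
  have in_ball: "a n *s w \<in> unit_ball" if "w \<in> unit_ball" for w :: "complex ^ 'd" and n
  proof -
    have "cmod (a n) * norm w \<le> 1 * norm w" using a2[of n] by (intro mult_right_mono) auto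
    then show ?thesis using that by (simp add: unit_ball_def norm_scale_vec)
  qed
  have hol: "G n holomorphic_on ?S" for n
  proof -
    have eq: "a n *s (v + t *s h) = a n *s v + t *s (a n *s h)" for t
      by (simp add: vec_eq_iff algebra_simps)
    have "(\<lambda>t. f (a n *s v + t *s (a n *s h))) holomorphic_on ?S"
      by (rule slice_holomorphic(1)[OF _ open_slice]) (use in_ball diff eq in \<open>metis mem_Collect_eq\<close>)
    then show ?thesis unfolding G_def eq using a(2)[of n] less by (intro holomorphic_intros) auto
  qed
  have close: "cmod (G n t - homogeneous_part f k (v + t *s h)) \<le> 2 * B / (real n + 2)" if t: "t \<in> ?S" for n t
  proof -
    let ?z = "v + t *s h"
    define D where "D = f (a n *s ?z) - (\<Sum>m<Suc k. a n ^ m * homogeneous_part f m ?z)"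
    have tail: "cmod D \<le> B * cmod (a n) ^ Suc k / (1 - cmod (a n))"
      unfolding D_def by (rule homogeneous_expansion_tail) (use t a2[of n] in auto)
    have "G n t - homogeneous_part f k ?z = D / a n ^ k"
      unfolding G_def D_def using a(2)[of n] by (simp add: field_simps)
    then have "cmod (G n t - homogeneous_part f k ?z) \<le> (B * cmod (a n) ^ Suc k / (1 - cmod (a n))) / cmod (a n) ^ k"
      using divide_right_mono[OF tail, of "cmod (a n) ^ k"] by (simp add: norm_divide norm_power)
    also have "\<dots> = B * cmod (a n) * (1 / (1 - cmod (a n)))" using a(2)[of n] by simp
    also have "\<dots> \<le> B * cmod (a n) * 2"
      using a2[of n] B_nonneg by (intro mult_left_mono) (auto simp: field_simps)
    finally show ?thesis unfolding a(1) by (simp add: mult.commute)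
  qed
  have ul: "uniform_limit ?S G (\<lambda>t. homogeneous_part f k (v + t *s h)) sequentially"
  proof (rule uniform_limitI)
    fix e :: real assume "e > 0"
    have "(\<lambda>n. 2 * B / (real n + 2)) \<longlonglongrightarrow> 0"
      using LIMSEQ_ignore_initial_segment[OF lim_const_over_n[of "2 * B"], of 2] by (simp add: add.commute)
    then have "\<forall>\<^sub>F n in sequentially. 2 * B / (real n + 2) < e" using \<open>e > 0\<close> by (rule order_tendstoD(2))
    then show "\<forall>\<^sub>F n in sequentially. \<forall>t\<in>?S. dist (G n t) (homogeneous_part f k (v + t *s h)) < e"
      unfolding dist_norm by (rule eventually_mono) (use close le_less_trans in blast)
  qed
  show ?case
  proof (rule holomorphic_uniform_sequence[OF open_slice hol])
    fix x assume "x \<in> ?S"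
    then obtain d where "d > 0" "cball x d \<subseteq> ?S" using open_slice open_contains_cball by blast
    then show "\<exists>d>0. cball x d \<subseteq> ?S \<and> uniform_limit (cball x d) G (\<lambda>t. homogeneous_part f k (v + t *s h)) sequentially"
      using uniform_limit_on_subset[OF ul] by blast
  qed
qed

lemma homogeneous_part_slice_entire:
  "(\<lambda>t. homogeneous_part f k (v + t *s h)) holomorphic_on UNIV"
proof -
  have "(\<lambda>t. homogeneous_part f k (v + t *s h)) field_differentiable at t0" for t0 :: complex
  proof -
    define R where "R = cmod t0 + 1"
    define r where "r = 1 + norm v + R * norm h"
    have R: "R > 0" unfolding R_def by (simp add: add_nonneg_pos)
    have r: "r > 0" unfolding r_def using R by (simp add: add_pos_nonneg)
    define c where "c = complex_of_real (1 / r)"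
    have sub: "ball 0 R \<subseteq> {t. c *s v + t *s (c *s h) \<in> unit_ball}"
    proof
      fix t :: complex assume "t \<in> ball 0 R"
      then have "cmod t * norm h \<le> R * norm h" by (intro mult_right_mono) auto
      then have lt: "norm (v + t *s h) < r"
        using norm_triangle_ineq[of v "t *s h"] unfolding r_def norm_scale_vec by linarith
      have eq: "c *s v + t *s (c *s h) = c *s (v + t *s h)" by (simp add: vec_eq_iff algebra_simps)
      have "cmod c = 1 / r" using r by (simp add: c_def norm_divide)
      then have "norm (c *s (v + t *s h)) < 1"
        unfolding norm_scale_vec using lt r by (simp add: divide_less_eq)
      then show "t \<in> {t. c *s v + t *s (c *s h) \<in> unit_ball}"
        by (simp only: eq unit_ball_def mem_Collect_eq mem_ball_0)
    qed
    have "(\<lambda>t. of_real r ^ k * homogeneous_part f k (c *s v + t *s (c *s h))) holomorphic_on ball 0 R"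
      by (intro holomorphic_intros holomorphic_on_subset[OF homogeneous_part_slice_holomorphic_ball sub])
    moreover have "of_real r ^ k * homogeneous_part f k (c *s v + t *s (c *s h)) = homogeneous_part f k (v + t *s h)" for t
    proof -
      have "v + t *s h = of_real r *s (c *s v + t *s (c *s h))"
        using r by (simp add: vec_eq_iff c_def field_simps)
      then show ?thesis using homogeneous_part_scale by metis
    qed
    ultimately have "(\<lambda>t. homogeneous_part f k (v + t *s h)) holomorphic_on ball 0 R" by simp
    then show ?thesis
      by (rule holomorphic_on_imp_differentiable_at) (simp_all add: R_def)
  qed
  then show ?thesis by (simp add: holomorphic_on_def field_differentiable_at_within)
qed

text \<open>
  In each coordinate the function is entire and grows at most like the power \<open>k\<close>, so it is a polynomial of
  degree at most \<open>k\<close> by Liouville's theorem.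
\<close>

lemma homogeneous_part_polynomial: "polynomial_fun (homogeneous_part f k)"
proof (rule polynomial_fun_if_separately_polynomial[where k = k])
  fix z :: "complex ^ 'd" and i :: 'd
  define v where "v = update_coord z i 0"
  define e where "e = (axis i 1 :: complex ^ 'd)"
  have upd: "update_coord z i t = v + t *s e" for t
    by (auto simp: v_def e_def update_coord_def axis_def vec_eq_iff)
  have e: "norm e = 1" by (simp add: e_def norm_axis_1)
  let ?\<phi> = "\<lambda>t. homogeneous_part f k (v + t *s e)"
  have "?\<phi> t = (\<Sum>m\<le>k. (deriv ^^ m) ?\<phi> 0 / fact m * t ^ m)" for t
  proof (rule Liouville_polynomial[OF homogeneous_part_slice_entire])
    fix t :: complex assume t: "1 + norm v \<le> cmod t"
    have "norm (v + t *s e) \<le> norm v + cmod t" using norm_triangle_ineq[of v "t *s e"] e by (simp add: norm_scale_vec)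
    then have "(1 + norm (v + t *s e)) ^ k \<le> (2 * cmod t) ^ k" using t by (intro power_mono) auto
    then have "B * (1 + norm (v + t *s e)) ^ k \<le> B * (2 * cmod t) ^ k" using B_nonneg by (rule mult_left_mono)
    then show "cmod (?\<phi> t) \<le> (B * 2 ^ k) * cmod t ^ k"
      using homogeneous_part_growth[of k "v + t *s e"] by (simp add: power_mult_distrib)
  qed
  then show "\<exists>c. \<forall>t. homogeneous_part f k (update_coord z i t) = (\<Sum>m\<le>k. c m * t ^ m)"
    unfolding upd by (intro exI allI)
qed

end

text \<open>
  By uniform continuity, \<open>f\<close> is close to its dilation \<open>z \<mapsto> f (r z)\<close> for \<open>r\<close> close to 1, and the homogeneous
  expansion of the dilation converges uniformly on the ball.
\<close>

theorem polynomials_dense_in_ball_algebra: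
  fixes f :: "complex ^ 'd \<Rightarrow> complex"
  assumes f: "f \<in> ball_algebra" and e: "e > 0"
  shows "\<exists>p. polynomial_fun p \<and> (\<forall>z\<in>unit_ball. cmod (f z - p z) \<le> e)"
proof -
  obtain g where g: "continuous_on (cball 0 1) g" "\<And>z. z \<in> unit_ball \<Longrightarrow> g z = f z"
    using f unfolding ball_algebra_def closure_unit_ball by blast
  have diff: "complex_differentiable f z" if "z \<in> unit_ball" for z
    using f that unfolding ball_algebra_def holomorphic_in_iff by blast
  define B where "B = ball_sup_norm f"
  have bound: "cmod (f z) \<le> B" if "z \<in> unit_ball" for z unfolding B_def by (rule cmod_le_ball_sup_norm[OF f that])
  have "uniformly_continuous_on (cball 0 1) g" by (intro compact_uniformly_continuous g compact_cball)
  then obtain d where d: "d > 0"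
    "\<And>x y. x \<in> cball 0 1 \<Longrightarrow> y \<in> cball 0 1 \<Longrightarrow> dist y x < d \<Longrightarrow> dist (g y) (g x) < e / 2"
    unfolding uniformly_continuous_on_def using e by (metis half_gt_zero)
  define r where "r = max (1 / 2) (1 - d / 2)"
  have r: "0 < r" "r < 1" "1 - r < d" using d(1) unfolding r_def by auto
  have rz: "complex_of_real r *s z \<in> unit_ball" if "z \<in> unit_ball" for z :: "complex ^ 'd"
  proof -
    have "r * norm z \<le> 1 * norm z" using r by (intro mult_right_mono) auto
    then show ?thesis using that r by (simp add: unit_ball_def norm_scale_vec)
  qed
  have dil: "cmod (f z - f (of_real r *s z)) \<le> e / 2" if z: "z \<in> unit_ball" for z
  proof -
    have "z - of_real r *s z = complex_of_real (1 - r) *s z" by (simp add: vec_eq_iff algebra_simps)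
    then have "norm (z - of_real r *s z) = (1 - r) * norm z" using r by (simp add: norm_scale_vec del: of_real_diff)
    also have "\<dots> \<le> (1 - r) * 1" using r z by (intro mult_left_mono) (auto simp: unit_ball_def)
    finally have "dist z (of_real r *s z) < d" using r by (simp add: dist_norm)
    then have "dist (g z) (g (of_real r *s z)) < e / 2"
      using z rz[OF z] by (intro d(2)) (auto simp: unit_ball_def)
    then show ?thesis using g(2)[OF z] g(2)[OF rz[OF z]] by (simp add: dist_norm)
  qed
  have "(\<lambda>N. B * r ^ N / (1 - r)) \<longlonglongrightarrow> B * 0 / (1 - r)"
    using r by (intro tendsto_intros LIMSEQ_realpow_zero) auto
  then have "\<forall>\<^sub>F N in sequentially. B * r ^ N / (1 - r) < e / 2"
    using e by (intro order_tendstoD(2)) auto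
  then obtain N where N: "B * r ^ N / (1 - r) < e / 2" unfolding eventually_sequentially by blast
  define p where "p z = (\<Sum>k<N. of_real r ^ k * homogeneous_part f k z)" for z
  have "polynomial_fun p"
    unfolding p_def using homogeneous_part_polynomial[OF diff bound]
    by (intro polynomial_fun_sum polynomial_fun_mult polynomial_fun_const) auto
  moreover have "cmod (f z - p z) \<le> e" if z: "z \<in> unit_ball" for z
  proof -
    have "cmod (f (of_real r *s z) - p z) \<le> B * cmod (of_real r) ^ N / (1 - cmod (of_real r))"
      unfolding p_def by (rule homogeneous_expansion_tail[OF diff bound z]) (use r in auto)
    moreover have "cmod (complex_of_real r) = r" using r by simp
    ultimately have "cmod (f (of_real r *s z) - p z) \<le> B * r ^ N / (1 - r)" by (simp only:)
    then have "cmod (f (of_real r *s z) - p z) \<le> e / 2" using N by linarith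
    moreover have "cmod (f z - p z) \<le> cmod (f z - f (of_real r *s z)) + cmod (f (of_real r *s z) - p z)" by norm
    ultimately show ?thesis using dil[OF z] by linarith
  qed
  ultimately show ?thesis by blast
qed

section \<open>Primary decomposition for commuting matrices\<close>

lemma mat_vec_mult: "mat c *v x = c *s (x :: complex ^ 'n)"
  by (simp add: matrix_vector_mult_def mat_def vec_eq_iff if_distrib if_distribR cong: if_cong)

lemma mat_power_0: "mat_power A 0 = mat 1" and mat_power_Suc: "mat_power A (Suc k) = A ** mat_power A k"
  by (simp_all add: mat_power_def)

lemma mat_power_add: "mat_power A (k + l) = mat_power A k ** mat_power A l"
  by (induction k) (simp_all add: mat_power_0 mat_power_Suc matrix_mul_assoc)

lemma mat_power_1: "mat_power A (Suc 0) = A"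
  by (simp add: mat_power_def)

lemma mat_power_commutes: "A ** B = B ** A \<Longrightarrow> mat_power A k ** B = B ** mat_power A k"
  using mat_power_commute[of A B k "Suc 0"] by (simp add: mat_power_1)

lemma invariant_mat_power:
  "(\<And>u. u \<in> U \<Longrightarrow> A *v u \<in> U) \<Longrightarrow> u \<in> U \<Longrightarrow> mat_power A k *v u \<in> U"
  by (induction k) (simp_all add: mat_power_0 mat_power_Suc matrix_vector_mul_assoc[symmetric])

definition poly_act :: "complex ^ 'n ^ 'n \<Rightarrow> complex poly \<Rightarrow> complex ^ 'n \<Rightarrow> complex ^ 'n" where
  "poly_act A q v = (\<Sum>k\<le>degree q. coeff q k *s (mat_power A k *v v))"

lemma poly_act_eq:
  "degree q \<le> N \<Longrightarrow> poly_act A q v = (\<Sum>k\<le>N. coeff q k *s (mat_power A k *v v))"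
  unfolding poly_act_def by (rule sum.mono_neutral_left) (auto simp: coeff_eq_0)

lemma mat_vec_sum: "A *v (\<Sum>k\<in>I. f k) = (\<Sum>k\<in>I. A *v (f k :: complex ^ 'n))"
  by (induction I rule: infinite_finite_induct) (simp_all add: matrix_vector_right_distrib)

lemma mat_vec_scale: "A *v (c *s x) = c *s (A *v (x :: complex ^ 'n))"
  by (simp add: matrix_vector_mult_def vec_eq_iff sum_distrib_left mult_ac)

lemma poly_act_linear_factor:
  "poly_act A ([:- \<mu>, 1:] * q) v = A *v poly_act A q v - \<mu> *s poly_act A q v"
proof -
  let ?N = "Suc (degree q)"
  have q: "poly_act A q v = (\<Sum>k\<le>?N. coeff q k *s (mat_power A k *v v))" by (rule poly_act_eq) simp
  have "poly_act A ([:- \<mu>, 1:] * q) v = (\<Sum>k\<le>?N. coeff ([:- \<mu>, 1:] * q) k *s (mat_power A k *v v))"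
    by (rule poly_act_eq) (rule order_trans[OF degree_mult_le], simp)
  also have "\<dots> = (\<Sum>k\<le>?N. coeff (pCons 0 q) k *s (mat_power A k *v v)) - \<mu> *s poly_act A q v"
    unfolding q vec.scale_sum_right sum_subtractf[symmetric]
    by (intro sum.cong refl) (simp add: vector_sub_rdistrib vector_smult_assoc)
  also have "(\<Sum>k\<le>?N. coeff (pCons 0 q) k *s (mat_power A k *v v)) = A *v poly_act A q v"
    unfolding sum.atMost_Suc_shift poly_act_def mat_vec_sum
    by (simp add: mat_vec_scale mat_power_Suc matrix_vector_mul_assoc)
  finally show ?thesis .
qed

lemma in_span_image_lessThan:
  "w \<in> vec.span (f ` {..<d}) \<Longrightarrow> \<exists>c. w = (\<Sum>k<d. c k *s ((f :: nat \<Rightarrow> complex ^ 'n) k))"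
proof (induction d arbitrary: w)
  case 0 then show ?case by simp
next
  case (Suc d)
  have "f ` {..<Suc d} = insert (f d) (f ` {..<d})" by (simp add: lessThan_Suc)
  then obtain a where "w - a *s f d \<in> vec.span (f ` {..<d})"
    using Suc.prems by (auto simp: vec.span_insert)
  then obtain c where c: "w - a *s f d = (\<Sum>k<d. c k *s f k)" using Suc.IH by blast
  have "w = (\<Sum>k<Suc d. (if k = d then a else c k) *s f k)"
    using c by (simp add: algebra_simps)
  then show ?case by (intro exI)
qed

text \<open>
  Some vector in the sequence \<open>v, A v, A\<^sup>2 v, \<dots>\<close> depends linearly on the earlier ones.
\<close>

lemma annihilating_poly_exists: "\<exists>q. q \<noteq> 0 \<and> poly_act A q v = 0"
proof -
  let ?f = "\<lambda>k. mat_power A k *v v"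
  have "\<exists>d. ?f d \<in> vec.span (?f ` {..<d})"
  proof (rule ccontr)
    assume no: "\<not> ?thesis"
    have "vec.independent (?f ` {..<d}) \<and> card (?f ` {..<d}) = d" for d
    proof (induction d)
      case 0 then show ?case by (simp add: vec.independent_empty)
    next
      case (Suc d)
      have ns: "?f d \<notin> vec.span (?f ` {..<d})" using no by blast
      have "?f d \<notin> ?f ` {..<d}" by (rule contra_subsetD[OF vec.span_superset ns])
      then show ?case
        using vec.independent_insertI[OF ns] Suc by (simp add: lessThan_Suc)
    qed
    from this[of "Suc CARD('a)"] show False
      using vec.independent_card_le_dim[of "?f ` {..<Suc CARD('a)}" UNIV]
        dim_subset_UNIV_cart_gen[of "UNIV :: (complex ^ 'a) set"] by simp
  qed
  then obtain d where "?f d \<in> vec.span (?f ` {..<d})" by blast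
  then obtain c where c: "?f d = (\<Sum>k<d. c k *s ?f k)" using in_span_image_lessThan by blast
  define q where "q = monom 1 d - (\<Sum>k<d. monom (c k) k)"
  have coeff: "coeff q k = (if k = d then 1 else if k < d then - c k else 0)" for k
    unfolding q_def by (auto simp: coeff_sum)
  have "q \<noteq> 0" using coeff[of d] by auto
  moreover have "degree q \<le> d" by (rule degree_le) (simp add: coeff)
  then have "poly_act A q v = (\<Sum>k\<le>d. coeff q k *s ?f k)" by (rule poly_act_eq)
  then have "poly_act A q v = ?f d - (\<Sum>k<d. c k *s ?f k)"
    by (simp add: lessThan_Suc_atMost[symmetric] coeff sum_negf)
  ultimately show ?thesis using c by auto
qed

text \<open>
  Split linear factors off a polynomial \<open>q\<close> with \<open>q(A) v = 0\<close>. As \<open>v \<noteq> 0\<close>, at some stage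
  \<open>(A - \<mu>) r(A) v = 0\<close> with \<open>r(A) v \<noteq> 0\<close>.
\<close>

lemma eigenvector_exists:
  fixes A :: "complex ^ 'n ^ 'n"
  assumes U: "vec.subspace U" and inv: "\<And>u. u \<in> U \<Longrightarrow> A *v u \<in> U" and v: "v \<in> U" "v \<noteq> 0"
  shows "\<exists>\<mu> w. w \<in> U \<and> w \<noteq> 0 \<and> A *v w = \<mu> *s w"
proof -
  obtain q where "q \<noteq> 0" "poly_act A q v = 0" using annihilating_poly_exists by blast
  then show ?thesis
  proof (induction "degree q" arbitrary: q rule: less_induct)
    case less
    show ?case
    proof (cases "degree q = 0")
      case True
      then have "coeff q 0 \<noteq> 0" using less.prems(1) by (metis leading_coeff_0_iff)
      moreover have "coeff q 0 *s v = 0" using less.prems(2) True by (simp add: poly_act_def mat_power_0)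
      ultimately show ?thesis using v by simp
    next
      case False
      have "coeff q 0 = 0 \<or> (\<exists>i\<in>{1..degree q}. coeff q i \<noteq> 0)"
        using False less.prems(1) by (intro disjI2 bexI[of _ "degree q"]) auto
      then obtain \<mu> where "(\<Sum>i\<le>degree q. coeff q i * \<mu> ^ i) = 0"
        using fundamental_theorem_of_algebra by blast
      then have "poly q \<mu> = 0" by (simp add: poly_altdef)
      then obtain r where r: "q = [:- \<mu>, 1:] * r" by (auto simp: poly_eq_0_iff_dvd elim: dvdE)
      then have "r \<noteq> 0" using less.prems by auto
      then have deg: "degree r < degree q" unfolding r by (subst degree_mult_eq) auto
      show ?thesis
      proof (cases "poly_act A r v = 0")
        case True
        then show ?thesis using less.hyps[OF deg \<open>r \<noteq> 0\<close>] by blast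
      next
        case False
        moreover have "poly_act A r v \<in> U"
          unfolding poly_act_def using v(1) inv
          by (intro vec.subspace_sum vec.subspace_scale U invariant_mat_power) auto
        moreover have "A *v poly_act A r v = \<mu> *s poly_act A r v"
          using less.prems(2) unfolding r poly_act_linear_factor by simp
        ultimately show ?thesis by blast
      qed
    qed
  qed
qed

text \<open>
  For large \<open>m\<close> both the image and the kernel of \<open>A ^ m\<close> on \<open>U\<close> have stabilized. Then \<open>U\<close> is the direct sum
  of the two: the second claim says that they span \<open>U\<close>, the third that they meet only in 0.
\<close>

lemma fitting:
  fixes A :: "complex ^ 'n ^ 'n"
  assumes U: "vec.subspace U" and inv: "\<And>u. u \<in> U \<Longrightarrow> A *v u \<in> U"
  obtains m where "m > 0" and "\<And>u. u \<in> U \<Longrightarrow> \<exists>w\<in>U. mat_power A m *v (u - mat_power A m *v w) = 0"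
    and "\<And>u. u \<in> U \<Longrightarrow> mat_power A m *v (mat_power A m *v u) = 0 \<Longrightarrow> mat_power A m *v u = 0"
proof -
  define I where "I k = (*v) (mat_power A k) ` U" for k
  define K where "K k = {u \<in> U. mat_power A k *v u = 0}" for k
  have I: "vec.subspace (I k)" for k
    unfolding I_def by (rule vec.linear_subspace_image[OF matrix_vector_mul_linear_gen U])
  have K: "vec.subspace (K k)" for k
    unfolding K_def using U by (auto simp: vec.subspace_def matrix_vector_right_distrib mat_vec_scale)
  have Imono: "I (k + l) \<subseteq> I k" for k l
    unfolding I_def mat_power_add using invariant_mat_power[OF inv]
    by (auto simp: matrix_vector_mul_assoc[symmetric])
  have Kmono: "K k \<subseteq> K (k + l)" for k l
    unfolding K_def add.commute[of k l] mat_power_add by (auto simp: matrix_vector_mul_assoc[symmetric])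
  obtain m0 where m0: "\<And>k. vec.dim (I m0) \<le> vec.dim (I k)"
    using ex_has_least_nat[of "\<lambda>_. True" 0 "\<lambda>k. vec.dim (I k)"] by auto
  have "\<forall>k. True \<longrightarrow> vec.dim (K k) < Suc CARD('n)"
    using dim_subset_UNIV_cart_gen by (auto simp: less_Suc_eq_le)
  then obtain m1 where m1: "\<And>k. vec.dim (K k) \<le> vec.dim (K m1)"
    using ex_has_greatest_nat[of "\<lambda>_. True" 0 "\<lambda>k. vec.dim (K k)" "Suc CARD('n)"] by auto
  have Ieq: "I (m0 + l) = I m0" for l
    by (rule vec.subspace_dim_equal[OF I I Imono m0])
  have Keq: "K m1 = K (m1 + l)" for l
    by (rule vec.subspace_dim_equal[OF K K Kmono m1])
  define m where "m = m0 + m1 + 1"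
  have I2: "I (m + m) = I m"
    using Ieq[of "m1 + 1"] Ieq[of "m1 + 1 + m"] unfolding m_def by (simp add: add_ac)
  have K2: "K (m + m) = K m"
    using Keq[of "m0 + 1"] Keq[of "m0 + 1 + m"] unfolding m_def by (simp add: add_ac)
  show thesis
  proof (rule that[of m])
    show "m > 0" unfolding m_def by simp
    show "\<exists>w\<in>U. mat_power A m *v (u - mat_power A m *v w) = 0" if "u \<in> U" for u
    proof -
      have "mat_power A m *v u \<in> I (m + m)" unfolding I2 using that by (auto simp: I_def)
      then obtain w where "w \<in> U" "mat_power A m *v u = mat_power A (m + m) *v w" unfolding I_def by blast
      then show ?thesis
        by (intro bexI[of _ w]) (simp_all add: matrix_vector_mult_diff_distrib mat_power_add matrix_vector_mul_assoc)
    qed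
    show "mat_power A m *v u = 0" if "u \<in> U" "mat_power A m *v (mat_power A m *v u) = 0" for u
    proof -
      have "u \<in> K (m + m)" using that by (simp add: K_def mat_power_add matrix_vector_mul_assoc)
      then show ?thesis unfolding K2 by (simp add: K_def)
    qed
  qed
qed

definition invariant_subspace :: "('d \<Rightarrow> complex ^ 'n ^ 'n) \<Rightarrow> (complex ^ 'n) set \<Rightarrow> bool" where
  "invariant_subspace T U \<longleftrightarrow> vec.subspace U \<and> (\<forall>i. \<forall>u\<in>U. T i *v u \<in> U)"

lemma commuting_shift:
  assumes T: "commuting_tuple T"
  shows "T j ** (T i - mat \<mu>) = (T i - mat \<mu>) ** T j"
  using T mat_comm[of \<mu> "T j"] unfolding commuting_tuple_def
  by (simp add: matrix_diff_ldistrib matrix_diff_rdistrib)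

text \<open>
  If no eigenvalue \<open>\<mu>\<close> of some \<open>T i\<close> makes \<open>T i - \<mu>\<close> nilpotent on \<open>U\<close>, the Fitting decomposition for
  \<open>T i - \<mu>\<close> splits \<open>U\<close> into two smaller invariant subspaces. So every invariant subspace is built by direct
  sums from those on which each \<open>T i\<close> differs from a scalar by a nilpotent matrix.
\<close>

lemma primary_induct:
  fixes T :: "'d::finite \<Rightarrow> complex ^ 'n ^ 'n"
  assumes T: "commuting_tuple T"
    and primary: "\<And>U l m. invariant_subspace T U \<Longrightarrow>
       (\<And>i u. u \<in> U \<Longrightarrow> mat_power (T i - mat (l $ i)) m *v u = 0) \<Longrightarrow> P U"
    and sum: "\<And>U V. invariant_subspace T U \<Longrightarrow> invariant_subspace T V \<Longrightarrow> U \<inter> V = {0} \<Longrightarrow>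
       P U \<Longrightarrow> P V \<Longrightarrow> P {u + v | u v. u \<in> U \<and> v \<in> V}"
  shows "invariant_subspace T U \<Longrightarrow> P U"
proof (induction "vec.dim U" arbitrary: U rule: less_induct)
  case less
  have U: "vec.subspace U" and inv: "\<And>i u. u \<in> U \<Longrightarrow> T i *v u \<in> U"
    using less.prems unfolding invariant_subspace_def by auto
  show ?case
  proof (cases "\<forall>i. \<exists>\<mu> m. \<forall>u\<in>U. mat_power (T i - mat \<mu>) m *v u = 0")
    case True
    then obtain l m where lm: "\<And>i u. u \<in> U \<Longrightarrow> mat_power (T i - mat (l i)) (m i) *v u = 0" by metis
    have "mat_power (T i - mat ((\<chi> i. l i) $ i)) (\<Sum>i\<in>UNIV. m i) *v u = 0" if "u \<in> U" for i u
    proof -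
      have "(\<Sum>i\<in>UNIV. m i) = (\<Sum>j\<in>UNIV - {i}. m j) + m i" by (simp add: sum.remove[of UNIV i] add.commute)
      then show ?thesis using lm[OF that, of i] by (simp add: mat_power_add matrix_vector_mul_assoc[symmetric])
    qed
    then show ?thesis by (rule primary[OF less.prems])
  next
    case False
    then obtain i where i: "\<And>\<mu> m. \<exists>u\<in>U. mat_power (T i - mat \<mu>) m *v u \<noteq> 0" by blast
    obtain v where v: "v \<in> U" "v \<noteq> 0" using i[of 0 0] by (auto simp: mat_power_0)
    obtain \<mu> w where w: "w \<in> U" "w \<noteq> 0" "T i *v w = \<mu> *s w" using eigenvector_exists[OF U inv v] by blast
    define A where "A = T i - mat \<mu>"
    have Aw: "A *v w = 0" using w(3) by (simp add: A_def matrix_vector_mult_diff_rdistrib mat_vec_mult)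
    have invA: "\<And>u. u \<in> U \<Longrightarrow> A *v u \<in> U"
      unfolding A_def matrix_vector_mult_diff_rdistrib mat_vec_mult
      using U inv by (intro vec.subspace_diff vec.subspace_scale) auto
    obtain m where m: "m > 0" "\<And>u. u \<in> U \<Longrightarrow> \<exists>w\<in>U. mat_power A m *v (u - mat_power A m *v w) = 0"
      "\<And>u. u \<in> U \<Longrightarrow> mat_power A m *v (mat_power A m *v u) = 0 \<Longrightarrow> mat_power A m *v u = 0"
      using fitting[OF U invA] by metis
    have comm: "T j ** mat_power A m = mat_power A m ** T j" for j
      using mat_power_commutes[OF commuting_shift[OF T, of j i \<mu>, symmetric]] unfolding A_def by simp
    define I where "I = (*v) (mat_power A m) ` U"
    define K where "K = {u \<in> U. mat_power A m *v u = 0}"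
    have "vec.subspace I"
      unfolding I_def by (rule vec.linear_subspace_image[OF matrix_vector_mul_linear_gen U])
    moreover have "T j *v u \<in> I" if "u \<in> I" for j u
      using that inv unfolding I_def by (auto simp: matrix_vector_mul_assoc comm) (auto simp: matrix_vector_mul_assoc[symmetric])
    ultimately have I: "invariant_subspace T I" unfolding invariant_subspace_def by blast
    have "vec.subspace K"
      unfolding K_def using U by (auto simp: vec.subspace_def matrix_vector_right_distrib mat_vec_scale)
    moreover have "T j *v u \<in> K" if "u \<in> K" for j u
      using that inv unfolding K_def by (auto simp: matrix_vector_mul_assoc comm[symmetric]) (auto simp: matrix_vector_mul_assoc[symmetric])
    ultimately have K: "invariant_subspace T K" unfolding invariant_subspace_def by blast
    have IU: "I \<subseteq> U" unfolding I_def using invariant_mat_power[OF invA] by auto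
    have KU: "K \<subseteq> U" unfolding K_def by auto
    have KI: "K \<inter> I = {0}"
      using m(3) vec.subspace_0[OF U] unfolding K_def I_def by (auto intro!: image_eqI[of _ _ 0])
    have "K \<noteq> U" using i[of \<mu> m] unfolding K_def A_def by blast
    then have dimK: "vec.dim K < vec.dim U"
      using vec.subspace_dim_equal[OF _ U KU] K unfolding invariant_subspace_def by (meson not_le)
    have "w \<in> K"
    proof -
      obtain m' where "m = m' + Suc 0" using m(1) by (metis add_Suc_right add_0_right gr0_implies_Suc)
      then show ?thesis using w Aw unfolding K_def by (simp add: mat_power_add[of A m' "Suc 0", simplified] mat_power_1 matrix_vector_mul_assoc[symmetric])
    qed
    then have "I \<noteq> U" using KI w by blast
    then have dimI: "vec.dim I < vec.dim U"
      using vec.subspace_dim_equal[OF _ U IU] I unfolding invariant_subspace_def by (meson not_le)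
    have "U = {u + v | u v. u \<in> K \<and> v \<in> I}"
    proof (intro equalityI subsetI)
      fix u assume u: "u \<in> U"
      then obtain x where x: "x \<in> U" "mat_power A m *v (u - mat_power A m *v x) = 0" using m(2) by blast
      have "u - mat_power A m *v x \<in> K"
        using x u U invariant_mat_power[OF invA x(1)] unfolding K_def by (auto intro: vec.subspace_diff)
      moreover have "mat_power A m *v x \<in> I" using x(1) unfolding I_def by blast
      ultimately show "u \<in> {u + v | u v. u \<in> K \<and> v \<in> I}"
        by (intro CollectI exI[of _ "u - mat_power A m *v x"] exI[of _ "mat_power A m *v x"]) simp
    next
      fix u assume "u \<in> {u + v | u v. u \<in> K \<and> v \<in> I}"
      then show "u \<in> U" using KU IU U by (auto intro!: vec.subspace_add)
    qed
    then show ?thesis using sum[OF K I KI less.hyps[OF dimK K] less.hyps[OF dimI I]] by simp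
  qed
qed

text \<open>
  Let \<open>h i v\<close> be the least power of \<open>N i\<close> that annihilates \<open>v\<close>. Applying any \<open>N i\<close> to \<open>v \<noteq> 0\<close> lowers the
  sum of these heights: it lowers \<open>h i\<close> and, because the matrices commute, raises none of the others.
\<close>

lemma nilpotent_induct:
  fixes N :: "'d::finite \<Rightarrow> complex ^ 'n ^ 'n"
  assumes comm: "commuting_tuple N" and inv: "\<And>i u. u \<in> U \<Longrightarrow> N i *v u \<in> U"
    and nil: "\<And>i u. u \<in> U \<Longrightarrow> mat_power (N i) m *v u = 0"
    and zero: "Q 0" and step: "\<And>v. v \<in> U \<Longrightarrow> (\<And>i. Q (N i *v v)) \<Longrightarrow> Q v"
  shows "v \<in> U \<Longrightarrow> Q v"
proof -
  define h where "h i v = (LEAST k. mat_power (N i) k *v v = 0)" for i v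
  have h: "mat_power (N i) (h i v) *v v = 0" if "v \<in> U" for i v
    unfolding h_def using nil[OF that] by (rule LeastI)
  show "v \<in> U \<Longrightarrow> Q v"
  proof (induction "\<Sum>i\<in>UNIV. h i v" arbitrary: v rule: less_induct)
    case less
    show ?case
    proof (cases "v = 0")
      case True then show ?thesis using zero by simp
    next
      case False
      have "Q (N i *v v)" for i
      proof (rule less.hyps)
        show "N i *v v \<in> U" by (rule inv[OF less.prems])
        show "(\<Sum>j\<in>UNIV. h j (N i *v v)) < (\<Sum>j\<in>UNIV. h j v)"
        proof (rule sum_strict_mono_ex1)
          show "\<forall>j\<in>UNIV. h j (N i *v v) \<le> h j v"
          proof
            fix j
            have "mat_power (N j) (h j v) ** N i = N i ** mat_power (N j) (h j v)"
              using comm unfolding commuting_tuple_def by (intro mat_power_commutes) blast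
            then have "mat_power (N j) (h j v) *v (N i *v v) = N i *v (mat_power (N j) (h j v) *v v)"
              by (simp add: matrix_vector_mul_assoc)
            then show "h j (N i *v v) \<le> h j v"
              using h[OF less.prems] by (subst h_def, intro Least_le) simp
          qed
          have "h i v \<noteq> 0" using h[OF less.prems, of i] False by (metis mat_power_0 matrix_vector_mul_lid)
          then obtain k where k: "h i v = Suc k" using not0_implies_Suc by blast
          have "mat_power (N i) k *v (N i *v v) = 0"
            using h[OF less.prems, of i] mat_power_add[of "N i" k "Suc 0"]
            unfolding k by (simp add: mat_power_1 matrix_vector_mul_assoc)
          then have "h i (N i *v v) \<le> k" unfolding h_def by (rule Least_le)
          then show "\<exists>j\<in>UNIV. h j (N i *v v) < h j v" using k by (intro bexI[of _ i]) auto
        qed simp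
      qed
      then show ?thesis using step[OF less.prems] by blast
    qed
  qed
qed

section \<open>Joint eigenvalues of tuples with slowly growing powers\<close>

definition lin_form :: "('d::finite \<Rightarrow> complex ^ 'n ^ 'n) \<Rightarrow> complex ^ 'd \<Rightarrow> complex ^ 'n ^ 'n" where
  "lin_form T x = (\<Sum>i\<in>UNIV. mat (cnj (x $ i)) ** T i)"

lemma sum_mat_vec: "(\<Sum>i\<in>I. A i) *v (x :: complex ^ 'n) = (\<Sum>i\<in>I. A i *v x)"
  by (induction I rule: infinite_finite_induct) (simp_all add: matrix_vector_mult_add_rdistrib)

lemma lin_form_vec: "lin_form T x *v v = (\<Sum>i\<in>UNIV. cnj (x $ i) *s (T i *v v))"
  unfolding lin_form_def sum_mat_vec by (simp add: matrix_vector_mul_assoc[symmetric] mat_vec_mult)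

lemma lin_form_vec_add: "lin_form T (x + y) *v v = lin_form T x *v v + lin_form T y *v v"
  unfolding lin_form_vec by (simp add: sum.distrib vector_sadd_rdistrib)

lemma lin_form_vec_scale: "lin_form T (c *s x) *v v = cnj c *s (lin_form T x *v v)"
  unfolding lin_form_vec by (simp add: vec.scale_sum_right)

lemma poly_calculus_lin_form: "poly_calculus T (\<lambda>z. cinner z x) (lin_form T x)"
proof -
  have "poly_calculus T (\<lambda>z. \<Sum>i\<in>UNIV. cnj (x $ i) * z $ i) (lin_form T x)"
    unfolding lin_form_def
    by (intro poly_calculus_sum poly_calculus.mult poly_calculus.const poly_calculus.coord finite)
  moreover have "(\<lambda>z. \<Sum>i\<in>UNIV. cnj (x $ i) * z $ i) = (\<lambda>z. cinner z x)"
    unfolding cinner_def by (simp add: mult.commute)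
  ultimately show ?thesis by simp
qed

text \<open>
  The exponent matters: a Jordan block in a direction orthogonal to a joint eigenvalue on the sphere produces
  powers of size \<open>\<surd>n\<close>, so only a bound \<open>o(\<surd>n)\<close> excludes it.
\<close>

definition slow_growth :: "('d::finite \<Rightarrow> complex ^ 'n ^ 'n) \<Rightarrow> bool" where
  "slow_growth T \<longleftrightarrow> (\<exists>g. (\<lambda>n. (g n)\<^sup>2 / real n) \<longlonglongrightarrow> 0 \<and>
     (\<forall>u n. norm u = 1 \<longrightarrow> op_norm (mat_power (lin_form T u) n) \<le> g n))"

lemma norm_mat_vec_le: "norm (A *v v) \<le> op_norm A * norm (v :: complex ^ 'n)"
  unfolding op_norm_def by (rule onorm[OF matrix_vector_mul_bounded_linear])

lemma mat_power_lin_form_scale: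
  "mat_power (lin_form T (c *s x)) n *v v = cnj c ^ n *s (mat_power (lin_form T x) n *v v)"
proof (induction n)
  case 0 then show ?case by (simp add: mat_power_0)
next
  case (Suc n)
  then show ?case
    by (simp add: mat_power_Suc matrix_vector_mul_assoc[symmetric] lin_form_vec_scale mat_vec_scale mult.commute)
qed

lemma slow_growth_vec:
  assumes "slow_growth T"
  shows "\<exists>g. (\<lambda>n. (g n)\<^sup>2 / real n) \<longlonglongrightarrow> 0 \<and> (\<forall>n. g n \<ge> 0) \<and>
    (\<forall>x n v. x \<noteq> 0 \<longrightarrow> norm (mat_power (lin_form T x) n *v v) \<le> g n * norm x ^ n * norm v)"
proof -
  obtain g where g: "(\<lambda>n. (g n)\<^sup>2 / real n) \<longlonglongrightarrow> 0"
    "\<And>u n. norm u = 1 \<Longrightarrow> op_norm (mat_power (lin_form T u) n) \<le> g n"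
    using assms unfolding slow_growth_def by blast
  have le: "norm (mat_power (lin_form T x) n *v v) \<le> g n * norm x ^ n * norm v" if x: "x \<noteq> 0" for x n v
  proof -
    define u where "u = complex_of_real (1 / norm x) *s x"
    have u: "norm u = 1" using x by (simp add: u_def norm_scale_vec norm_divide)
    have "x = complex_of_real (norm x) *s u" using x by (simp add: u_def)
    then have "mat_power (lin_form T x) n *v v = complex_of_real (norm x) ^ n *s (mat_power (lin_form T u) n *v v)"
      by (metis mat_power_lin_form_scale complex_cnj_complex_of_real)
    then have "norm (mat_power (lin_form T x) n *v v) = norm x ^ n * norm (mat_power (lin_form T u) n *v v)"
      by (simp add: norm_scale_vec norm_power)
    also have "\<dots> \<le> norm x ^ n * (g n * norm v)"
    proof (rule mult_left_mono)
      have "norm (mat_power (lin_form T u) n *v v) \<le> op_norm (mat_power (lin_form T u) n) * norm v"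
        by (rule norm_mat_vec_le)
      also have "\<dots> \<le> g n * norm v" by (intro mult_right_mono g(2) u) simp
      finally show "norm (mat_power (lin_form T u) n *v v) \<le> g n * norm v" .
    qed simp
    finally show ?thesis by (simp add: mult_ac)
  qed
  have "g n \<ge> 0" for n
  proof -
    have "0 \<le> op_norm (mat_power (lin_form T (axis undefined 1)) n)"
      unfolding op_norm_def by (rule onorm_pos_le[OF matrix_vector_mul_bounded_linear])
    also have "\<dots> \<le> g n"
      by (rule g(2)) (simp add: norm_vec_def L2_set_def axis_def if_distrib[of "\<lambda>y. (norm y)\<^sup>2"] cong: if_cong)
    finally show ?thesis .
  qed
  then show ?thesis using g(1) le by blast
qed

context
  fixes T :: "'d::finite \<Rightarrow> complex ^ 'n ^ 'n" and U :: "(complex ^ 'n) set" and l :: "complex ^ 'd" and m :: nat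
  assumes T: "commuting_tuple T" and inv: "invariant_subspace T U"
    and nil: "\<And>i u. u \<in> U \<Longrightarrow> mat_power (T i - mat (l $ i)) m *v u = 0"
begin

abbreviation shifted :: "'d \<Rightarrow> complex ^ 'n ^ 'n" where "shifted \<equiv> \<lambda>i. T i - mat (l $ i)"

lemma shifted_vec: "shifted i *v v = T i *v v - l $ i *s v"
  by (simp add: matrix_vector_mult_diff_rdistrib mat_vec_mult)

lemma shifted_commuting: "commuting_tuple shifted"
  unfolding commuting_tuple_def
proof (intro allI)
  fix i j
  have "T i ** T j = T j ** T i" using T unfolding commuting_tuple_def by blast
  then show "shifted i ** shifted j = shifted j ** shifted i"
    unfolding matrix_diff_ldistrib matrix_diff_rdistrib mat_mult_mat mat_comm[of _ "T i"] mat_comm[of _ "T j"]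
    by (simp add: mult.commute)
qed

lemma shifted_invariant: "u \<in> U \<Longrightarrow> shifted i *v u \<in> U"
  unfolding shifted_vec using inv unfolding invariant_subspace_def
  by (intro vec.subspace_diff vec.subspace_scale) auto

lemmas primary_nilpotent_induct = nilpotent_induct[OF shifted_commuting shifted_invariant nil]

lemma lin_form_shifted: "lin_form T x *v v = cinner l x *s v + lin_form shifted x *v v"
proof -
  have "lin_form T x *v v = (\<Sum>i\<in>UNIV. cnj (x $ i) *s (l $ i *s v) + cnj (x $ i) *s (shifted i *v v))"
    unfolding lin_form_vec shifted_vec by (intro sum.cong refl) (simp add: vector_add_ldistrib[symmetric])
  then show ?thesis
    unfolding sum.distrib lin_form_vec cinner_def
    by (simp add: vec.scale_sum_left mult.commute)
qed

text \<open>
  A joint eigenvector for \<open>l\<close> is an eigenvector of \<open>lin_form T l\<close> with eigenvalue \<open>(norm l)\<^sup>2\<close>, so the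
  powers in the direction of \<open>l\<close> grow at least like \<open>norm l ^ n\<close>.
\<close>

lemma joint_eigenvalue_norm_le:
  assumes sg: "slow_growth T" and U: "U \<noteq> {0}"
  shows "norm l \<le> 1"
proof (rule ccontr)
  assume "\<not> norm l \<le> 1"
  then have l: "norm l > 1" by simp
  have "\<exists>v\<in>U. v \<noteq> 0 \<and> (\<forall>i. shifted i *v v = 0)"
  proof (rule ccontr)
    assume no: "\<not> ?thesis"
    have "v = 0" if "v \<in> U" for v
      by (rule primary_nilpotent_induct[of "\<lambda>v. v = 0"]) (use that no in auto)
    then show False using U vec.subspace_0 inv unfolding invariant_subspace_def by blast
  qed
  then obtain v where v: "v \<noteq> 0" "\<And>i. shifted i *v v = 0" by blast
  have "lin_form shifted l *v v = 0" unfolding lin_form_vec v(2) by simp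
  then have eig: "lin_form T l *v v = of_real ((norm l)\<^sup>2) *s v" unfolding lin_form_shifted cinner_self by simp
  have pow: "mat_power (lin_form T l) n *v v = of_real (((norm l)\<^sup>2) ^ n) *s v" for n
    by (induction n)
      (simp_all add: mat_power_0 mat_power_Suc matrix_vector_mul_assoc[symmetric] mat_vec_scale eig mult.commute)
  obtain g where g: "(\<lambda>n. (g n)\<^sup>2 / real n) \<longlonglongrightarrow> 0" "\<And>n. g n \<ge> 0"
    "\<And>x n v. x \<noteq> 0 \<Longrightarrow> norm (mat_power (lin_form T x) n *v v) \<le> g n * norm x ^ n * norm v"
    using slow_growth_vec[OF sg] by blast
  have le: "norm l ^ n \<le> g n" for n
  proof -
    have "l \<noteq> 0" using l by auto
    have "((norm l)\<^sup>2) ^ n * norm v \<le> g n * norm l ^ n * norm v"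
      using g(3)[OF \<open>l \<noteq> 0\<close>, of n v] unfolding pow norm_scale_vec norm_of_real by simp
    moreover have "norm v > 0" using v(1) by simp
    ultimately have "((norm l)\<^sup>2) ^ n \<le> g n * norm l ^ n" by (rule mult_right_le_imp_le)
    then have "norm l ^ n * norm l ^ n \<le> g n * norm l ^ n"
      by (simp add: power2_eq_square power_mult_distrib)
    moreover have "norm l ^ n > 0" using l by (intro zero_less_power) linarith
    ultimately show ?thesis by (rule mult_right_le_imp_le)
  qed
  define b where "b = 1 / (norm l)\<^sup>2"
  have "(norm l)\<^sup>2 > 1" using l by (simp add: one_less_power)
  then have b: "norm b < 1" "b > 0" unfolding b_def by (auto simp: divide_less_eq)
  have "(\<lambda>n. ((g n)\<^sup>2 / real n) * (real n * b ^ n)) \<longlonglongrightarrow> 0 * 0"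
    by (intro tendsto_mult g(1)) (use powser_times_n_limit_0[OF b(1)] in simp)
  moreover have "1 \<le> ((g n)\<^sup>2 / real n) * (real n * b ^ n)" if "n \<ge> 1" for n
  proof -
    have "(norm l ^ n)\<^sup>2 \<le> (g n)\<^sup>2" using le[of n] by (intro power_mono) auto
    then have "((norm l)\<^sup>2) ^ n * b ^ n \<le> (g n)\<^sup>2 * b ^ n"
      using b by (intro mult_right_mono) (auto simp: power_mult[symmetric] mult.commute)
    moreover have "((norm l)\<^sup>2) ^ n * b ^ n = 1"
      using l by (auto simp: b_def power_mult_distrib[symmetric])
    ultimately show ?thesis using that by simp
  qed
  ultimately have "1 \<le> (0 * 0 :: real)" by (intro LIMSEQ_le_const) auto
  then show False by simp
qed

text \<open>
  Suppose the nilpotent parts are not all zero and choose \<open>v\<close> that is killed by every product of two of them, but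
  not by each single one. For \<open>x\<close> with \<open>\<langle>l, x\<rangle> = 1\<close> the power \<open>lin_form T x ^ n\<close> sends \<open>v\<close> to
  \<open>v + n w(x)\<close>, where \<open>w(x)\<close> is conjugate-linear in \<open>x\<close>. If \<open>(norm x)\<^sup>2 \<le> 1 + 1/n\<close>, the factor
  \<open>norm x ^ n\<close> stays bounded, and slow growth gives \<open>w(x) = o(1/\<surd>n)\<close>. The choice \<open>x = l\<close> yields
  \<open>w(l) = 0\<close>, and \<open>x = l + s \<eta>\<close> with \<open>\<eta>\<close> orthogonal to \<open>l\<close> and \<open>s\<close> of order \<open>1/\<surd>n\<close> yields
  \<open>w(\<eta>) = 0\<close>.
\<close>

lemma sphere_eigenvalue_semisimple:
  assumes sg: "slow_growth T" and l: "norm l = 1"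
  shows "v \<in> U \<Longrightarrow> shifted i *v v = 0"
proof (rule ccontr)
  assume "v \<in> U" "shifted i *v v \<noteq> 0"
  have "\<exists>v\<in>U. (\<exists>i. shifted i *v v \<noteq> 0) \<and> (\<forall>i j. shifted j *v (shifted i *v v) = 0)"
  proof (rule ccontr)
    assume no: "\<not> ?thesis"
    have "\<forall>i. shifted i *v w = 0" if "w \<in> U" for w
      by (rule primary_nilpotent_induct[of "\<lambda>w. \<forall>i. shifted i *v w = 0"]) (use that no in auto)
    then show False using \<open>v \<in> U\<close> \<open>shifted i *v v \<noteq> 0\<close> by blast
  qed
  then obtain v i where v: "shifted i *v v \<noteq> 0" "\<And>i j. shifted j *v (shifted i *v v) = 0" by blast
  \<comment> \<open>The part of \<open>lin_form T x\<close> that moves \<open>v\<close> off its line.\<close>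
  define w where "w x = lin_form shifted x *v v" for x
  have shifted_w: "lin_form shifted x *v w y = 0" for x y
    unfolding w_def lin_form_vec mat_vec_sum mat_vec_scale v(2) by simp
  have pow: "mat_power (lin_form T x) n *v v = v + of_nat n *s w x" if "cinner l x = 1" for x n
  proof (induction n)
    case 0 then show ?case by (simp add: mat_power_0)
  next
    case (Suc n)
    have "mat_power (lin_form T x) (Suc n) *v v = lin_form T x *v (v + of_nat n *s w x)"
      using Suc by (simp add: mat_power_Suc matrix_vector_mul_assoc[symmetric])
    also have "\<dots> = v + of_nat (Suc n) *s w x"
      unfolding matrix_vector_right_distrib mat_vec_scale lin_form_shifted that shifted_w
      by (simp add: w_def[symmetric] vector_sadd_rdistrib add_ac)
    finally show ?case .
  qed
  obtain g where g: "(\<lambda>n. (g n)\<^sup>2 / real n) \<longlonglongrightarrow> 0" "\<And>n. g n \<ge> 0"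
    "\<And>x n v. x \<noteq> 0 \<Longrightarrow> norm (mat_power (lin_form T x) n *v v) \<le> g n * norm x ^ n * norm v"
    using slow_growth_vec[OF sg] by blast
  have "(\<lambda>n. sqrt ((g n)\<^sup>2 / real n)) \<longlonglongrightarrow> sqrt 0" by (intro tendsto_real_sqrt g(1))
  then have g0: "(\<lambda>n. g n / sqrt (real n)) \<longlonglongrightarrow> 0" using g(2) by (simp add: real_sqrt_divide)
  have inv0: "(\<lambda>n. 1 / sqrt (real n)) \<longlonglongrightarrow> 0"
    using tendsto_real_sqrt[OF lim_const_over_n[of 1]] by (simp add: real_sqrt_divide)
  have vanish: "(\<lambda>n. sqrt (real n) * norm (w (x n))) \<longlonglongrightarrow> 0"
    if x: "\<And>n. n \<ge> 1 \<Longrightarrow> cinner l (x n) = 1" "\<And>n. n \<ge> 1 \<Longrightarrow> (norm (x n))\<^sup>2 \<le> 1 + 1 / real n" for x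
  proof (rule tendsto_sandwich[OF _ _ tendsto_const])
    show "\<forall>\<^sub>F n in sequentially. 0 \<le> sqrt (real n) * norm (w (x n))" by simp
    have "(\<lambda>n. (2 * (g n / sqrt (real n)) + 1 / sqrt (real n)) * norm v) \<longlonglongrightarrow> (2 * 0 + 0) * norm v"
      by (intro tendsto_intros g0 inv0)
    then show "(\<lambda>n. (2 * (g n / sqrt (real n)) + 1 / sqrt (real n)) * norm v) \<longlonglongrightarrow> 0" by simp
    show "\<forall>\<^sub>F n in sequentially. sqrt (real n) * norm (w (x n)) \<le> (2 * (g n / sqrt (real n)) + 1 / sqrt (real n)) * norm v"
      unfolding eventually_sequentially
    proof (intro exI[of _ 1] allI impI)
      fix n :: nat assume n: "n \<ge> 1"
      have "((norm (x n)) ^ n)\<^sup>2 = ((norm (x n))\<^sup>2) ^ n" by (simp add: power_mult[symmetric] mult.commute)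
      also have "\<dots> \<le> (1 + 1 / real n) ^ n" using x(2)[OF n] by (intro power_mono) auto
      also have "\<dots> \<le> exp 1" using exp_ge_one_plus_x_over_n_power_n[where x = 1 and n = n] n by simp
      also have "\<dots> \<le> 2\<^sup>2" using exp_le by simp
      finally have x2: "norm (x n) ^ n \<le> 2" by (rule power2_le_imp_le) simp
      have "x n \<noteq> 0" using x(1)[OF n] by (auto simp: cinner_def)
      from g(3)[OF this, of n v] have "norm (v + of_nat n *s w (x n)) \<le> g n * norm (x n) ^ n * norm v"
        unfolding pow[OF x(1)[OF n]] .
      also have "\<dots> \<le> g n * 2 * norm v" using x2 g(2) by (intro mult_right_mono mult_left_mono) auto
      finally have "norm (of_nat n *s w (x n)) \<le> (2 * g n + 1) * norm v"
        using norm_triangle_ineq4[of "v + of_nat n *s w (x n)" v] by (simp add: algebra_simps)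
      then have "real n * norm (w (x n)) \<le> (2 * g n + 1) * norm v" by (simp add: norm_scale_vec)
      then have "(real n * norm (w (x n))) / sqrt (real n) \<le> ((2 * g n + 1) * norm v) / sqrt (real n)"
        by (rule divide_right_mono) simp
      moreover have "(real n * norm (w (x n))) / sqrt (real n) = sqrt (real n) * norm (w (x n))"
        using n by (simp add: real_div_sqrt flip: times_divide_eq_left)
      ultimately show "sqrt (real n) * norm (w (x n)) \<le> (2 * (g n / sqrt (real n)) + 1 / sqrt (real n)) * norm v"
        by (simp add: add_divide_distrib distrib_right)
    qed
  qed
  have wl: "w l = 0"
  proof -
    have lim: "(\<lambda>n. sqrt (real n) * norm (w l)) \<longlonglongrightarrow> 0"
      by (rule vanish) (use l in \<open>auto simp: cinner_self\<close>)
    have "norm (w l) \<le> 0"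
    proof (rule LIMSEQ_le_const[OF lim])
      show "\<exists>k. \<forall>n\<ge>k. norm (w l) \<le> sqrt (real n) * norm (w l)"
      proof (intro exI[of _ 1] allI impI)
        fix n :: nat assume "1 \<le> n"
        then have "1 \<le> sqrt (real n)" by simp
        then show "norm (w l) \<le> sqrt (real n) * norm (w l)" using mult_right_mono[of 1 "sqrt (real n)" "norm (w l)"] by simp
      qed
    qed
    then show ?thesis by simp
  qed
  \<comment> \<open>The component of the coordinate direction \<open>i\<close> orthogonal to \<open>l\<close>; its image under \<open>w\<close> is still \<open>shifted i *v v\<close>.\<close>
  define \<eta> where "\<eta> = axis i 1 - cnj (l $ i) *s l"
  have wadd: "w (x + y) = w x + w y" and wscale: "w (c *s x) = cnj c *s w x" for x y c
    unfolding w_def by (rule lin_form_vec_add, rule lin_form_vec_scale)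
  have waxis: "w (axis i 1) = shifted i *v v"
    unfolding w_def lin_form_vec by (simp add: axis_def if_distrib[of cnj] if_distribR if_distrib[of "\<lambda>c. c *s _"] cong: if_cong)
  have "w (axis i 1) = w \<eta> + cnj (cnj (l $ i)) *s w l"
    unfolding wadd[symmetric] wscale[symmetric] \<eta>_def by simp
  then have w\<eta>: "w \<eta> = shifted i *v v" using waxis wl by simp
  have ladd: "cinner x (y + z) = cinner x y + cinner x z" "cinner (y + z) x = cinner y x + cinner z x"
    "cinner x (c *s y) = cnj c * cinner x y" "cinner (c *s y) x = c * cinner y x" for x y z :: "complex ^ 'd" and c
    unfolding cinner_def by (simp_all add: algebra_simps sum.distrib sum_distrib_left)
  have "cinner l (axis i 1) = l $ i"
    unfolding cinner_def by (simp add: axis_def if_distrib[of cnj] if_distrib[of "\<lambda>y. _ * y"] cong: if_cong)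
  moreover have "cinner l (axis i 1) = cinner l \<eta> + l $ i * cinner l l"
    unfolding ladd(3)[symmetric, of "cnj (l $ i)", simplified] ladd(1)[symmetric] \<eta>_def by simp
  ultimately have l\<eta>: "cinner l \<eta> = 0" using l by (simp add: cinner_self)
  have \<eta>l: "cinner \<eta> l = 0" using cinner_cnj[of l \<eta>] l\<eta> by simp
  \<comment> \<open>The angle \<open>1/\<surd>n\<close>, scaled such that \<open>s n\<close> times \<open>\<eta>\<close> has norm at most \<open>1/\<surd>n\<close>.\<close>
  define s where "s n = 1 / (sqrt (real n) * (1 + norm \<eta>))" for n
  have pos: "1 + norm \<eta> > 0" by (simp add: add_pos_nonneg)
  have "(\<lambda>n. sqrt (real n) * norm (w (l + complex_of_real (s n) *s \<eta>))) \<longlonglongrightarrow> 0"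
  proof (rule vanish)
    fix n :: nat assume n: "n \<ge> 1"
    show "cinner l (l + complex_of_real (s n) *s \<eta>) = 1"
      unfolding ladd l\<eta> cinner_self using l by simp
    have "complex_of_real ((norm (l + complex_of_real (s n) *s \<eta>))\<^sup>2) = of_real (1 + (s n)\<^sup>2 * (norm \<eta>)\<^sup>2)"
      unfolding cinner_self[symmetric] ladd l\<eta> \<eta>l
      unfolding cinner_self using l by (simp add: power2_eq_square)
    then have "(norm (l + complex_of_real (s n) *s \<eta>))\<^sup>2 = 1 + (s n)\<^sup>2 * (norm \<eta>)\<^sup>2"
      using of_real_eq_iff by blast
    also have "(s n)\<^sup>2 * (norm \<eta>)\<^sup>2 = (1 / real n) * (norm \<eta> / (1 + norm \<eta>))\<^sup>2"
      by (simp add: s_def power_divide power_mult_distrib)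
    also have "\<dots> \<le> (1 / real n) * 1"
      using pos by (intro mult_left_mono) (auto simp: power_le_one_iff abs_square_le_1)
    finally show "(norm (l + complex_of_real (s n) *s \<eta>))\<^sup>2 \<le> 1 + 1 / real n" by simp
  qed
  then have lim: "(\<lambda>n. sqrt (real n) * norm (w (l + complex_of_real (s n) *s \<eta>))) \<longlonglongrightarrow> 0" .
  have const: "sqrt (real n) * norm (w (l + complex_of_real (s n) *s \<eta>)) = norm (shifted i *v v) / (1 + norm \<eta>)" if "n \<ge> 1" for n
    unfolding wadd wscale wl w\<eta> add_0 complex_cnj_complex_of_real norm_scale_vec norm_of_real
    using that pos by (simp add: s_def abs_mult)
  have "(\<lambda>n. norm (shifted i *v v) / (1 + norm \<eta>)) \<longlonglongrightarrow> 0"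
    by (rule Lim_transform_eventually[OF lim]) (use const in \<open>auto simp only: eventually_sequentially\<close>)
  then have "norm (shifted i *v v) / (1 + norm \<eta>) = 0" using LIMSEQ_unique tendsto_const by blast
  then show False using v(1) pos by simp
qed

end

section \<open>Boundedness of the polynomial calculus in the supremum norm\<close>

lemma poly_calculus_commute:
  assumes "\<And>i. T i ** X = X ** T i"
  shows "poly_calculus T f A \<Longrightarrow> A ** X = X ** A"
proof (induction rule: poly_calculus.induct)
  case (const c) then show ?case by (rule mat_comm)
next
  case (coord j) then show ?case by (rule assms)
next
  case (add f A g B) then show ?case by (simp add: matrix_add_ldistrib matrix_add_rdistrib)
next
  case (mult f A g B)
  have "(A ** B) ** X = A ** (X ** B)" using mult.IH by (simp add: matrix_mul_assoc[symmetric])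
  also have "\<dots> = X ** (A ** B)" using mult.IH by (simp add: matrix_mul_assoc)
  finally show ?case .
qed

text \<open>
  Replacing some of the matrices by scalars has the same effect as fixing the corresponding variables.
\<close>

lemma poly_calculus_substitute:
  assumes "\<And>i. i \<in> I \<Longrightarrow> S i = mat (l i)" and "\<And>i. i \<notin> I \<Longrightarrow> S i = T i"
  shows "poly_calculus S f A \<Longrightarrow> poly_calculus T (\<lambda>z. f (\<chi> j. if j \<in> I then l j else z $ j)) A"
proof (induction rule: poly_calculus.induct)
  case (const c) then show ?case by (rule poly_calculus.const)
next
  case (coord i)
  then show ?case
    using assms[of i] poly_calculus.const[of T "l i"] poly_calculus.coord[of T i] by (cases "i \<in> I") auto
next
  case (add f A g B) then show ?case by (simp add: poly_calculus.add)
next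
  case (mult f A g B) then show ?case by (simp add: poly_calculus.mult)
qed

text \<open>
  Division with remainder by \<open>z\<^sub>i - c\<close>, carried out for the function and for the matrix at the same time. The
  remainder, \<open>f\<close> with \<open>z\<^sub>i\<close> fixed to \<open>c\<close>, belongs to the tuple in which \<open>T i\<close> is replaced by the scalar
  \<open>c\<close>.
\<close>

lemma poly_calculus_divide_by_coord:
  fixes T :: "'d::finite \<Rightarrow> complex ^ 'n ^ 'n"
  assumes T: "\<And>j. T i ** T j = T j ** T i"
  shows "poly_calculus T f A \<Longrightarrow>
   \<exists>A' q Q. poly_calculus (T(i := mat c)) f A' \<and> poly_calculus T q Q \<and>
     (\<forall>z. f z - f (update_coord z i c) = (z $ i - c) * q z) \<and> A - A' = (T i - mat c) ** Q"
proof (induction rule: poly_calculus.induct)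
  case (const a)
  have "a - a = (z $ i - c) * 0" "mat a - mat a = (T i - mat c) ** mat 0" for z :: "complex ^ 'd"
    by simp_all
  then show ?case using poly_calculus.const by blast
next
  case (coord j)
  have c: "poly_calculus (T(i := mat c)) (\<lambda>z. z $ j) ((T(i := mat c)) j)" by (rule poly_calculus.coord)
  show ?case
  proof (cases "j = i")
    case True
    then have "z $ j - update_coord z i c $ j = (z $ i - c) * 1"
      "T j - (T(i := mat c)) j = (T i - mat c) ** mat 1" for z :: "complex ^ 'd"
      by (simp_all add: update_coord_def)
    then show ?thesis using c poly_calculus.const by blast
  next
    case False
    then have "z $ j - update_coord z i c $ j = (z $ i - c) * 0"
      "T j - (T(i := mat c)) j = (T i - mat c) ** mat 0" for z :: "complex ^ 'd"
      by (simp_all add: update_coord_def)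
    then show ?thesis using c poly_calculus.const by blast
  qed
next
  case (add f A g B)
  obtain A' q Q where f: "poly_calculus (T(i := mat c)) f A'" "poly_calculus T q Q"
     "\<And>z. f z - f (update_coord z i c) = (z $ i - c) * q z" "A - A' = (T i - mat c) ** Q" using add by blast
  obtain B' r R where g: "poly_calculus (T(i := mat c)) g B'" "poly_calculus T r R"
     "\<And>z. g z - g (update_coord z i c) = (z $ i - c) * r z" "B - B' = (T i - mat c) ** R" using add by blast
  have "(f z + g z) - (f (update_coord z i c) + g (update_coord z i c)) = (z $ i - c) * (q z + r z)" for z
    using f(3)[of z] g(3)[of z] by (simp add: algebra_simps)
  moreover have "(A + B) - (A' + B') = (T i - mat c) ** (Q + R)"
    using f(4) g(4) by (simp add: matrix_add_ldistrib algebra_simps)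
  ultimately show ?case
    using poly_calculus.add[OF f(1) g(1)] poly_calculus.add[OF f(2) g(2)] by blast
next
  case (mult f A g B)
  obtain A' q Q where f: "poly_calculus (T(i := mat c)) f A'" "poly_calculus T q Q"
     "\<And>z. f z - f (update_coord z i c) = (z $ i - c) * q z" "A - A' = (T i - mat c) ** Q" using mult by blast
  obtain B' r R where g: "poly_calculus (T(i := mat c)) g B'" "poly_calculus T r R"
     "\<And>z. g z - g (update_coord z i c) = (z $ i - c) * r z" "B - B' = (T i - mat c) ** R" using mult by blast
  have f': "poly_calculus T (\<lambda>z. f (update_coord z i c)) A'"
    using poly_calculus_substitute[where I = "{i}" and l = "\<lambda>_. c", OF _ _ f(1)]
    unfolding update_coord_def by simp
  have "f z * g z - f (update_coord z i c) * g (update_coord z i c)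
      = (z $ i - c) * (q z * g z + f (update_coord z i c) * r z)" for z
  proof -
    have "f z * g z - f (update_coord z i c) * g (update_coord z i c)
       = (f z - f (update_coord z i c)) * g z + f (update_coord z i c) * (g z - g (update_coord z i c))"
      by (simp only: algebra_simps)
    then show ?thesis unfolding f(3) g(3) by (simp add: algebra_simps)
  qed
  moreover have "A ** B - A' ** B' = (T i - mat c) ** (Q ** B + A' ** R)"
  proof -
    have "A' ** (T i - mat c) = (T i - mat c) ** A'"
    proof (rule poly_calculus_commute[OF _ f'])
      show "T j ** (T i - mat c) = (T i - mat c) ** T j" for j
        using T[of j] mat_comm[of c "T j"] by (simp add: matrix_diff_ldistrib matrix_diff_rdistrib)
    qed
    then have "A' ** (B - B') = (T i - mat c) ** (A' ** R)"
      unfolding g(4) by (simp add: matrix_mul_assoc)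
    moreover have "(A - A') ** B = (T i - mat c) ** (Q ** B)"
      unfolding f(4) by (simp add: matrix_mul_assoc)
    moreover have "A ** B - A' ** B' = (A - A') ** B + A' ** (B - B')"
      by (simp add: matrix_diff_ldistrib matrix_diff_rdistrib)
    ultimately show ?thesis by (simp add: matrix_add_ldistrib)
  qed
  ultimately show ?case
    using poly_calculus.mult[OF f(1) g(1)]
      poly_calculus.add[OF poly_calculus.mult[OF f(2) mult.hyps(2)] poly_calculus.mult[OF f' g(2)]]
    by blast
qed

text \<open>
  The vector functional \<open>f \<mapsto> f(T) v\<close> is bounded by the supremum over \<open>D\<close>. As \<open>f(T)\<close> is given by a relation,
  the bound \<open>B\<close> is quantified in place of the supremum of \<open>f\<close>.
\<close>

definition bounded_calculus_at :: "('d::finite \<Rightarrow> complex ^ 'n ^ 'n) \<Rightarrow> (complex ^ 'd) set \<Rightarrow> complex ^ 'n \<Rightarrow> bool" where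
  "bounded_calculus_at T D v \<longleftrightarrow>
     (\<exists>C\<ge>0. \<forall>f A B. poly_calculus T f A \<longrightarrow> (\<forall>z\<in>D. cmod (f z) \<le> B) \<longrightarrow> norm (A *v v) \<le> C * B)"

lemma bounded_calculus_at_mono:
  "D \<subseteq> D' \<Longrightarrow> bounded_calculus_at T D v \<Longrightarrow> bounded_calculus_at T D' v"
  unfolding bounded_calculus_at_def by (meson subsetD)

lemma bounded_calculus_at_add:
  assumes "bounded_calculus_at T D u" "bounded_calculus_at T D v"
  shows "bounded_calculus_at T D (u + v)"
proof -
  obtain C where C: "C \<ge> 0" "\<forall>f A B. poly_calculus T f A \<longrightarrow> (\<forall>z\<in>D. cmod (f z) \<le> B) \<longrightarrow> norm (A *v u) \<le> C * B"
    using assms(1) unfolding bounded_calculus_at_def by (elim exE conjE)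
  obtain C' where C': "C' \<ge> 0" "\<forall>f A B. poly_calculus T f A \<longrightarrow> (\<forall>z\<in>D. cmod (f z) \<le> B) \<longrightarrow> norm (A *v v) \<le> C' * B"
    using assms(2) unfolding bounded_calculus_at_def by (elim exE conjE)
  have "norm (A *v (u + v)) \<le> (C + C') * B" if "poly_calculus T f A" "\<forall>z\<in>D. cmod (f z) \<le> B" for f A B
  proof -
    have "norm (A *v u) \<le> C * B" "norm (A *v v) \<le> C' * B" using C(2) C'(2) that by blast+
    then show ?thesis
      using norm_triangle_ineq[of "A *v u" "A *v v"] by (simp add: matrix_vector_right_distrib distrib_right)
  qed
  then show ?thesis unfolding bounded_calculus_at_def using C(1) C'(1) by (intro exI[of _ "C + C'"]) simp
qed

definition polydisc :: "complex ^ 'd \<Rightarrow> real \<Rightarrow> (complex ^ 'd) set" where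
  "polydisc l r = {z. \<forall>i. cmod (z $ i - l $ i) \<le> r}"

lemma polydisc_subset_ball:
  fixes l :: "complex ^ 'd"
  assumes "norm l < 1"
  shows "\<exists>r>0. polydisc l r \<subseteq> unit_ball"
proof -
  define r where "r = (1 - norm l) / (2 * real CARD('d))"
  have r: "r > 0" using assms unfolding r_def by simp
  have "norm z < 1" if z: "z \<in> polydisc l r" for z
  proof -
    have "norm (z - l) \<le> (\<Sum>i\<in>UNIV. norm ((z - l) $ i))" unfolding norm_vec_def by (rule L2_set_le_sum) simp
    also have "\<dots> \<le> (\<Sum>i\<in>(UNIV :: 'd set). r)" using z unfolding polydisc_def by (intro sum_mono) simp
    also have "\<dots> < 1 - norm l" using assms by (simp add: r_def)
    finally show ?thesis using norm_triangle_ineq[of l "z - l"] by simp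
  qed
  then show ?thesis using r by (auto simp: unit_ball_def)
qed

text \<open>
  The maximum principle in the variable \<open>z\<^sub>i\<close>: on the circle of radius \<open>r\<close> around \<open>l\<^sub>i\<close> the divisor has
  modulus \<open>r\<close>.
\<close>

lemma divided_difference_bound:
  assumes f: "polynomial_fun q" and id: "\<And>z. f z - f (update_coord z i (l $ i)) = (z $ i - l $ i) * q z"
    and B: "\<And>z. z \<in> polydisc l r \<Longrightarrow> cmod (f z) \<le> B" and r: "r > 0" and z: "z \<in> polydisc l r"
  shows "cmod (q z) \<le> 2 * B / r"
proof -
  let ?h = "\<lambda>t. q (update_coord z i t)"
  define v where "v = update_coord z i 0"
  have upd: "update_coord z i t = v + t *s axis i 1" for t
    by (auto simp: v_def update_coord_def axis_def vec_eq_iff)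
  have hol: "?h holomorphic_on UNIV"
    unfolding upd by (rule slice_holomorphic(1)) (use polynomial_fun_complex_differentiable[OF f] in auto)
  have mem: "update_coord z i t \<in> polydisc l r" if "cmod (t - l $ i) \<le> r" for t
    using z that unfolding polydisc_def update_coord_def by auto
  have "cmod (?h (z $ i)) \<le> 2 * B / r"
  proof (rule maximum_modulus_frontier[where S = "cball (l $ i) r" and f = ?h])
    show "?h holomorphic_on interior (cball (l $ i) r)" using hol holomorphic_on_subset by blast
    show "continuous_on (closure (cball (l $ i) r)) ?h"
      using hol holomorphic_on_subset holomorphic_on_imp_continuous_on by blast
    show "bounded (cball (l $ i) r)" by simp
    show "z $ i \<in> cball (l $ i) r" using z by (simp add: polydisc_def dist_norm norm_minus_commute)
    fix t assume "t \<in> frontier (cball (l $ i) r)"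
    then have t: "cmod (t - l $ i) = r" using r by (simp add: dist_norm norm_minus_commute)
    have twice: "update_coord (update_coord z i t) i (l $ i) = update_coord z i (l $ i)"
      "update_coord z i t $ i = t" by (simp_all add: update_coord_def vec_eq_iff)
    have "r * cmod (?h t) = cmod (f (update_coord z i t) - f (update_coord z i (l $ i)))"
      using id[of "update_coord z i t"] t unfolding twice by (simp add: norm_mult)
    also have "\<dots> \<le> B + B"
      by (rule order_trans[OF norm_triangle_ineq4]) (intro add_mono B mem; use t r in simp)
    finally show "cmod (?h t) \<le> 2 * B / r" using r by (simp add: field_simps)
  qed
  moreover have "update_coord z i (z $ i) = z" by (simp add: update_coord_def vec_eq_iff)
  ultimately show ?thesis by simp
qed

lemma poly_calculus_scalar: "poly_calculus (\<lambda>i. mat (l $ i)) f A \<Longrightarrow> A = mat (f l)"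
  by (induction rule: poly_calculus.induct) (simp_all add: mat_add_mat mat_mult_mat)

text \<open>
  Replace \<open>T i\<close> by the scalar \<open>l i\<close> for one index after the other. By division with remainder, each replacement
  changes \<open>f(T) v\<close> by \<open>q(T) (T i - l i) v\<close>, where \<open>q\<close> is bounded by \<open>2/r\<close> times the bound on \<open>f\<close>, and after
  all replacements \<open>f(l) v\<close> remains.
\<close>

lemma bounded_calculus_at_step:
  fixes T :: "'d::finite \<Rightarrow> complex ^ 'n ^ 'n"
  assumes T: "commuting_tuple T" and r: "r > 0"
    and bd: "\<And>i. bounded_calculus_at T (polydisc l r) ((T i - mat (l $ i)) *v v)"
  shows "bounded_calculus_at T (polydisc l r) v"
proof -
  let ?D = "polydisc l r"
  have "\<forall>i. \<exists>C\<ge>0. \<forall>f A B. poly_calculus T f A \<longrightarrow> (\<forall>z\<in>?D. cmod (f z) \<le> B) \<longrightarrow>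
      norm (A *v ((T i - mat (l $ i)) *v v)) \<le> C * B" using bd unfolding bounded_calculus_at_def by blast
  then obtain C where C0: "\<And>i. C i \<ge> 0" and C: "\<And>i f A B. poly_calculus T f A \<Longrightarrow> (\<And>z. z \<in> ?D \<Longrightarrow> cmod (f z) \<le> B) \<Longrightarrow>
      norm (A *v ((T i - mat (l $ i)) *v v)) \<le> C i * B" by metis
  define S where "S I = (\<lambda>i. if i \<in> I then mat (l $ i) else T i)" for I
  define sub where "sub I z = (\<chi> j. if j \<in> I then l $ j else z $ j)" for I and z :: "complex ^ 'd"
  have subD: "sub I z \<in> ?D" if "z \<in> ?D" for I z
    using that r unfolding sub_def polydisc_def by auto
  have S_sub: "poly_calculus T (\<lambda>z. q (sub I z)) Q" if "poly_calculus (S I) q Q" for I q Q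
    unfolding sub_def by (rule poly_calculus_substitute[OF _ _ that]) (auto simp: S_def)
  have ST: "S I i ** T j = T j ** S I i" for I i j
    using T mat_comm[of "l $ i" "T j"] unfolding S_def commuting_tuple_def by auto
  have SS: "S I i ** S I j = S I j ** S I i" for I i j
    using ST[of I i j] mat_comm[of "l $ j" "S I i"] unfolding S_def[of I] by auto
  define K where "K = (2 / r) * (\<Sum>i\<in>UNIV. C i)"
  have main: "\<exists>A'. poly_calculus (S I) f A' \<and> norm ((A - A') *v v) \<le> (\<Sum>i\<in>I. C i * (2 * B / r))"
    if "finite I" and f: "poly_calculus T f A" and B: "\<And>z. z \<in> ?D \<Longrightarrow> cmod (f z) \<le> B" for I f A B
    using that(1)
  proof (induction rule: finite_induct)
    case empty
    have "S {} = T" unfolding S_def by simp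
    then show ?case using f by (intro exI[of _ A]) simp
  next
    case (insert i I)
    then obtain A' where A': "poly_calculus (S I) f A'" "norm ((A - A') *v v) \<le> (\<Sum>i\<in>I. C i * (2 * B / r))" by blast
    obtain A'' q Q where A'': "poly_calculus ((S I)(i := mat (l $ i))) f A''" and q: "poly_calculus (S I) q Q"
      and id: "\<And>z. f z - f (update_coord z i (l $ i)) = (z $ i - l $ i) * q z"
      and diff: "A' - A'' = (S I i - mat (l $ i)) ** Q"
      using poly_calculus_divide_by_coord[OF SS A'(1), of i "l $ i"] by blast
    have ins: "(S I)(i := mat (l $ i)) = S (insert i I)" unfolding S_def by auto
    have Si: "S I i = T i" using insert.hyps unfolding S_def by simp
    have "Q ** (T i - mat (l $ i)) = (T i - mat (l $ i)) ** Q"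
    proof (rule poly_calculus_commute[OF _ q])
      show "S I j ** (T i - mat (l $ i)) = (T i - mat (l $ i)) ** S I j" for j
        using ST[of I j i] mat_comm[of "l $ i" "S I j"] by (simp add: matrix_diff_ldistrib matrix_diff_rdistrib)
    qed
    then have eq: "(A' - A'') *v v = Q *v ((T i - mat (l $ i)) *v v)"
      unfolding diff Si by (simp add: matrix_vector_mul_assoc)
    have "cmod (q (sub I z)) \<le> 2 * B / r" if "z \<in> ?D" for z
      by (rule divided_difference_bound[OF polynomial_fun_if_calculus[OF q] id B r subD[OF that]])
    then have "norm ((A' - A'') *v v) \<le> C i * (2 * B / r)"
      unfolding eq using C[OF S_sub[OF q]] by blast
    moreover have "(A - A'') *v v = (A - A') *v v + (A' - A'') *v v"
      by (simp add: matrix_vector_mult_diff_rdistrib)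
    ultimately have "norm ((A - A'') *v v) \<le> (\<Sum>i\<in>insert i I. C i * (2 * B / r))"
      using A'(2) norm_triangle_ineq[of "(A - A') *v v" "(A' - A'') *v v"] insert.hyps by simp
    then show ?case using A'' unfolding ins by blast
  qed
  have lD: "l \<in> ?D" using r unfolding polydisc_def by simp
  have "norm (A *v v) \<le> (K + norm v) * B"
    if f: "poly_calculus T f A" and B: "\<forall>z\<in>?D. cmod (f z) \<le> B" for f A B
  proof -
    obtain A' where A': "poly_calculus (S UNIV) f A'" "norm ((A - A') *v v) \<le> (\<Sum>i\<in>UNIV. C i * (2 * B / r))"
      using main[OF finite f] B by blast
    have "A' = mat (f l)" using A'(1) by (intro poly_calculus_scalar) (simp add: S_def)
    then have "norm (A' *v v) \<le> B * norm v"
      using B lD by (simp add: mat_vec_mult norm_scale_vec mult_right_mono)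
    moreover have "(\<Sum>i\<in>UNIV. C i * (2 * B / r)) = K * B" unfolding K_def sum_distrib_right[symmetric] by (simp add: mult_ac)
    moreover have "A *v v = (A - A') *v v + A' *v v" by (simp add: matrix_vector_mult_diff_rdistrib)
    ultimately show ?thesis
      using A'(2) norm_triangle_ineq[of "(A - A') *v v" "A' *v v"] by (simp add: algebra_simps)
  qed
  moreover have "K + norm v \<ge> 0" unfolding K_def using C0 r by (intro add_nonneg_nonneg mult_nonneg_nonneg sum_nonneg) auto
  ultimately show ?thesis unfolding bounded_calculus_at_def by blast
qed

lemma bounded_calculus_zero: "bounded_calculus_at T D 0"
  unfolding bounded_calculus_at_def by (intro exI[of _ 0]) simp

text \<open>
  If \<open>norm l < 1\<close>, a small polydisc around \<open>l\<close> lies in the ball and the bound spreads from joint eigenvectors to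
  all of \<open>U\<close> by induction along the nilpotent parts. If \<open>norm l = 1\<close>, then \<open>f(T)\<close> acts as the scalar \<open>f(l)\<close>,
  and \<open>l\<close> lies in the closure of the ball.
\<close>

lemma bounded_calculus_primary:
  fixes T :: "'d::finite \<Rightarrow> complex ^ 'n ^ 'n"
  assumes T: "commuting_tuple T" and sg: "slow_growth T" and inv: "invariant_subspace T U"
    and nil: "\<And>i u. u \<in> U \<Longrightarrow> mat_power (T i - mat (l $ i)) m *v u = 0" and v: "v \<in> U"
  shows "bounded_calculus_at T unit_ball v"
proof (cases "v = 0")
  case True then show ?thesis using bounded_calculus_zero by simp
next
  case False
  then have "U \<noteq> {0}" using v by auto
  have "norm l \<le> 1" by (rule joint_eigenvalue_norm_le[OF T inv nil sg \<open>U \<noteq> {0}\<close>])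
  then consider "norm l < 1" | "norm l = 1" by linarith
  then show ?thesis
  proof cases
    case 1
    then obtain r where r: "r > 0" "polydisc l r \<subseteq> unit_ball" using polydisc_subset_ball by blast
    have "bounded_calculus_at T (polydisc l r) v"
      by (rule primary_nilpotent_induct[OF T inv nil, where Q = "bounded_calculus_at T (polydisc l r)"])
        (use v bounded_calculus_zero bounded_calculus_at_step[OF T r(1)] in blast)+
    then show ?thesis by (rule bounded_calculus_at_mono[OF r(2)])
  next
    case 2
    have eig: "T i *v u = l $ i *s u" if "u \<in> U" for i u
      using sphere_eigenvalue_semisimple[OF T inv nil sg 2 that, of i]
      by (simp add: matrix_vector_mult_diff_rdistrib mat_vec_mult)
    have act: "A *v v = f l *s v" if "poly_calculus T f A" for f A
      using that
    proof (induction rule: poly_calculus.induct)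
      case (const c) then show ?case by (rule mat_vec_mult)
    next
      case (coord i) then show ?case by (rule eig[OF v])
    next
      case (add f A g B) then show ?case by (simp add: matrix_vector_mult_add_rdistrib vector_sadd_rdistrib)
    next
      case (mult f A g B)
      then show ?case by (simp add: matrix_vector_mul_assoc[symmetric] mat_vec_scale mult.commute)
    qed
    have "norm (A *v v) \<le> norm v * B" if f: "poly_calculus T f A" and B: "\<forall>z\<in>unit_ball. cmod (f z) \<le> B" for f A B
    proof -
      have "cmod (f l) \<le> B"
        by (rule continuous_on_closure_norm_le[OF polynomial_fun_continuous[OF polynomial_fun_if_calculus[OF f]] B])
          (use 2 in \<open>simp add: closure_unit_ball\<close>)
      then show ?thesis unfolding act[OF f] norm_scale_vec using mult_left_mono[of "cmod (f l)" B "norm v"] by (simp add: mult.commute)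
    qed
    then show ?thesis unfolding bounded_calculus_at_def by (intro exI[of _ "norm v"]) auto
  qed
qed

text \<open>
  The vectors with bounded functional form a subspace, so it is enough to look at a primary decomposition.
\<close>

theorem bounded_calculus:
  fixes T :: "'d::finite \<Rightarrow> complex ^ 'n ^ 'n"
  assumes T: "commuting_tuple T" and sg: "slow_growth T"
  shows "\<exists>C\<ge>0. \<forall>f A B. poly_calculus T f A \<longrightarrow> (\<forall>z\<in>unit_ball. cmod (f z) \<le> B) \<longrightarrow> op_norm A \<le> C * B"
proof -
  have "\<forall>v\<in>U. bounded_calculus_at T unit_ball v" if "invariant_subspace T U" for U
    using that
  proof (rule primary_induct[OF T, rotated 2])
    show "\<forall>v\<in>U. bounded_calculus_at T unit_ball v"
      if "invariant_subspace T U" "\<And>i u. u \<in> U \<Longrightarrow> mat_power (T i - mat (l $ i)) m *v u = 0" for U l m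
      using bounded_calculus_primary[OF T sg that] by blast
  qed (auto intro: bounded_calculus_at_add)
  from this[of UNIV] have "bounded_calculus_at T unit_ball v" for v
    unfolding invariant_subspace_def by simp
  then have "\<forall>k. \<exists>C\<ge>0. \<forall>f A B. poly_calculus T f A \<longrightarrow> (\<forall>z\<in>unit_ball. cmod (f z) \<le> B) \<longrightarrow>
      norm (A *v axis k 1) \<le> C * B" unfolding bounded_calculus_at_def by blast
  then obtain C where C0: "\<And>k. C k \<ge> 0" and C: "\<And>k f A B. poly_calculus T f A \<Longrightarrow> (\<And>z. z \<in> unit_ball \<Longrightarrow> cmod (f z) \<le> B) \<Longrightarrow>
      norm (A *v axis k 1) \<le> C k * B" by metis
  have "op_norm A \<le> (\<Sum>k\<in>UNIV. C k) * B"
    if f: "poly_calculus T f A" and B: "\<forall>z\<in>unit_ball. cmod (f z) \<le> B" for f A B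
    unfolding op_norm_def
  proof (rule onorm_le)
    fix x :: "complex ^ 'n"
    have "x = (\<Sum>k\<in>UNIV. x $ k *s axis k 1)" by (simp add: vec_eq_iff axis_def if_distrib[of "\<lambda>y. _ * y"] cong: if_cong)
    then have "A *v x = (\<Sum>k\<in>UNIV. x $ k *s (A *v axis k 1))" by (metis (no_types, lifting) mat_vec_sum mat_vec_scale sum.cong)
    then have "norm (A *v x) \<le> (\<Sum>k\<in>UNIV. cmod (x $ k) * norm (A *v axis k 1))"
      using norm_sum[of "\<lambda>k. x $ k *s (A *v axis k 1)" UNIV] by (simp add: norm_scale_vec)
    also have "\<dots> \<le> (\<Sum>k\<in>UNIV. norm x * (C k * B))"
    proof (intro sum_mono mult_mono)
      show "cmod (x $ k) \<le> norm x" for k by (rule Finite_Cartesian_Product.norm_nth_le)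
      show "norm (A *v axis k 1) \<le> C k * B" for k using C[OF f] B by blast
    qed auto
    also have "\<dots> = (\<Sum>k\<in>UNIV. C k) * B * norm x" by (simp add: sum_distrib_left sum_distrib_right mult_ac)
    finally show "norm (A *v x) \<le> (\<Sum>k\<in>UNIV. C k) * B * norm x" .
  qed
  moreover have "(\<Sum>k\<in>UNIV. C k) \<ge> 0" using C0 by (intro sum_nonneg) auto
  ultimately show ?thesis by blast
qed

section \<open>Similarity to a row contraction\<close>

text \<open>
  In the basis \<open>B\<close> the tuple is the diagonal tuple with entries \<open>L b\<close> plus an error with entries \<open>e\<close>. The
  weights \<open>1 - norm (L b)\<close> make the rows and columns of the error vanish where \<open>L b\<close> is on the sphere; there a
  row contraction leaves no room for off-diagonal entries.
\<close>

definition nearly_diagonal_basis ::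
  "real \<Rightarrow> ('d::finite \<Rightarrow> complex ^ 'n ^ 'n) \<Rightarrow> (complex ^ 'n) set \<Rightarrow> (complex ^ 'n \<Rightarrow> complex ^ 'd) \<Rightarrow>
    ('d \<Rightarrow> complex ^ 'n \<Rightarrow> complex ^ 'n \<Rightarrow> complex) \<Rightarrow> bool" where
  "nearly_diagonal_basis \<epsilon> T B L e \<longleftrightarrow>
     finite B \<and> vec.independent B \<and> (\<forall>b\<in>B. norm (L b) \<le> 1) \<and>
     (\<forall>b\<in>B. \<forall>i. T i *v b = L b $ i *s b + (\<Sum>b'\<in>B. e i b' b *s b')) \<and>
     (\<forall>b\<in>B. \<forall>b'\<in>B. \<forall>i. cmod (e i b' b) \<le> \<epsilon> * (1 - norm (L b')) * (1 - norm (L b)))"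

lemma independent_Un_if_Int_span_zero:
  fixes B C :: "(complex ^ 'n) set"
  assumes B: "vec.independent B" and C: "vec.independent C" and BC: "vec.span B \<inter> vec.span C = {0}"
  shows "vec.independent (B \<union> C)" and "B \<inter> C = {}"
proof -
  have fin: "finite B" "finite C" using B C vec.finiteI_independent by auto
  show disj: "B \<inter> C = {}"
  proof (rule ccontr)
    assume "B \<inter> C \<noteq> {}"
    then obtain b where b: "b \<in> B" "b \<in> C" by blast
    then have "b \<in> vec.span B \<inter> vec.span C" using vec.span_base by blast
    then have "0 \<in> B" using BC b(1) by simp
    then show False using vec.dependent_zero B by metis
  qed
  show "vec.independent (B \<union> C)"
  proof (rule vec.independent_if_scalars_zero)
    show "finite (B \<union> C)" using fin by simp
    fix f x assume s: "(\<Sum>x\<in>B \<union> C. f x *s x) = 0" and x: "x \<in> B \<union> C"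
    have s': "(\<Sum>x\<in>B. f x *s x) + (\<Sum>x\<in>C. f x *s x) = 0" using s unfolding sum.union_disjoint[OF fin disj] .
    have mB: "(\<Sum>x\<in>B. f x *s x) \<in> vec.span B" by (intro vec.span_sum vec.span_scale vec.span_base)
    have mC: "(\<Sum>x\<in>C. f x *s x) \<in> vec.span C" by (intro vec.span_sum vec.span_scale vec.span_base)
    have "(\<Sum>x\<in>B. f x *s x) = - (\<Sum>x\<in>C. f x *s x)" using s' by (simp add: eq_neg_iff_add_eq_0)
    then have "(\<Sum>x\<in>B. f x *s x) \<in> vec.span B \<inter> vec.span C" using mB mC vec.span_neg by auto
    then have zB: "(\<Sum>x\<in>B. f x *s x) = 0" using BC by simp
    then have zC: "(\<Sum>x\<in>C. f x *s x) = 0" using s' by simp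
    show "f x = 0"
      using x vec.independentD[OF B fin(1) subset_refl zB, of x] vec.independentD[OF C fin(2) subset_refl zC, of x] by (elim UnE)
  qed
qed

lemma nearly_diagonal_basis_direct_sum:
  assumes B: "nearly_diagonal_basis \<epsilon> T B L e" and C: "nearly_diagonal_basis \<epsilon> T C M d"
    and int: "vec.span B \<inter> vec.span C = {0}" and \<epsilon>: "\<epsilon> > 0"
  shows "\<exists>L' e'. nearly_diagonal_basis \<epsilon> T (B \<union> C) L' e'"
proof -
  have finB: "finite B" and indB: "vec.independent B" and LB: "\<And>b. b \<in> B \<Longrightarrow> norm (L b) \<le> 1"
    and TB: "\<And>b i. b \<in> B \<Longrightarrow> T i *v b = L b $ i *s b + (\<Sum>b'\<in>B. e i b' b *s b')"
    and eB: "\<And>b b' i. b \<in> B \<Longrightarrow> b' \<in> B \<Longrightarrow> cmod (e i b' b) \<le> \<epsilon> * (1 - norm (L b')) * (1 - norm (L b))"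
    using B unfolding nearly_diagonal_basis_def by blast+
  have finC: "finite C" and indC: "vec.independent C" and LC: "\<And>b. b \<in> C \<Longrightarrow> norm (M b) \<le> 1"
    and TC: "\<And>b i. b \<in> C \<Longrightarrow> T i *v b = M b $ i *s b + (\<Sum>b'\<in>C. d i b' b *s b')"
    and eC: "\<And>b b' i. b \<in> C \<Longrightarrow> b' \<in> C \<Longrightarrow> cmod (d i b' b) \<le> \<epsilon> * (1 - norm (M b')) * (1 - norm (M b))"
    using C unfolding nearly_diagonal_basis_def by blast+
  note ind = independent_Un_if_Int_span_zero(1)[OF indB indC int]
  note disj = independent_Un_if_Int_span_zero(2)[OF indB indC int]
  define L' where "L' b = (if b \<in> B then L b else M b)" for b
  define e' where "e' i b' b = (if b \<in> B then (if b' \<in> B then e i b' b else 0)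
      else (if b' \<in> B then 0 else d i b' b))" for i b' b
  have nB: "b \<notin> B" if "b \<in> C" for b using that disj by blast
  have L'1: "norm (L' b) \<le> 1" if "b \<in> B \<union> C" for b using that LB LC unfolding L'_def by auto
  have T': "T i *v b = L' b $ i *s b + (\<Sum>b'\<in>B \<union> C. e' i b' b *s b')" if "b \<in> B \<union> C" for b i
  proof (cases "b \<in> B")
    case True
    have "(\<Sum>b'\<in>B \<union> C. e' i b' b *s b') = (\<Sum>b'\<in>B. e i b' b *s b')"
      using finB finC True by (intro sum.mono_neutral_cong_right) (auto simp: e'_def)
    then show ?thesis using TB[OF True] True by (simp add: L'_def)
  next
    case False
    have "(\<Sum>b'\<in>B \<union> C. e' i b' b *s b') = (\<Sum>b'\<in>C. d i b' b *s b')"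
      using finB finC False nB by (intro sum.mono_neutral_cong_right) (auto simp: e'_def)
    then show ?thesis using TC False that by (simp add: L'_def)
  qed
  have bound: "cmod (e' i b' b) \<le> \<epsilon> * (1 - norm (L' b')) * (1 - norm (L' b))" if "b \<in> B \<union> C" "b' \<in> B \<union> C" for b b' i
  proof (cases "(b \<in> B) = (b' \<in> B)")
    case True
    then show ?thesis using that eB[of b b' i] eC[of b b' i] by (auto simp: e'_def L'_def)
  next
    case False
    then have "e' i b' b = 0" by (auto simp: e'_def)
    then show ?thesis using L'1[OF that(1)] L'1[OF that(2)] \<epsilon> by simp
  qed
  have "nearly_diagonal_basis \<epsilon> T (B \<union> C) L' e'"
    unfolding nearly_diagonal_basis_def using finB finC ind L'1 T' bound by blast
  then show ?thesis by blast
qed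

text \<open>
  If \<open>norm l < 1\<close>, take such a basis of a subspace of \<open>U\<close> with as many elements as possible. If it did not span
  \<open>U\<close>, some \<open>v\<close> outside the span would be mapped into the span by all nilpotent parts, and a small multiple of
  \<open>v\<close> could be added to the basis, because the multiple scales the new entries of the error.
\<close>

lemma nearly_diagonal_basis_primary:
  fixes T :: "'d::finite \<Rightarrow> complex ^ 'n ^ 'n"
  assumes T: "commuting_tuple T" and sg: "slow_growth T" and inv: "invariant_subspace T U"
    and nil: "\<And>i u. u \<in> U \<Longrightarrow> mat_power (T i - mat (l $ i)) m *v u = 0" and \<epsilon>: "\<epsilon> > 0"
  shows "\<exists>B L e. nearly_diagonal_basis \<epsilon> T B L e \<and> vec.span B = U"
proof -
  have U: "vec.subspace U" using inv unfolding invariant_subspace_def by simp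
  show ?thesis
  proof (cases "U = {0}")
    case True
    have "nearly_diagonal_basis \<epsilon> T {} (\<lambda>_. 0) (\<lambda>_ _ _. 0) \<and> vec.span {} = U"
      unfolding nearly_diagonal_basis_def True using vec.independent_empty by simp
    then show ?thesis by blast
  next
    case False
    have l: "norm l \<le> 1" by (rule joint_eigenvalue_norm_le[OF T inv nil sg False])
    show ?thesis
    proof (cases "norm l = 1")
      case True
      obtain B where B: "B \<subseteq> U" "vec.independent B" "U \<subseteq> vec.span B" by (rule vec.basis_exists[of U], rule that)
      have span: "vec.span B = U" using B vec.span_minimal[OF B(1) U] by blast
      have "T i *v b = l $ i *s b" if "b \<in> B" for b i
        using sphere_eigenvalue_semisimple[OF T inv nil sg True, of b i] that B(1)
        by (auto simp: matrix_vector_mult_diff_rdistrib mat_vec_mult)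
      then have "nearly_diagonal_basis \<epsilon> T B (\<lambda>_. l) (\<lambda>_ _ _. 0)"
        unfolding nearly_diagonal_basis_def using B(2) vec.finiteI_independent[OF B(2)] True by simp
      then show ?thesis using span by blast
    next
      case False
      define \<delta> where "\<delta> = \<epsilon> * (1 - norm l) * (1 - norm l)"
      have \<delta>: "\<delta> > 0" using l False \<epsilon> unfolding \<delta>_def by simp
      define Good where "Good B \<longleftrightarrow> B \<subseteq> U \<and> (\<exists>e. nearly_diagonal_basis \<epsilon> T B (\<lambda>_. l) e)" for B
      have "Good {}" unfolding Good_def nearly_diagonal_basis_def using vec.independent_empty by simp
      moreover have "\<forall>B. Good B \<longrightarrow> card B < Suc CARD('n)"
      proof (intro allI impI)
        fix B assume "Good B"
        then have "vec.independent B" unfolding Good_def nearly_diagonal_basis_def by blast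
        then show "card B < Suc CARD('n)"
          using vec.independent_card_le_dim[of B UNIV] dim_subset_UNIV_cart_gen[of "UNIV :: (complex ^ 'n) set"] by simp
      qed
      ultimately obtain B where B: "Good B" "\<And>C. Good C \<Longrightarrow> card C \<le> card B"
        using ex_has_greatest_nat[of Good "{}" card "Suc CARD('n)"] by auto
      obtain e where BU: "B \<subseteq> U" and e: "nearly_diagonal_basis \<epsilon> T B (\<lambda>_. l) e" using B(1) unfolding Good_def by blast
      have fin: "finite B" and ind: "vec.independent B"
        and TB: "\<And>b i. b \<in> B \<Longrightarrow> T i *v b = l $ i *s b + (\<Sum>b'\<in>B. e i b' b *s b')"
        and eB: "\<And>b b' i. b \<in> B \<Longrightarrow> b' \<in> B \<Longrightarrow> cmod (e i b' b) \<le> \<delta>"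
        using e unfolding nearly_diagonal_basis_def \<delta>_def by blast+
      have "v \<in> vec.span B" if "v \<in> U" for v
      proof (rule primary_nilpotent_induct[OF T inv nil, where Q = "\<lambda>v. v \<in> vec.span B"])
        show "v \<in> U" "0 \<in> vec.span B" using that vec.span_zero by auto
        fix v assume v: "v \<in> U" and Nv: "\<And>i. (T i - mat (l $ i)) *v v \<in> vec.span B"
        show "v \<in> vec.span B"
        proof (rule ccontr)
          assume nv: "v \<notin> vec.span B"
          have "\<exists>c. (T i - mat (l $ i)) *v v = (\<Sum>b\<in>B. c b *s b)" for i
            using Nv[of i] unfolding vec.span_finite[OF fin] by auto
          then obtain c where c: "\<And>i. (T i - mat (l $ i)) *v v = (\<Sum>b\<in>B. c i b *s b)" by metis
          \<comment> \<open>With the factor \<open>\<delta> / S\<close>, all new entries have modulus at most \<open>\<delta>\<close>.\<close>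
          define S where "S = 1 + (\<Sum>i\<in>UNIV. \<Sum>b\<in>B. cmod (c i b))"
          have S: "S > 0" unfolding S_def by (intro add_pos_nonneg sum_nonneg) auto
          have cS: "cmod (c i b) \<le> S" if "b \<in> B" for i b
          proof -
            have "cmod (c i b) \<le> (\<Sum>b\<in>B. cmod (c i b))" using fin that by (intro member_le_sum) auto
            also have "\<dots> \<le> (\<Sum>i\<in>UNIV. \<Sum>b\<in>B. cmod (c i b))"
              by (rule member_le_sum[of i UNIV "\<lambda>i. \<Sum>b\<in>B. cmod (c i b)"]) (auto intro: sum_nonneg)
            finally show ?thesis unfolding S_def by simp
          qed
          define t where "t = complex_of_real (\<delta> / S)"
          have t: "t \<noteq> 0" "cmod t = \<delta> / S" using \<delta> S unfolding t_def norm_of_real by auto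
          have ntv: "t *s v \<notin> vec.span B"
          proof
            assume "t *s v \<in> vec.span B"
            then have "(1 / t) *s (t *s v) \<in> vec.span B" by (rule vec.span_scale)
            then show False using nv t by simp
          qed
          have tvB: "t *s v \<notin> B" using ntv vec.span_base by blast
          define e' where "e' i b' b = (if b' = t *s v then 0 else if b = t *s v then t * c i b' else e i b' b)" for i b' b
          have ins: "(\<Sum>b'\<in>insert (t *s v) B. e' i b' b *s b') = (\<Sum>b'\<in>B. e' i b' b *s b')" for i b
            using fin tvB by (simp add: e'_def)
          have T': "T i *v b = l $ i *s b + (\<Sum>b'\<in>insert (t *s v) B. e' i b' b *s b')" if "b \<in> insert (t *s v) B" for b i
          proof (cases "b = t *s v")
            case True
            have "T i *v v = l $ i *s v + (\<Sum>b\<in>B. c i b *s b)"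
              using c[of i] by (simp add: matrix_vector_mult_diff_rdistrib mat_vec_mult algebra_simps)
            then have "T i *v b = l $ i *s b + (\<Sum>b'\<in>B. (t * c i b') *s b')"
              unfolding True mat_vec_scale by (simp add: vector_add_ldistrib vec.scale_sum_right mult.commute)
            also have "(\<Sum>b'\<in>B. (t * c i b') *s b') = (\<Sum>b'\<in>B. e' i b' b *s b')"
              using tvB True by (intro sum.cong refl) (auto simp: e'_def)
            finally show ?thesis unfolding ins .
          next
            case False
            then have "b \<in> B" using that by simp
            moreover have "(\<Sum>b'\<in>B. e i b' b *s b') = (\<Sum>b'\<in>B. e' i b' b *s b')"
              using tvB False by (intro sum.cong refl) (auto simp: e'_def)
            ultimately show ?thesis unfolding ins using TB by simp
          qed
          have e'\<delta>: "cmod (e' i b' b) \<le> \<delta>" if bb: "b \<in> insert (t *s v) B" "b' \<in> insert (t *s v) B" for i b b'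
          proof -
            consider "b' = t *s v" | "b' \<in> B" "b' \<noteq> t *s v" "b = t *s v" | "b' \<in> B" "b \<in> B" "b' \<noteq> t *s v" "b \<noteq> t *s v"
              using bb by blast
            then show ?thesis
            proof cases
              case 1 then show ?thesis using \<delta> by (simp add: e'_def)
            next
              case 2
              have "\<delta> / S * cmod (c i b') \<le> \<delta> / S * S" using cS[OF 2(1)] \<delta> S by (intro mult_left_mono) auto
              then show ?thesis using 2 t S by (simp add: e'_def norm_mult)
            next
              case 3 then show ?thesis using eB by (simp add: e'_def)
            qed
          qed
          have "nearly_diagonal_basis \<epsilon> T (insert (t *s v) B) (\<lambda>_. l) e'"
            unfolding nearly_diagonal_basis_def \<delta>_def[symmetric]
            using fin vec.independent_insertI[OF ntv ind] l T' e'\<delta> by blast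
          moreover have "t *s v \<in> U" using v U by (simp add: vec.subspace_scale)
          ultimately have "Good (insert (t *s v) B)" unfolding Good_def using BU by blast
          from B(2)[OF this] show False using fin tvB by simp
        qed
      qed
      then have "vec.span B = U" using vec.span_minimal[OF BU U] by blast
      then show ?thesis using e by blast
    qed
  qed
qed

lemma nearly_diagonal_basis_exists:
  fixes T :: "'d::finite \<Rightarrow> complex ^ 'n ^ 'n"
  assumes T: "commuting_tuple T" and sg: "slow_growth T" and \<epsilon>: "\<epsilon> > 0"
  shows "\<exists>B L e. nearly_diagonal_basis \<epsilon> T B L e \<and> vec.span B = UNIV"
proof -
  have "\<exists>B L e. nearly_diagonal_basis \<epsilon> T B L e \<and> vec.span B = U" if "invariant_subspace T U" for U
    using that
  proof (rule primary_induct[OF T, rotated 2])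
    show "\<exists>B L e. nearly_diagonal_basis \<epsilon> T B L e \<and> vec.span B = U"
      if "invariant_subspace T U" "\<And>i u. u \<in> U \<Longrightarrow> mat_power (T i - mat (l $ i)) m *v u = 0" for U l m
      using nearly_diagonal_basis_primary[OF T sg that \<epsilon>] by blast
  next
    fix U V assume "U \<inter> V = {0}"
      and "\<exists>B L e. nearly_diagonal_basis \<epsilon> T B L e \<and> vec.span B = U"
      and "\<exists>B L e. nearly_diagonal_basis \<epsilon> T B L e \<and> vec.span B = V"
    then obtain B L e C M d where BC: "nearly_diagonal_basis \<epsilon> T B L e" "vec.span B = U"
      "nearly_diagonal_basis \<epsilon> T C M d" "vec.span C = V" by metis
    then obtain L' e' where "nearly_diagonal_basis \<epsilon> T (B \<union> C) L' e'"
      using nearly_diagonal_basis_direct_sum[OF BC(1,3) _ \<epsilon>] \<open>U \<inter> V = {0}\<close> by blast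
    moreover have "vec.span (B \<union> C) = {u + v | u v. u \<in> U \<and> v \<in> V}" unfolding vec.span_Un BC(2,4) by blast
    ultimately show "\<exists>B L e. nearly_diagonal_basis \<epsilon> T B L e \<and> vec.span B = {u + v | u v. u \<in> U \<and> v \<in> V}" by metis
  qed
  then show ?thesis unfolding invariant_subspace_def by simp
qed

lemma cinner_adjoint: "cinner (A *v x) w = cinner x (conj_transpose A *v w)"
proof -
  have "cinner (A *v x) w = (\<Sum>i\<in>UNIV. \<Sum>j\<in>UNIV. A $ i $ j * x $ j * cnj (w $ i))"
    unfolding cinner_def matrix_vector_mult_def by (simp add: sum_distrib_right)
  also have "\<dots> = (\<Sum>j\<in>UNIV. \<Sum>i\<in>UNIV. A $ i $ j * x $ j * cnj (w $ i))" by (rule sum.swap)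
  also have "\<dots> = cinner x (conj_transpose A *v w)"
    unfolding cinner_def matrix_vector_mult_def conj_transpose_def by (simp add: sum_distrib_left mult_ac)
  finally show ?thesis .
qed

text \<open>
  A row operator and its adjoint column have the same norm.
\<close>

lemma row_contraction_if_column:
  fixes R :: "'d::finite \<Rightarrow> complex ^ 'n ^ 'n"
  assumes col: "\<And>x. (\<Sum>i\<in>UNIV. (norm (conj_transpose (R i) *v x))\<^sup>2) \<le> (norm x)\<^sup>2"
  shows "row_contraction R"
proof -
  define P where "P = (\<Sum>i\<in>UNIV. R i ** conj_transpose (R i))"
  have "norm (P *v x) \<le> norm x" for x
  proof -
    let ?w = "P *v x"
    have sum_left: "cinner (\<Sum>i\<in>UNIV. f i) w = (\<Sum>i\<in>UNIV. cinner (f i) w)" for f :: "'d \<Rightarrow> complex ^ 'n" and w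
      unfolding cinner_def by (simp add: sum_distrib_right) (rule sum.swap)
    have "cinner ?w ?w = (\<Sum>i\<in>UNIV. cinner (conj_transpose (R i) *v x) (conj_transpose (R i) *v ?w))"
      unfolding P_def sum_mat_vec sum_left
      by (simp add: matrix_vector_mul_assoc[symmetric] cinner_adjoint)
    then have "cmod (cinner ?w ?w) \<le> (\<Sum>i\<in>UNIV. cmod (cinner (conj_transpose (R i) *v x) (conj_transpose (R i) *v ?w)))"
      by (simp only: norm_sum)
    then have "(norm ?w)\<^sup>2 \<le> (\<Sum>i\<in>UNIV. cmod (cinner (conj_transpose (R i) *v x) (conj_transpose (R i) *v ?w)))"
      unfolding cinner_self[of ?w] norm_of_real by simp
    also have "\<dots> \<le> (\<Sum>i\<in>UNIV. \<bar>norm (conj_transpose (R i) *v x)\<bar> * \<bar>norm (conj_transpose (R i) *v ?w)\<bar>)"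
      by (intro sum_mono) (simp add: cinner_cmod_le)
    also have "\<dots> \<le> L2_set (\<lambda>i. norm (conj_transpose (R i) *v x)) UNIV * L2_set (\<lambda>i. norm (conj_transpose (R i) *v ?w)) UNIV"
      by (rule L2_set_mult_ineq)
    also have "\<dots> \<le> norm x * norm ?w"
    proof (rule mult_mono)
      show "L2_set (\<lambda>i. norm (conj_transpose (R i) *v y)) UNIV \<le> norm y" for y
        unfolding L2_set_def using col[of y] by (intro real_le_lsqrt) (auto simp: sum_nonneg)
      then show "L2_set (\<lambda>i. norm (conj_transpose (R i) *v ?w)) UNIV \<le> norm ?w" .
    qed auto
    finally have "norm ?w * norm ?w \<le> norm x * norm ?w" by (simp add: power2_eq_square)
    then show ?thesis by (cases "norm ?w = 0") auto
  qed
  then have "op_norm P \<le> 1" unfolding op_norm_def by (intro onorm_le) simp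
  then show ?thesis unfolding row_contraction_def P_def by simp
qed

text \<open>
  Let \<open>\<delta> k = 1 - norm (L k)\<close>. The entries with index \<open>k\<close> of the column of adjoints applied to \<open>x\<close> have
  Euclidean norm at most \<open>(1 - \<delta> k) \<bar>x k\<bar> + \<delta> k s / n\<close>, where \<open>s\<close> is the sum of the
  \<open>\<delta> j \<bar>x j\<bar>\<close>. This is a convex combination, so its square is at most
  \<open>(1 - \<delta> k) \<bar>x k\<bar>\<^sup>2 + \<delta> k (s/n)\<^sup>2\<close>, and summing over \<open>k\<close> the second terms are absorbed by the
  missing \<open>\<delta> k \<bar>x k\<bar>\<^sup>2\<close>, by the Cauchy-Schwarz inequality for \<open>s\<close>.
\<close>

lemma row_contraction_if_nearly_diagonal:
  fixes R :: "'d::finite \<Rightarrow> complex ^ 'n ^ 'n" and L :: "'n \<Rightarrow> complex ^ 'd"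
  assumes L: "\<And>k. norm (L k) \<le> 1"
    and R: "\<And>i. R i = (\<chi> j k. (if j = k then L k $ i else 0) + e i j k)"
    and e: "\<And>i j k. cmod (e i j k) \<le> 1 / (real CARD('d) * real CARD('n)) * (1 - norm (L j)) * (1 - norm (L k))"
  shows "row_contraction R"
proof (rule row_contraction_if_column)
  fix x :: "complex ^ 'n"
  define \<delta> where "\<delta> k = 1 - norm (L k)" for k
  have \<delta>: "0 \<le> \<delta> k" "\<delta> k \<le> 1" for k using L[of k] unfolding \<delta>_def by auto
  define n where "n = real CARD('n)"
  have n: "n > 0" unfolding n_def by simp
  define s where "s = (\<Sum>j\<in>UNIV. \<delta> j * cmod (x $ j))"
  have s0: "s \<ge> 0" unfolding s_def using \<delta> by (intro sum_nonneg) auto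
  have comp: "(conj_transpose (R i) *v x) $ k = cnj (L k $ i) * x $ k + (\<Sum>j\<in>UNIV. cnj (e i j k) * x $ j)" for i k
    unfolding R conj_transpose_def matrix_vector_mult_def
    by (simp add: distrib_right sum.distrib if_distrib[of cnj] if_distribR[of _ _ _ "x $ _"] if_distrib[of "\<lambda>y. y * _"] cong: if_cong)
  have col: "(\<Sum>i\<in>UNIV. (cmod ((conj_transpose (R i) *v x) $ k))\<^sup>2) \<le> (1 - \<delta> k) * (cmod (x $ k))\<^sup>2 + \<delta> k * (s / n)\<^sup>2" for k
  proof -
    have "L2_set (\<lambda>i. cmod ((conj_transpose (R i) *v x) $ k)) UNIV
       \<le> L2_set (\<lambda>i. cmod (cnj (L k $ i) * x $ k) + cmod (\<Sum>j\<in>UNIV. cnj (e i j k) * x $ j)) UNIV"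
      unfolding comp by (intro L2_set_mono norm_triangle_ineq) auto
    also have "\<dots> \<le> L2_set (\<lambda>i. cmod (cnj (L k $ i) * x $ k)) UNIV + L2_set (\<lambda>i. cmod (\<Sum>j\<in>UNIV. cnj (e i j k) * x $ j)) UNIV"
      by (rule L2_set_triangle_ineq)
    also have "L2_set (\<lambda>i. cmod (cnj (L k $ i) * x $ k)) UNIV = (1 - \<delta> k) * cmod (x $ k)"
      unfolding \<delta>_def norm_vec_def[of "L k"] by (simp add: norm_mult L2_set_left_distrib)
    also have "L2_set (\<lambda>i. cmod (\<Sum>j\<in>UNIV. cnj (e i j k) * x $ j)) UNIV \<le> (\<Sum>i\<in>(UNIV :: 'd set). 1 / (real CARD('d) * n) * \<delta> k * s)"
    proof (rule order_trans[OF L2_set_le_sum sum_mono])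
      fix i :: 'd
      have "cmod (\<Sum>j\<in>UNIV. cnj (e i j k) * x $ j) \<le> (\<Sum>j\<in>UNIV. cmod (e i j k) * cmod (x $ j))"
        by (rule order_trans[OF norm_sum]) (simp add: norm_mult)
      also have "\<dots> \<le> (\<Sum>j\<in>UNIV. (1 / (real CARD('d) * n) * \<delta> j * \<delta> k) * cmod (x $ j))"
        using e unfolding \<delta>_def n_def by (intro sum_mono mult_right_mono) auto
      also have "\<dots> = 1 / (real CARD('d) * n) * \<delta> k * s"
        unfolding s_def sum_distrib_left by (intro sum.cong refl) (simp add: mult_ac)
      finally show "cmod (\<Sum>j\<in>UNIV. cnj (e i j k) * x $ j) \<le> 1 / (real CARD('d) * n) * \<delta> k * s" .
    qed auto
    also have "\<dots> = \<delta> k * (s / n)" using n by simp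
    finally have "L2_set (\<lambda>i. cmod ((conj_transpose (R i) *v x) $ k)) UNIV \<le> (1 - \<delta> k) * cmod (x $ k) + \<delta> k * (s / n)" by simp
    then have "(L2_set (\<lambda>i. cmod ((conj_transpose (R i) *v x) $ k)) UNIV)\<^sup>2 \<le> ((1 - \<delta> k) * cmod (x $ k) + \<delta> k * (s / n))\<^sup>2"
      by (rule power_mono) simp
    also have "\<dots> \<le> (1 - \<delta> k) * (cmod (x $ k))\<^sup>2 + \<delta> k * (s / n)\<^sup>2"
    proof -
      have "(1 - d) * a\<^sup>2 + d * b\<^sup>2 - ((1 - d) * a + d * b)\<^sup>2 = d * (1 - d) * (a - b)\<^sup>2" for a b d :: real
        by (simp add: power2_eq_square algebra_simps)
      moreover have "\<delta> k * (1 - \<delta> k) * (cmod (x $ k) - s / n)\<^sup>2 \<ge> 0" using \<delta>[of k] by simp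
      ultimately show ?thesis by (metis diff_ge_0_iff_ge)
    qed
    finally show ?thesis unfolding L2_set_def by (simp add: sum_nonneg)
  qed
  have s2: "s\<^sup>2 \<le> n * (\<Sum>j\<in>UNIV. \<delta> j * (cmod (x $ j))\<^sup>2)"
  proof -
    have "s\<^sup>2 \<le> n * (\<Sum>j\<in>UNIV. (\<delta> j * cmod (x $ j))\<^sup>2)"
      unfolding s_def n_def using sum_squared_le_sum_of_squares[of "\<lambda>j. \<delta> j * cmod (x $ j)" UNIV] by (simp add: mult.commute)
    also have "\<dots> \<le> n * (\<Sum>j\<in>UNIV. \<delta> j * (cmod (x $ j))\<^sup>2)"
    proof (intro mult_left_mono sum_mono)
      fix j
      have "\<delta> j * \<delta> j \<le> \<delta> j * 1" using \<delta>[of j] by (intro mult_left_mono) auto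
      then have "(\<delta> j * \<delta> j) * (cmod (x $ j))\<^sup>2 \<le> \<delta> j * (cmod (x $ j))\<^sup>2" by (intro mult_right_mono) auto
      then show "(\<delta> j * cmod (x $ j))\<^sup>2 \<le> \<delta> j * (cmod (x $ j))\<^sup>2" by (simp add: power2_eq_square mult_ac)
    qed (use n in simp)
    finally show ?thesis .
  qed
  have vec_norm: "(norm y)\<^sup>2 = (\<Sum>k\<in>UNIV. (cmod (y $ k))\<^sup>2)" for y :: "complex ^ 'n"
    unfolding norm_vec_def L2_set_def by (simp add: sum_nonneg)
  have "(\<Sum>i\<in>UNIV. (norm (conj_transpose (R i) *v x))\<^sup>2) = (\<Sum>k\<in>UNIV. \<Sum>i\<in>UNIV. (cmod ((conj_transpose (R i) *v x) $ k))\<^sup>2)"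
    unfolding vec_norm by (rule sum.swap)
  also have "\<dots> \<le> (\<Sum>k\<in>UNIV. (1 - \<delta> k) * (cmod (x $ k))\<^sup>2 + \<delta> k * (s / n)\<^sup>2)" by (intro sum_mono col)
  also have "\<dots> \<le> (\<Sum>k\<in>UNIV. (1 - \<delta> k) * (cmod (x $ k))\<^sup>2) + n * (s / n)\<^sup>2"
  proof -
    have "(\<Sum>k\<in>UNIV. \<delta> k * (s / n)\<^sup>2) \<le> (\<Sum>k\<in>(UNIV :: 'n set). 1 * (s / n)\<^sup>2)"
      using \<delta> by (intro sum_mono mult_right_mono) auto
    then show ?thesis by (simp add: sum.distrib n_def)
  qed
  also have "n * (s / n)\<^sup>2 \<le> (\<Sum>j\<in>UNIV. \<delta> j * (cmod (x $ j))\<^sup>2)"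
    using s2 n by (simp add: power_divide power2_eq_square field_simps)
  also have "(\<Sum>k\<in>UNIV. (1 - \<delta> k) * (cmod (x $ k))\<^sup>2) + (\<Sum>j\<in>UNIV. \<delta> j * (cmod (x $ j))\<^sup>2) = (norm x)\<^sup>2"
    unfolding vec_norm sum.distrib[symmetric] by (simp add: algebra_simps)
  finally show "(\<Sum>i\<in>UNIV. (norm (conj_transpose (R i) *v x))\<^sup>2) \<le> (norm x)\<^sup>2" by simp
qed

lemma matrix_mult_matrix_inv: "invertible S \<Longrightarrow> S ** matrix_inv S = mat 1"
  unfolding invertible_def matrix_inv_def by (rule someI_ex[THEN conjunct1])

theorem similar_to_row_contraction:
  fixes T :: "'d::finite \<Rightarrow> complex ^ 'n ^ 'n"
  assumes T: "commuting_tuple T" and sg: "slow_growth T"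
  shows "\<exists>R. row_contraction R \<and> jointly_similar T R"
proof -
  define \<epsilon> where "\<epsilon> = 1 / (real CARD('d) * real CARD('n))"
  have "\<epsilon> > 0" unfolding \<epsilon>_def by simp
  then obtain B L e where ndb: "nearly_diagonal_basis \<epsilon> T B L e" and span: "vec.span B = UNIV"
    using nearly_diagonal_basis_exists[OF T sg] by blast
  have fin: "finite B" and ind: "vec.independent B" and L: "\<And>b. b \<in> B \<Longrightarrow> norm (L b) \<le> 1"
    and TB: "\<And>b i. b \<in> B \<Longrightarrow> T i *v b = L b $ i *s b + (\<Sum>b'\<in>B. e i b' b *s b')"
    and eB: "\<And>b b' i. b \<in> B \<Longrightarrow> b' \<in> B \<Longrightarrow> cmod (e i b' b) \<le> \<epsilon> * (1 - norm (L b')) * (1 - norm (L b))"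
    using ndb unfolding nearly_diagonal_basis_def by blast+
  have "card B = vec.dim (UNIV :: (complex ^ 'n) set)"
    using vec.dim_eq_card_independent[OF ind] vec.dim_span[of B] span by simp
  also have "\<dots> = CARD('n)" by (rule vec_dim_card)
  finally have "card B = CARD('n)" .
  then obtain \<beta> where \<beta>: "bij_betw \<beta> (UNIV :: 'n set) B"
    using finite_same_card_bij[OF finite fin] by metis
  have \<beta>B: "\<beta> k \<in> B" for k using \<beta> unfolding bij_betw_def by blast
  define S :: "complex ^ 'n ^ 'n" where "S = (\<chi> r k. \<beta> k $ r)"
  define R where "R i = (\<chi> j k. (if j = k then L (\<beta> k) $ i else 0) + e i (\<beta> j) (\<beta> k))" for i
  have Sx: "S *v x = (\<Sum>k\<in>UNIV. x $ k *s \<beta> k)" for x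
    unfolding S_def matrix_vector_mult_def by (simp add: vec_eq_iff mult.commute)
  have "surj ((*v) S)"
  proof -
    have "y \<in> range ((*v) S)" for y
    proof -
      have "y \<in> vec.span B" using span by simp
      then obtain c where "y = (\<Sum>b\<in>B. c b *s b)" unfolding vec.span_finite[OF fin] by blast
      also have "\<dots> = (\<Sum>k\<in>UNIV. c (\<beta> k) *s \<beta> k)" by (rule sum.reindex_bij_betw[OF \<beta>, symmetric])
      finally have "y = S *v (\<chi> k. c (\<beta> k))" unfolding Sx by simp
      then show ?thesis by blast
    qed
    then show ?thesis by blast
  qed
  then have "\<exists>S'. S ** S' = mat 1" using matrix_right_invertible_surjective by blast
  then have inv: "invertible S" unfolding invertible_right_inverse .
  have TS: "T i ** S = S ** R i" for i
  proof -
    have "(T i ** S) *v x = (S ** R i) *v x" for x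
    proof -
      have "(T i ** S) *v x = (\<Sum>k\<in>UNIV. x $ k *s (T i *v \<beta> k))"
        by (simp add: matrix_vector_mul_assoc[symmetric] Sx mat_vec_sum mat_vec_scale)
      also have "\<dots> = (\<Sum>k\<in>UNIV. x $ k *s (\<Sum>j\<in>UNIV. (R i $ j $ k) *s \<beta> j))"
      proof (intro sum.cong refl arg_cong[where f = "\<lambda>v. _ *s v"])
        fix k
        have "T i *v \<beta> k = L (\<beta> k) $ i *s \<beta> k + (\<Sum>j\<in>UNIV. e i (\<beta> j) (\<beta> k) *s \<beta> j)"
          unfolding TB[OF \<beta>B] by (simp add: sum.reindex_bij_betw[OF \<beta>, of "\<lambda>b. e i b (\<beta> k) *s b"])
        also have "L (\<beta> k) $ i *s \<beta> k = (\<Sum>j\<in>UNIV. (if j = k then L (\<beta> k) $ i else 0) *s \<beta> j)"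
          by (simp add: if_distrib[of "\<lambda>c. c *s _"] cong: if_cong)
        finally show "T i *v \<beta> k = (\<Sum>j\<in>UNIV. (R i $ j $ k) *s \<beta> j)"
          unfolding R_def by (simp add: sum.distrib[symmetric] vector_sadd_rdistrib)
      qed
      also have "\<dots> = (\<Sum>j\<in>UNIV. \<Sum>k\<in>UNIV. (R i $ j $ k * x $ k) *s \<beta> j)"
        unfolding vec.scale_sum_right by (subst sum.swap) (simp add: mult.commute)
      also have "\<dots> = (S ** R i) *v x"
        unfolding matrix_vector_mul_assoc[symmetric] Sx vec.scale_sum_left[symmetric]
        by (simp add: matrix_vector_mult_def)
      finally show ?thesis .
    qed
    then show ?thesis using matrix_eq by blast
  qed
  have "T i = S ** R i ** matrix_inv S" for i
  proof -
    have "T i = T i ** (S ** matrix_inv S)" using matrix_mult_matrix_inv[OF inv] by simp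
    also have "\<dots> = S ** R i ** matrix_inv S" unfolding matrix_mul_assoc TS ..
    finally show ?thesis .
  qed
  then have "jointly_similar T R" unfolding jointly_similar_def using inv by blast
  moreover have "row_contraction R"
    by (rule row_contraction_if_nearly_diagonal[where L = "\<lambda>k. L (\<beta> k)" and e = "\<lambda>i j k. e i (\<beta> j) (\<beta> k)"])
      (use L \<beta>B eB in \<open>auto simp: R_def \<epsilon>_def\<close>)
  ultimately show ?thesis by blast
qed

section \<open>Representations of algebras that contain the polynomials\<close>

lemma norm_le_op_norm:
  fixes A :: "complex ^ 'n ^ 'n"
  shows "norm A \<le> (real CARD('n))\<^sup>2 * op_norm A"
proof -
  have entry: "cmod (A $ i $ j) \<le> op_norm A" for i j
  proof -
    have "A $ i $ j = (A *v axis j 1) $ i"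
      by (simp add: matrix_vector_mult_def axis_def if_distrib[of "\<lambda>y. _ * y"] cong: if_cong)
    then have "cmod (A $ i $ j) \<le> norm (A *v axis j 1)" by (simp add: Finite_Cartesian_Product.norm_nth_le)
    also have "\<dots> \<le> op_norm A * norm (axis j (1::complex) :: complex ^ 'n)" by (rule norm_mat_vec_le)
    also have "norm (axis j (1::complex) :: complex ^ 'n) = 1"
      by (simp add: norm_vec_def L2_set_def axis_def if_distrib[of "\<lambda>y. (norm y)\<^sup>2"] cong: if_cong)
    finally show ?thesis by simp
  qed
  have "norm A \<le> (\<Sum>i\<in>UNIV. norm (A $ i))" unfolding norm_vec_def[of A] by (rule L2_set_le_sum) simp
  also have "\<dots> \<le> (\<Sum>i\<in>UNIV. \<Sum>j\<in>UNIV. cmod (A $ i $ j))"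
    unfolding norm_vec_def[of "A $ _"] by (intro sum_mono L2_set_le_sum) simp
  also have "\<dots> \<le> (\<Sum>i\<in>(UNIV :: 'n set). \<Sum>j\<in>(UNIV :: 'n set). op_norm A)" by (intro sum_mono entry)
  also have "\<dots> = (real CARD('n))\<^sup>2 * op_norm A" by (simp add: power2_eq_square)
  finally show ?thesis .
qed

lemma tendsto_matrix_mult:
  fixes G H :: "nat \<Rightarrow> complex ^ 'n ^ 'n"
  assumes "G \<longlonglongrightarrow> A" "H \<longlonglongrightarrow> B"
  shows "(\<lambda>k. G k ** H k) \<longlonglongrightarrow> A ** B"
  unfolding matrix_matrix_mult_def
  by (intro tendsto_vec_lambda tendsto_sum tendsto_mult tendsto_vec_nth assms)

lemma tendsto_matrix_vector:
  fixes G :: "nat \<Rightarrow> complex ^ 'n ^ 'n"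
  assumes "G \<longlonglongrightarrow> A"
  shows "(\<lambda>k. G k *v v) \<longlonglongrightarrow> A *v v"
  unfolding matrix_vector_mult_def
  by (intro tendsto_vec_lambda tendsto_sum tendsto_mult tendsto_vec_nth assms tendsto_const)

lemma on_ball_poly_eval: "on_ball (poly_eval p) = poly_on_ball p"
  unfolding on_ball_def poly_on_ball_eq ..

lemma on_ball_one: "on_ball (\<lambda>z. 1) = one_on unit_ball"
  unfolding on_ball_def one_on_def ..

locale ball_rep =
  fixes A :: "(complex ^ 'd \<Rightarrow> complex) set" and \<nu> :: "(complex ^ 'd \<Rightarrow> complex) \<Rightarrow> real"
    and \<pi> :: "(complex ^ 'd \<Rightarrow> complex) \<Rightarrow> complex ^ 'n ^ 'n"
  assumes polys: "\<And>f. polynomial_fun f \<Longrightarrow> on_ball f \<in> A"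
    and rep: "\<pi> \<in> bounded_unital_reps A \<nu>"
begin

lemma rep_add: "f \<in> A \<Longrightarrow> g \<in> A \<Longrightarrow> \<pi> (\<lambda>z. f z + g z) = \<pi> f + \<pi> g"
  and rep_scale: "f \<in> A \<Longrightarrow> \<pi> (\<lambda>z. c * f z) = mat c ** \<pi> f"
  and rep_mult: "f \<in> A \<Longrightarrow> g \<in> A \<Longrightarrow> \<pi> (\<lambda>z. f z * g z) = \<pi> f ** \<pi> g"
  and rep_one: "\<pi> (one_on unit_ball) = mat 1"
  and ext: "\<pi> \<in> extensional A"
  and bounded: "\<exists>C. \<forall>f\<in>A. op_norm (\<pi> f) \<le> C * \<nu> f"
  using rep unfolding bounded_unital_reps_def by blast+

definition tuple :: "'d \<Rightarrow> complex ^ 'n ^ 'n" where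
  "tuple i = \<pi> (on_ball (\<lambda>z. z $ i))"

lemma calculus: "poly_calculus tuple f M \<Longrightarrow> \<pi> (on_ball f) = M"
proof (induction rule: poly_calculus.induct)
  case (const c)
  have "on_ball (\<lambda>z :: complex ^ 'd. c) = (\<lambda>z. c * on_ball (\<lambda>z. 1) z)" unfolding on_ball_def by auto
  then show ?case using rep_scale[OF polys[OF polynomial_fun_const], of c 1] rep_one by (simp add: on_ball_one)
next
  case (coord i) then show ?case by (simp add: tuple_def)
next
  case (add f F g G)
  have "on_ball (\<lambda>z. f z + g z) = (\<lambda>z. on_ball f z + on_ball g z)" unfolding on_ball_def by auto
  then show ?case using add rep_add[OF polys polys] polynomial_fun_if_calculus by metis
next
  case (mult f F g G)
  have "on_ball (\<lambda>z. f z * g z) = (\<lambda>z. on_ball f z * on_ball g z)" unfolding on_ball_def by auto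
  then show ?case using mult rep_mult[OF polys polys] polynomial_fun_if_calculus by metis
qed

lemma tuple_commuting: "commuting_tuple tuple"
  unfolding commuting_tuple_def
proof (intro allI)
  fix i j
  have "tuple i ** tuple j = \<pi> (\<lambda>z. on_ball (\<lambda>z. z $ i) z * on_ball (\<lambda>z. z $ j) z)"
    unfolding tuple_def by (rule rep_mult[OF polys[OF polynomial_fun_coord] polys[OF polynomial_fun_coord], symmetric])
  also have "\<dots> = \<pi> (\<lambda>z. on_ball (\<lambda>z. z $ j) z * on_ball (\<lambda>z. z $ i) z)" by (simp add: mult.commute)
  also have "\<dots> = tuple j ** tuple i"
    unfolding tuple_def by (rule rep_mult[OF polys[OF polynomial_fun_coord] polys[OF polynomial_fun_coord]])
  finally show "tuple i ** tuple j = tuple j ** tuple i" .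
qed

lemma poly: "\<pi> (poly_on_ball p) = poly_mat p tuple"
  using calculus[OF poly_calculus_poly[OF tuple_commuting]] unfolding on_ball_poly_eval .

lemma eq_tuple_if_represents: "represents T \<pi> \<Longrightarrow> T = tuple"
proof
  fix i assume T: "represents T \<pi>"
  let ?p = "Poly_Mapping.single (Poly_Mapping.single i 1) 1 :: 'd cpoly"
  have "T i = poly_mat ?p T" using T poly_mat_coord unfolding represents_def by metis
  also have "\<dots> = \<pi> (poly_on_ball ?p)" using T unfolding represents_def by simp
  also have "\<dots> = tuple i" unfolding tuple_def on_ball_poly_eval[symmetric] poly_eval_coord ..
  finally show "T i = tuple i" .
qed

lemma norm_bounded: "\<exists>C\<ge>0. \<forall>f\<in>A. norm (\<pi> f) \<le> C * \<bar>\<nu> f\<bar>"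
proof -
  obtain C where C: "\<And>f. f \<in> A \<Longrightarrow> op_norm (\<pi> f) \<le> C * \<nu> f" using bounded by blast
  have "norm (\<pi> f) \<le> ((real CARD('n))\<^sup>2 * \<bar>C\<bar>) * \<bar>\<nu> f\<bar>" if "f \<in> A" for f
  proof -
    have "norm (\<pi> f) \<le> (real CARD('n))\<^sup>2 * op_norm (\<pi> f)" by (rule norm_le_op_norm)
    also have "\<dots> \<le> (real CARD('n))\<^sup>2 * (\<bar>C\<bar> * \<bar>\<nu> f\<bar>)"
      using C[OF that] abs_ge_self[of "C * \<nu> f"] by (intro mult_left_mono) (auto simp: abs_mult)
    finally show ?thesis by (simp add: mult.assoc)
  qed
  then show ?thesis by (intro exI[of _ "(real CARD('n))\<^sup>2 * \<bar>C\<bar>"]) simp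
qed

lemma tuple_slow_growth:
  assumes h: "(\<lambda>n. (h n)\<^sup>2 / real n) \<longlonglongrightarrow> 0"
    and \<nu>: "\<And>u n. norm u = 1 \<Longrightarrow> \<bar>\<nu> (on_ball (\<lambda>z. cinner z u ^ n))\<bar> \<le> h n"
  shows "slow_growth tuple"
proof -
  obtain C where C: "\<And>f. f \<in> A \<Longrightarrow> op_norm (\<pi> f) \<le> C * \<nu> f" using bounded by blast
  have "op_norm (mat_power (lin_form tuple u) n) \<le> \<bar>C\<bar> * h n" if u: "norm u = 1" for u n
  proof -
    note c = poly_calculus_mat_power[OF poly_calculus_lin_form[of tuple u], of n]
    have "op_norm (mat_power (lin_form tuple u) n) \<le> C * \<nu> (on_ball (\<lambda>z. cinner z u ^ n))"
      using C[OF polys[OF polynomial_fun_if_calculus[OF c]]] unfolding calculus[OF c] .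
    also have "\<dots> \<le> \<bar>C\<bar> * \<bar>\<nu> (on_ball (\<lambda>z. cinner z u ^ n))\<bar>"
      using abs_ge_self by (metis abs_mult)
    also have "\<dots> \<le> \<bar>C\<bar> * h n" by (intro mult_left_mono \<nu> u) simp
    finally show ?thesis .
  qed
  moreover have "(\<lambda>n. (\<bar>C\<bar> * h n)\<^sup>2 / real n) \<longlonglongrightarrow> 0"
    using tendsto_mult_right_zero[OF h, of "C\<^sup>2"] by (simp add: power_mult_distrib)
  ultimately show ?thesis unfolding slow_growth_def by (intro exI[of _ "\<lambda>n. \<bar>C\<bar> * h n"]) simp
qed

lemma represents_tuple: "slow_growth tuple \<Longrightarrow> represents tuple \<pi>"
  unfolding represents_def
  using tuple_commuting similar_to_row_contraction[OF tuple_commuting] poly by blast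

end

text \<open>
  Both representations are continuous, and the polynomials are dense.
\<close>

lemma rep_eq_if_eq_on_polynomials:
  assumes \<pi>: "ball_rep A \<nu> \<pi>" and \<pi>': "ball_rep A \<nu> \<pi>'"
    and closed: "\<And>f g. f \<in> A \<Longrightarrow> g \<in> A \<Longrightarrow> (\<lambda>z. f z - g z) \<in> A"
    and dense: "\<And>f e. f \<in> A \<Longrightarrow> e > 0 \<Longrightarrow> \<exists>p. polynomial_fun p \<and> \<bar>\<nu> (\<lambda>z. f z - on_ball p z)\<bar> \<le> e"
    and eq: "\<And>p. polynomial_fun p \<Longrightarrow> \<pi> (on_ball p) = \<pi>' (on_ball p)"
  shows "\<pi> = \<pi>'"
proof (rule extensionalityI[of _ A])
  interpret p: ball_rep A \<nu> \<pi> by (rule \<pi>)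
  interpret p': ball_rep A \<nu> \<pi>' by (rule \<pi>')
  show "\<pi> \<in> extensional A" "\<pi>' \<in> extensional A" by (rule p.ext, rule p'.ext)
  fix f assume f: "f \<in> A"
  obtain C where C: "C \<ge> 0" "\<And>f. f \<in> A \<Longrightarrow> norm (\<pi> f) \<le> C * \<bar>\<nu> f\<bar>" using p.norm_bounded by blast
  obtain C' where C': "C' \<ge> 0" "\<And>f. f \<in> A \<Longrightarrow> norm (\<pi>' f) \<le> C' * \<bar>\<nu> f\<bar>" using p'.norm_bounded by blast
  have "norm (\<pi> f - \<pi>' f) \<le> 0 + e" if "e > 0" for e
  proof -
    have "e / (C + C' + 1) > 0" using that C C' by simp
    then obtain q where q: "polynomial_fun q" "\<bar>\<nu> (\<lambda>z. f z - on_ball q z)\<bar> \<le> e / (C + C' + 1)"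
      using dense[OF f] by blast
    have qA: "on_ball q \<in> A" by (rule p.polys[OF q(1)])
    have d: "(\<lambda>z. f z - on_ball q z) \<in> A" by (rule closed[OF f qA])
    have ff: "f = (\<lambda>z. (f z - on_ball q z) + on_ball q z)" by simp
    have "\<pi> f = \<pi> (\<lambda>z. f z - on_ball q z) + \<pi> (on_ball q)" using p.rep_add[OF d qA] ff by simp
    moreover have "\<pi>' f = \<pi>' (\<lambda>z. f z - on_ball q z) + \<pi> (on_ball q)" using p'.rep_add[OF d qA] ff eq[OF q(1)] by simp
    ultimately have "norm (\<pi> f - \<pi>' f) \<le> norm (\<pi> (\<lambda>z. f z - on_ball q z)) + norm (\<pi>' (\<lambda>z. f z - on_ball q z))"
      by (simp add: norm_triangle_ineq4)
    also have "\<dots> \<le> C * \<bar>\<nu> (\<lambda>z. f z - on_ball q z)\<bar> + C' * \<bar>\<nu> (\<lambda>z. f z - on_ball q z)\<bar>"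
      by (intro add_mono C C' d)
    also have "\<dots> = (C + C') * \<bar>\<nu> (\<lambda>z. f z - on_ball q z)\<bar>" by (simp add: distrib_right)
    also have "\<dots> \<le> (C + C') * (e / (C + C' + 1))" using q C C' by (intro mult_left_mono) auto
    also have "\<dots> \<le> e" using that C C' by (simp add: field_simps)
    finally show ?thesis by simp
  qed
  then have "norm (\<pi> f - \<pi>' f) \<le> 0" by (rule field_le_epsilon)
  then show "\<pi> f = \<pi>' f" by simp
qed

locale Da_space =
  fixes a :: real and H :: "(complex ^ 'd \<Rightarrow> complex) set"
    and ip :: "(complex ^ 'd \<Rightarrow> complex) \<Rightarrow> (complex ^ 'd \<Rightarrow> complex) \<Rightarrow> complex"
  assumes a: "a > 0" and is_rkhs: "is_rkhs (unit_ball :: (complex ^ 'd) set) (Da_kernel a) H ip"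
begin

sublocale rkhs unit_ball "Da_kernel a" H ip by unfold_locales (rule is_rkhs)

abbreviation A_Da :: "(complex ^ 'd \<Rightarrow> complex) set" where "A_Da \<equiv> poly_closure H ip"

lemma polynomial_multiplier: "polynomial_fun f \<Longrightarrow> on_ball f \<in> M"
proof (induction rule: polynomial_fun_induct)
  case (const c)
  have "on_ball (\<lambda>z :: complex ^ 'd. c) = (\<lambda>z. c * (if z \<in> unit_ball then cinner z (axis undefined 1) ^ 0 else 0))"
    unfolding on_ball_def by auto
  moreover have "norm (axis undefined 1 :: complex ^ 'd) = 1"
    by (simp add: norm_vec_def L2_set_def axis_def if_distrib[of "\<lambda>y. (norm y)\<^sup>2"] cong: if_cong)
  ultimately show ?case
    using multiplier_scale(1)[OF linear_form_power_multiplier(1)[OF is_rkhs a, of "axis undefined 1" 0], of c] by simp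
next
  case (coord i)
  have n: "norm (axis i 1 :: complex ^ 'd) = 1"
    by (simp add: norm_vec_def L2_set_def axis_def if_distrib[of "\<lambda>y. (norm y)\<^sup>2"] cong: if_cong)
  have c: "cinner z (axis i 1) = z $ i" for z :: "complex ^ 'd"
    unfolding cinner_def by (simp add: axis_def if_distrib[of cnj] if_distrib[of "\<lambda>y. _ * y"] cong: if_cong)
  have eq: "on_ball (\<lambda>z :: complex ^ 'd. z $ i) = (\<lambda>z. if z \<in> unit_ball then cinner z (axis i 1) ^ 1 else 0)"
    unfolding on_ball_def power_one_right c ..
  show ?case unfolding eq by (rule linear_form_power_multiplier(1)[OF is_rkhs a n])
next
  case (add f g)
  have "on_ball (\<lambda>z. f z + g z) = (\<lambda>z. on_ball f z + on_ball g z)" unfolding on_ball_def by auto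
  then show ?case using multiplier_add(1)[OF add] by simp
next
  case (mult f g)
  have "on_ball (\<lambda>z. f z * g z) = (\<lambda>z. on_ball f z * on_ball g z)" unfolding on_ball_def by auto
  then show ?case using multiplier_mult(1)[OF mult] by simp
qed

lemma mem_A_Da_iff: "f \<in> A_Da \<longleftrightarrow> f \<in> M \<and> (\<forall>e>0. \<exists>p. polynomial_fun p \<and> mnorm (\<lambda>z. f z - on_ball p z) < e)"
  unfolding poly_closure_def mem_Collect_eq polynomial_fun_def
  using polynomial_multiplier unfolding polynomial_fun_def on_ball_poly_eval[symmetric] by blast

lemma A_Da_multiplier: "f \<in> A_Da \<Longrightarrow> f \<in> M"
  unfolding mem_A_Da_iff by blast

lemma A_Da_approx: "f \<in> A_Da \<Longrightarrow> e > 0 \<Longrightarrow> \<exists>p. polynomial_fun p \<and> mnorm (\<lambda>z. f z - on_ball p z) < e"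
  unfolding mem_A_Da_iff by blast

lemma mult_norm_zero: "mnorm (\<lambda>z. 0) \<le> 0"
  using ip_zero_left[OF zero_mem] nrm_nonneg by (intro mult_norm_le) (simp_all add: ip_norm_def)

lemma polynomial_mem_A_Da: "polynomial_fun f \<Longrightarrow> on_ball f \<in> A_Da"
  unfolding mem_A_Da_iff
proof (intro conjI allI impI)
  fix e :: real assume f: "polynomial_fun f" and "e > 0"
  then have "mnorm (\<lambda>z. on_ball f z - on_ball f z) < e" using mult_norm_zero by simp
  then show "\<exists>p. polynomial_fun p \<and> mnorm (\<lambda>z. on_ball f z - on_ball p z) < e" using f by blast
qed (rule polynomial_multiplier)

lemma A_Da_add:
  assumes f: "f \<in> A_Da" and g: "g \<in> A_Da" shows "(\<lambda>z. f z + g z) \<in> A_Da"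
  unfolding mem_A_Da_iff
proof (intro conjI allI impI)
  show "(\<lambda>z. f z + g z) \<in> M" by (intro multiplier_add A_Da_multiplier f g)
  fix e :: real assume "e > 0"
  then have e2: "e / 2 > 0" by simp
  obtain p q where p: "polynomial_fun p" "mnorm (\<lambda>z. f z - on_ball p z) < e / 2"
    and q: "polynomial_fun q" "mnorm (\<lambda>z. g z - on_ball q z) < e / 2"
    using A_Da_approx[OF f e2] A_Da_approx[OF g e2] by blast
  have "(\<lambda>z. (f z + g z) - on_ball (\<lambda>z. p z + q z) z) = (\<lambda>z. (f z - on_ball p z) + (g z - on_ball q z))"
    unfolding on_ball_def by auto
  then have "mnorm (\<lambda>z. (f z + g z) - on_ball (\<lambda>z. p z + q z) z)
      \<le> mnorm (\<lambda>z. f z - on_ball p z) + mnorm (\<lambda>z. g z - on_ball q z)"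
    using multiplier_add(2)[OF multiplier_diff[OF A_Da_multiplier[OF f] polynomial_multiplier[OF p(1)]]
        multiplier_diff[OF A_Da_multiplier[OF g] polynomial_multiplier[OF q(1)]]] by simp
  then have "mnorm (\<lambda>z. (f z + g z) - on_ball (\<lambda>z. p z + q z) z) < e" using p q by linarith
  then show "\<exists>r. polynomial_fun r \<and> mnorm (\<lambda>z. f z + g z - on_ball r z) < e"
    using polynomial_fun_add[OF p(1) q(1)] by blast
qed

lemma A_Da_mult:
  assumes f: "f \<in> A_Da" and g: "g \<in> A_Da" shows "(\<lambda>z. f z * g z) \<in> A_Da"
  unfolding mem_A_Da_iff
proof (intro conjI allI impI)
  note fM = A_Da_multiplier[OF f] and gM = A_Da_multiplier[OF g]
  show "(\<lambda>z. f z * g z) \<in> M" by (rule multiplier_mult(1)[OF fM gM])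
  fix e :: real assume e: "e > 0"
  \<comment> \<open>The bound \<open>\<parallel>f g - p q\<parallel> \<le> \<parallel>f - p\<parallel> \<parallel>g\<parallel> + \<parallel>p\<parallel> \<parallel>g - q\<parallel>\<close> with \<open>\<parallel>p\<parallel> \<le> \<parallel>f\<parallel> + 1\<close> determines this constant.\<close>
  define K where "K = mnorm f + mnorm g + 2"
  have K: "K > 0" using mult_norm_nonneg[OF fM] mult_norm_nonneg[OF gM] unfolding K_def by simp
  define d where "d = min 1 (e / K)"
  have d: "d > 0" "d \<le> 1" "d * K \<le> e" using e K unfolding d_def by (auto simp: min_def field_simps)
  obtain p q where p: "polynomial_fun p" "mnorm (\<lambda>z. f z - on_ball p z) < d"
    and q: "polynomial_fun q" "mnorm (\<lambda>z. g z - on_ball q z) < d"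
    using A_Da_approx[OF f d(1)] A_Da_approx[OF g d(1)] by blast
  note pM = polynomial_multiplier[OF p(1)] and qM = polynomial_multiplier[OF q(1)]
  note fp = multiplier_diff[OF fM pM] and gq = multiplier_diff[OF gM qM]
  have "on_ball p = (\<lambda>z. f z + (-1) * (f z - on_ball p z))" by auto
  then have "mnorm (on_ball p) \<le> mnorm f + mnorm (\<lambda>z. (-1) * (f z - on_ball p z))"
    using multiplier_add(2)[OF fM multiplier_scale(1)[OF fp, of "-1"]] by simp
  also have "\<dots> \<le> mnorm f + 1" using multiplier_scale(2)[OF fp, of "-1"] p d by simp
  finally have pn: "mnorm (on_ball p) \<le> mnorm f + 1" .
  have "(\<lambda>z. f z * g z - on_ball (\<lambda>z. p z * q z) z)
     = (\<lambda>z. (f z - on_ball p z) * g z + on_ball p z * (g z - on_ball q z))"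
    unfolding on_ball_def by (auto simp: algebra_simps)
  then have "mnorm (\<lambda>z. f z * g z - on_ball (\<lambda>z. p z * q z) z)
      \<le> mnorm (\<lambda>z. (f z - on_ball p z) * g z) + mnorm (\<lambda>z. on_ball p z * (g z - on_ball q z))"
    using multiplier_add(2)[OF multiplier_mult(1)[OF fp gM] multiplier_mult(1)[OF pM gq]] by simp
  also have "\<dots> \<le> mnorm (\<lambda>z. f z - on_ball p z) * mnorm g + mnorm (on_ball p) * mnorm (\<lambda>z. g z - on_ball q z)"
    by (intro add_mono multiplier_mult fp gM pM gq)
  also have "\<dots> \<le> d * mnorm g + (mnorm f + 1) * d"
    using p q pn mult_norm_nonneg[OF gM] mult_norm_nonneg[OF pM] mult_norm_nonneg[OF gq] d
    by (intro add_mono mult_mono) auto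
  also have "\<dots> < d * K" using d(1) unfolding K_def by (simp add: algebra_simps)
  finally have "mnorm (\<lambda>z. f z * g z - on_ball (\<lambda>z. p z * q z) z) < e" using d(3) by linarith
  then show "\<exists>r. polynomial_fun r \<and> mnorm (\<lambda>z. f z * g z - on_ball r z) < e"
    using polynomial_fun_mult[OF p(1) q(1)] by blast
qed

lemma A_Da_functions_on: "f \<in> A_Da \<Longrightarrow> f \<in> functions_on unit_ball"
  using A_Da_multiplier unfolding multipliers_def by blast

lemma A_Da_scale: "f \<in> A_Da \<Longrightarrow> (\<lambda>z. c * f z) \<in> A_Da"
proof -
  assume f: "f \<in> A_Da"
  have "(\<lambda>z. c * f z) = (\<lambda>z. on_ball (\<lambda>z. c) z * f z)"
    using A_Da_functions_on[OF f] unfolding functions_on_def on_ball_def by (auto simp: fun_eq_iff)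
  then show ?thesis using A_Da_mult[OF polynomial_mem_A_Da[OF polynomial_fun_const] f] by simp
qed

lemma cmod_le_mult_norm: "f \<in> M \<Longrightarrow> z \<in> unit_ball \<Longrightarrow> cmod (f z) \<le> mnorm f"
  by (rule sup_le_mult_norm[OF _ _ Da_kernel_diag_nonzero])

lemma A_Da_subset_ball_algebra: "A_Da \<subseteq> ball_algebra"
proof
  fix f assume f: "f \<in> A_Da"
  show "f \<in> ball_algebra"
  proof (rule uniform_limit_of_polynomials_mem_ball_algebra[OF A_Da_functions_on[OF f]])
    fix e :: real assume "e > 0"
    then obtain p where p: "polynomial_fun p" "mnorm (\<lambda>z. f z - on_ball p z) < e" using A_Da_approx[OF f] by blast
    have "cmod (f z - p z) \<le> e" if z: "z \<in> unit_ball" for z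
      using cmod_le_mult_norm[OF multiplier_diff[OF A_Da_multiplier[OF f] polynomial_multiplier[OF p(1)]] z] p(2) z
      by (simp add: on_ball_def)
    then show "\<exists>p. polynomial_fun p \<and> (\<forall>z\<in>unit_ball. cmod (f z - p z) \<le> e)" using p(1) by blast
  qed
qed

lemma ball_sup_norm_le_mult_norm: "f \<in> A_Da \<Longrightarrow> ball_sup_norm f \<le> mnorm f"
  by (intro ball_sup_norm_le cmod_le_mult_norm A_Da_multiplier)

lemma linear_form_power_norm:
  assumes "norm u = 1"
  shows "\<bar>mnorm (on_ball (\<lambda>z. cinner z u ^ n))\<bar> \<le> sqrt (growth a n)"
  using linear_form_power_multiplier[OF is_rkhs a assms, of n] mult_norm_nonneg
  unfolding on_ball_def by simp

end

section \<open>Extension of representations to the ball algebra\<close>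

text \<open>
  The closure of the pairs \<open>(f, f(T))\<close>, with uniform convergence on the ball for the functions. The bounded
  calculus makes it the graph of a map on the ball algebra.
\<close>

definition calculus_limit ::
  "('d::finite \<Rightarrow> complex ^ 'n ^ 'n) \<Rightarrow> (complex ^ 'd \<Rightarrow> complex) \<Rightarrow> complex ^ 'n ^ 'n \<Rightarrow> bool" where
  "calculus_limit T f A \<longleftrightarrow> (\<exists>g G. (\<forall>k. poly_calculus T (g k) (G k)) \<and>
     uniform_limit unit_ball g f sequentially \<and> G \<longlonglongrightarrow> A)"

lemma calculus_limitI:
  assumes "\<And>k. poly_calculus T (g k) (G k)" "uniform_limit unit_ball g f sequentially" "G \<longlonglongrightarrow> A"
  shows "calculus_limit T f A"
  unfolding calculus_limit_def using assms by (intro exI[of _ g] exI[of _ G]) simp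

lemma calculus_limit_poly: "poly_calculus T f A \<Longrightarrow> calculus_limit T (on_ball f) A"
  unfolding calculus_limit_def
  by (intro exI[of _ "\<lambda>_. f"] exI[of _ "\<lambda>_. A"]) (auto simp: on_ball_def intro!: uniform_limitI)

lemma calculus_limit_add:
  assumes "calculus_limit T f A" "calculus_limit T g B"
  shows "calculus_limit T (\<lambda>z. f z + g z) (A + B)"
proof -
  obtain p P where p: "\<And>k. poly_calculus T (p k) (P k)" "uniform_limit unit_ball p f sequentially" "P \<longlonglongrightarrow> A"
    using assms(1) unfolding calculus_limit_def by blast
  obtain q Q where q: "\<And>k. poly_calculus T (q k) (Q k)" "uniform_limit unit_ball q g sequentially" "Q \<longlonglongrightarrow> B"
    using assms(2) unfolding calculus_limit_def by blast
  show ?thesis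
    by (rule calculus_limitI[OF _ uniform_limit_add[OF p(2) q(2)] tendsto_add[OF p(3) q(3)]])
      (rule poly_calculus.add[OF p(1) q(1)])
qed

lemma calculus_limit_mult:
  assumes "calculus_limit T f A" "calculus_limit T g B" and f: "f \<in> ball_algebra" and g: "g \<in> ball_algebra"
  shows "calculus_limit T (\<lambda>z. f z * g z) (A ** B)"
proof -
  obtain p P where p: "\<And>k. poly_calculus T (p k) (P k)" "uniform_limit unit_ball p f sequentially" "P \<longlonglongrightarrow> A"
    using assms(1) unfolding calculus_limit_def by blast
  obtain q Q where q: "\<And>k. poly_calculus T (q k) (Q k)" "uniform_limit unit_ball q g sequentially" "Q \<longlonglongrightarrow> B"
    using assms(2) unfolding calculus_limit_def by blast
  have bdd: "bounded (h ` unit_ball)" if "h \<in> ball_algebra" for h :: "complex ^ 'a \<Rightarrow> complex"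
    unfolding bounded_iff using cmod_le_ball_sup_norm[OF that] by blast
  show ?thesis
    by (rule calculus_limitI[OF _ uniform_lim_mult[OF p(2) q(2) bdd[OF f] bdd[OF g]]
          tendsto_matrix_mult[OF p(3) q(3)]]) (rule poly_calculus.mult[OF p(1) q(1)])
qed

lemma uniform_limit_boundD:
  assumes "uniform_limit S g f sequentially" and "\<And>z. z \<in> S \<Longrightarrow> cmod (f z) \<le> B" and "e > 0"
  shows "\<forall>\<^sub>F k in sequentially. \<forall>z\<in>S. cmod (g k z) \<le> B + e"
  using uniform_limitD[OF assms(1,3)]
proof (rule eventually_mono)
  fix k assume k: "\<forall>z\<in>S. dist (g k z) (f z) < e"
  show "\<forall>z\<in>S. cmod (g k z) \<le> B + e"
  proof
    fix z assume z: "z \<in> S"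
    have "cmod (g k z) \<le> cmod (f z) + dist (g k z) (f z)" unfolding dist_norm by norm
    then show "cmod (g k z) \<le> B + e" using assms(2)[OF z] k z by force
  qed
qed

locale bounded_tuple =
  fixes T :: "'d::finite \<Rightarrow> complex ^ 'n ^ 'n"
  assumes comm: "commuting_tuple T" and slow: "slow_growth T"
begin

lemma calculus_limit_bound:
  obtains C where "C \<ge> 0" and "\<And>f A B. calculus_limit T f A \<Longrightarrow> (\<And>z. z \<in> unit_ball \<Longrightarrow> cmod (f z) \<le> B) \<Longrightarrow> op_norm A \<le> C * B"
proof -
  obtain C where C: "C \<ge> 0"
    "\<And>f A B. poly_calculus T f A \<Longrightarrow> (\<forall>z\<in>unit_ball. cmod (f z) \<le> B) \<Longrightarrow> op_norm A \<le> C * B"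
    using bounded_calculus[OF comm slow] by blast
  have "op_norm A \<le> C * B" if f: "calculus_limit T f A" and B: "\<And>z. z \<in> unit_ball \<Longrightarrow> cmod (f z) \<le> B" for f A B
    unfolding op_norm_def
  proof (rule onorm_le)
    fix v :: "complex ^ 'n"
    obtain g G where g: "\<And>k. poly_calculus T (g k) (G k)" "uniform_limit unit_ball g f sequentially" "G \<longlonglongrightarrow> A"
      using f unfolding calculus_limit_def by blast
    have "norm (A *v v) \<le> C * B * norm v + e" if e: "e > 0" for e
    proof -
      define d where "d = e / (C * norm v + 1)"
      have pos: "C * norm v + 1 > 0" using C(1) by (simp add: add_nonneg_pos)
      have d: "d > 0" "C * d * norm v \<le> e" using e pos C(1) unfolding d_def by (auto simp: field_simps)
      have "norm (A *v v) \<le> C * (B + d) * norm v"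
      proof (rule tendsto_upperbound[OF tendsto_norm[OF tendsto_matrix_vector[OF g(3)]]])
        show "\<forall>\<^sub>F k in sequentially. norm (G k *v v) \<le> C * (B + d) * norm v"
          using uniform_limit_boundD[OF g(2) B d(1)]
        proof (rule eventually_mono)
          fix k assume "\<forall>z\<in>unit_ball. cmod (g k z) \<le> B + d"
          then have "op_norm (G k) \<le> C * (B + d)" by (rule C(2)[OF g(1)])
          then show "norm (G k *v v) \<le> C * (B + d) * norm v"
            by (intro order_trans[OF norm_mat_vec_le] mult_right_mono) simp_all
        qed
      qed simp
      then show ?thesis using d(2) by (simp add: distrib_left distrib_right)
    qed
    then show "norm (A *v v) \<le> C * B * norm v" by (rule field_le_epsilon)
  qed
  then show thesis using that C(1) by blast
qed

lemma calculus_limit_unique: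
  assumes "calculus_limit T f A" "calculus_limit T f B" shows "A = B"
proof -
  obtain C where C: "\<And>f A B. calculus_limit T f A \<Longrightarrow> (\<And>z. z \<in> unit_ball \<Longrightarrow> cmod (f z) \<le> B) \<Longrightarrow> op_norm A \<le> C * B"
    using calculus_limit_bound by metis
  obtain p P where p: "\<And>k. poly_calculus T (p k) (P k)" "uniform_limit unit_ball p f sequentially" "P \<longlonglongrightarrow> A"
    using assms(1) unfolding calculus_limit_def by blast
  obtain q Q where q: "\<And>k. poly_calculus T (q k) (Q k)" "uniform_limit unit_ball q f sequentially" "Q \<longlonglongrightarrow> B"
    using assms(2) unfolding calculus_limit_def by blast
  have "poly_calculus T (\<lambda>z. p k z + (-1) * q k z) (P k + mat (-1) ** Q k)" for k
    by (intro poly_calculus.add poly_calculus.mult poly_calculus.const p q)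
  then have pq: "poly_calculus T (\<lambda>z. p k z - q k z) (P k + mat (-1) ** Q k)" for k by simp
  have lim: "(\<lambda>k. P k + mat (-1) ** Q k) \<longlonglongrightarrow> A + mat (-1) ** B"
    by (intro tendsto_add tendsto_matrix_mult tendsto_const p q)
  have "calculus_limit T (\<lambda>z. f z - f z) (A + mat (-1) ** B)"
    by (rule calculus_limitI[OF pq uniform_limit_minus[OF p(2) q(2)] lim])
  then have "op_norm (A + mat (-1) ** B) \<le> C * 0" by (rule C) simp
  then have "(real CARD('n))\<^sup>2 * op_norm (A + mat (-1) ** B) \<le> (real CARD('n))\<^sup>2 * 0"
    by (intro mult_left_mono) simp_all
  then have "norm (A + mat (-1) ** B) \<le> 0"
    unfolding mult_zero_right by (rule order_trans[OF norm_le_op_norm])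
  then have "A + mat (-1) ** B = 0" by simp
  moreover have "mat (-1) ** B = - B" by (simp add: vec_eq_iff mat_mult_component)
  ultimately show ?thesis by simp
qed

lemma calculus_limit_exists:
  assumes f: "f \<in> ball_algebra" shows "\<exists>A. calculus_limit T f A"
proof -
  obtain C where C: "C \<ge> 0"
    "\<And>f A B. poly_calculus T f A \<Longrightarrow> (\<forall>z\<in>unit_ball. cmod (f z) \<le> B) \<Longrightarrow> op_norm A \<le> C * B"
    using bounded_calculus[OF comm slow] by blast
  have "\<exists>p. polynomial_fun p \<and> (\<forall>z\<in>unit_ball. cmod (f z - p z) \<le> 1 / real (Suc k))" for k
    by (rule polynomials_dense_in_ball_algebra[OF f]) simp
  then obtain p where p: "\<And>k. polynomial_fun (p k)" "\<And>k z. z \<in> unit_ball \<Longrightarrow> cmod (f z - p k z) \<le> 1 / real (Suc k)" by metis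
  obtain P where P: "\<And>k. poly_calculus T (p k) (P k)"
    using poly_calculus_if_polynomial_fun[OF p(1) comm] by metis
  define D where "D = (real CARD('n))\<^sup>2 * C"
  have D: "D \<ge> 0" unfolding D_def using C(1) by simp
  have neg: "mat (-1) ** B = - B" for B :: "complex ^ 'n ^ 'n" by (simp add: vec_eq_iff mat_mult_component)
  have diff: "norm (P k - P l) \<le> D * (1 / real (Suc k) + 1 / real (Suc l))" for k l
  proof -
    have "poly_calculus T (\<lambda>z. p k z + (-1) * p l z) (P k + mat (-1) ** P l)"
      by (intro poly_calculus.add poly_calculus.mult poly_calculus.const P)
    then have "poly_calculus T (\<lambda>z. p k z - p l z) (P k - P l)" by (simp add: neg)
    moreover have "\<forall>z\<in>unit_ball. cmod (p k z - p l z) \<le> 1 / real (Suc k) + 1 / real (Suc l)"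
    proof
      fix z assume z: "z \<in> (unit_ball :: (complex ^ 'd) set)"
      have "cmod (p k z - p l z) \<le> cmod (f z - p k z) + cmod (f z - p l z)" by norm
      then show "cmod (p k z - p l z) \<le> 1 / real (Suc k) + 1 / real (Suc l)"
        using p(2)[OF z, of k] p(2)[OF z, of l] by linarith
    qed
    ultimately have "op_norm (P k - P l) \<le> C * (1 / real (Suc k) + 1 / real (Suc l))" by (rule C(2))
    then have "(real CARD('n))\<^sup>2 * op_norm (P k - P l) \<le> (real CARD('n))\<^sup>2 * (C * (1 / real (Suc k) + 1 / real (Suc l)))"
      by (rule mult_left_mono) simp
    then show ?thesis using norm_le_op_norm[of "P k - P l"] unfolding D_def mult.assoc by linarith
  qed
  have "Cauchy P" by (rule Cauchy_if_diff_le_inverse[OF D diff])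
  then obtain A where A: "P \<longlonglongrightarrow> A" using Cauchy_convergent convergent_def by blast
  have "uniform_limit unit_ball p f sequentially" by (rule uniform_limit_if_le_inverse) (rule p(2))
  then show ?thesis using calculus_limitI[where g = p and G = P, OF P _ A] by blast
qed

definition extension :: "(complex ^ 'd \<Rightarrow> complex) \<Rightarrow> complex ^ 'n ^ 'n" where
  "extension = restrict (\<lambda>f. THE A. calculus_limit T f A) ball_algebra"

lemma extension_eq: "f \<in> ball_algebra \<Longrightarrow> calculus_limit T f A \<Longrightarrow> extension f = A"
  unfolding extension_def using calculus_limit_unique by (simp add: the_equality)

lemma extension_limit: "f \<in> ball_algebra \<Longrightarrow> calculus_limit T f (extension f)"
  using calculus_limit_exists extension_eq by metis

lemma extension_rep: "extension \<in> bounded_unital_reps ball_algebra ball_sup_norm"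
  unfolding bounded_unital_reps_def mem_Collect_eq
proof (intro conjI ballI allI)
  show "extension \<in> extensional ball_algebra" unfolding extension_def by simp
  fix f g :: "complex ^ 'd \<Rightarrow> complex" assume f: "f \<in> ball_algebra" and g: "g \<in> ball_algebra"
  show "extension (\<lambda>z. f z + g z) = extension f + extension g"
    by (intro extension_eq ball_algebra_add calculus_limit_add extension_limit f g)
  show "extension (\<lambda>z. f z * g z) = extension f ** extension g"
    by (intro extension_eq ball_algebra_mult calculus_limit_mult extension_limit f g)
next
  fix f :: "complex ^ 'd \<Rightarrow> complex" and c assume f: "f \<in> ball_algebra"
  have eq: "(\<lambda>z. c * f z) = (\<lambda>z. on_ball (\<lambda>z. c) z * f z)"
    using f unfolding ball_algebra_def functions_on_def on_ball_def by (auto simp: fun_eq_iff)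
  show "extension (\<lambda>z. c * f z) = mat c ** extension f"
    unfolding eq
    by (intro extension_eq ball_algebra_mult calculus_limit_mult extension_limit f
        polynomial_on_ball_mem_ball_algebra polynomial_fun_const calculus_limit_poly poly_calculus.const)
next
  show "extension (one_on unit_ball) = mat 1"
    unfolding on_ball_one[symmetric]
    by (intro extension_eq polynomial_on_ball_mem_ball_algebra polynomial_fun_const calculus_limit_poly poly_calculus.const)
next
  obtain C where C: "\<And>f A B. calculus_limit T f A \<Longrightarrow> (\<And>z. z \<in> unit_ball \<Longrightarrow> cmod (f z) \<le> B) \<Longrightarrow> op_norm A \<le> C * B"
    using calculus_limit_bound by metis
  have "op_norm (extension f) \<le> C * ball_sup_norm f" if "f \<in> ball_algebra" for f
    by (rule C[OF extension_limit[OF that] cmod_le_ball_sup_norm[OF that]])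
  then show "\<exists>C. \<forall>f\<in>ball_algebra. op_norm (extension f) \<le> C * ball_sup_norm f" by blast
qed

end

lemma ball_algebra_rep:
  "\<sigma> \<in> bounded_unital_reps ball_algebra ball_sup_norm \<Longrightarrow> ball_rep ball_algebra ball_sup_norm \<sigma>"
  by unfold_locales (rule polynomial_on_ball_mem_ball_algebra)

lemma ball_sup_norm_nonneg: "f \<in> ball_algebra \<Longrightarrow> 0 \<le> ball_sup_norm f"
  using cmod_le_ball_sup_norm[OF _ zero_mem_unit_ball] norm_ge_zero order_trans by blast

lemma ball_algebra_diff: "f \<in> ball_algebra \<Longrightarrow> g \<in> ball_algebra \<Longrightarrow> (\<lambda>z. f z - g z) \<in> ball_algebra"
  using ball_algebra_add[OF _ ball_algebra_scale, of f g "-1"] by simp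

lemma ball_algebra_rep_slow_growth:
  assumes \<sigma>: "\<sigma> \<in> bounded_unital_reps ball_algebra ball_sup_norm"
  shows "slow_growth (ball_rep.tuple \<sigma>)"
proof -
  interpret ball_rep ball_algebra ball_sup_norm \<sigma> by (rule ball_algebra_rep[OF \<sigma>])
  show ?thesis
  proof (rule tuple_slow_growth[where h = "\<lambda>_. 1"])
    show "(\<lambda>n. 1\<^sup>2 / real n) \<longlonglongrightarrow> 0" using lim_const_over_n[of 1] by simp
    fix u :: "complex ^ 'a" and n assume u: "norm u = 1"
    have "polynomial_fun (\<lambda>z. cinner z u ^ n)"
      unfolding cinner_def
      by (intro polynomial_fun_power polynomial_fun_sum polynomial_fun_mult polynomial_fun_coord polynomial_fun_const finite)
    then have mem: "on_ball (\<lambda>z. cinner z u ^ n) \<in> ball_algebra" by (rule polynomial_on_ball_mem_ball_algebra)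
    have "ball_sup_norm (on_ball (\<lambda>z. cinner z u ^ n)) \<le> 1"
    proof (rule ball_sup_norm_le)
      fix z :: "complex ^ 'a" assume z: "z \<in> unit_ball"
      have "cmod (cinner z u) \<le> 1" using cinner_cmod_le[of z u] z u by (simp add: unit_ball_def)
      then show "cmod (on_ball (\<lambda>z. cinner z u ^ n) z) \<le> 1"
        using z by (simp add: on_ball_def norm_power power_le_one)
    qed
    then show "\<bar>ball_sup_norm (on_ball (\<lambda>z. cinner z u ^ n))\<bar> \<le> 1" using ball_sup_norm_nonneg[OF mem] by simp
  qed
qed

lemma ball_algebra_rep_eqI:
  assumes \<sigma>: "\<sigma> \<in> bounded_unital_reps ball_algebra ball_sup_norm"
    and \<sigma>': "\<sigma>' \<in> bounded_unital_reps ball_algebra ball_sup_norm"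
    and eq: "\<And>p. \<sigma> (poly_on_ball p) = \<sigma>' (poly_on_ball p)"
  shows "\<sigma> = \<sigma>'"
proof (rule rep_eq_if_eq_on_polynomials[OF ball_algebra_rep[OF \<sigma>] ball_algebra_rep[OF \<sigma>'] ball_algebra_diff])
  show "\<exists>p. polynomial_fun p \<and> \<bar>ball_sup_norm (\<lambda>z. f z - on_ball p z)\<bar> \<le> e" if f: "f \<in> ball_algebra" and e: "e > 0" for f e
  proof -
    obtain p where p: "polynomial_fun p" "\<And>z. z \<in> unit_ball \<Longrightarrow> cmod (f z - p z) \<le> e"
      using polynomials_dense_in_ball_algebra[OF f e] by blast
    have "ball_sup_norm (\<lambda>z. f z - on_ball p z) \<le> e"
      by (rule ball_sup_norm_le) (use p(2) in \<open>simp add: on_ball_def\<close>)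
    then show ?thesis
      using p(1) ball_sup_norm_nonneg[OF ball_algebra_diff[OF f polynomial_on_ball_mem_ball_algebra[OF p(1)]]] by auto
  qed
  show "\<sigma> (on_ball p) = \<sigma>' (on_ball p)" if "polynomial_fun p" for p
    using that eq unfolding polynomial_fun_def by (auto simp: on_ball_poly_eval)
qed

context Da_space begin

lemma A_Da_rep: "\<pi> \<in> bounded_unital_reps A_Da mnorm \<Longrightarrow> ball_rep A_Da mnorm \<pi>"
  by unfold_locales (rule polynomial_mem_A_Da)

lemma A_Da_diff: "f \<in> A_Da \<Longrightarrow> g \<in> A_Da \<Longrightarrow> (\<lambda>z. f z - g z) \<in> A_Da"
  using A_Da_add[OF _ A_Da_scale, of f g "-1"] by simp

lemma A_Da_rep_slow_growth:
  assumes \<pi>: "\<pi> \<in> bounded_unital_reps A_Da mnorm"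
  shows "slow_growth (ball_rep.tuple \<pi>)"
proof -
  interpret ball_rep A_Da mnorm \<pi> by (rule A_Da_rep[OF \<pi>])
  show ?thesis
  proof (rule tuple_slow_growth[where h = "\<lambda>n. sqrt (growth a n)"])
    show "(\<lambda>n. (sqrt (growth a n))\<^sup>2 / real n) \<longlonglongrightarrow> 0"
      using growth_little_o[OF a] growth_nonneg[OF a] by simp
  qed (rule linear_form_power_norm)
qed

lemma A_Da_rep_eqI:
  assumes \<pi>: "\<pi> \<in> bounded_unital_reps A_Da mnorm" and \<pi>': "\<pi>' \<in> bounded_unital_reps A_Da mnorm"
    and eq: "\<And>p. \<pi> (poly_on_ball p) = \<pi>' (poly_on_ball p)"
  shows "\<pi> = \<pi>'"
proof (rule rep_eq_if_eq_on_polynomials[OF A_Da_rep[OF \<pi>] A_Da_rep[OF \<pi>'] A_Da_diff])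
  show "\<exists>p. polynomial_fun p \<and> \<bar>mnorm (\<lambda>z. f z - on_ball p z)\<bar> \<le> e" if f: "f \<in> A_Da" and e: "e > 0" for f e
  proof -
    obtain p where p: "polynomial_fun p" "mnorm (\<lambda>z. f z - on_ball p z) < e" using A_Da_approx[OF f e] by blast
    then show ?thesis
      using mult_norm_nonneg[OF multiplier_diff[OF A_Da_multiplier[OF f] polynomial_multiplier[OF p(1)]]] by auto
  qed
  show "\<pi> (on_ball p) = \<pi>' (on_ball p)" if "polynomial_fun p" for p
    using that eq unfolding polynomial_fun_def by (auto simp: on_ball_poly_eval)
qed

lemma restrict_rep:
  assumes \<sigma>: "\<sigma> \<in> bounded_unital_reps ball_algebra ball_sup_norm"
  shows "restrict \<sigma> A_Da \<in> bounded_unital_reps A_Da mnorm"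
proof -
  interpret s: ball_rep ball_algebra ball_sup_norm \<sigma> by (rule ball_algebra_rep[OF \<sigma>])
  have sub: "f \<in> ball_algebra" if "f \<in> A_Da" for f using that A_Da_subset_ball_algebra by blast
  have one: "one_on unit_ball \<in> A_Da" using polynomial_mem_A_Da[OF polynomial_fun_const] by (simp add: on_ball_one[symmetric])
  obtain C where C: "\<And>f. f \<in> ball_algebra \<Longrightarrow> op_norm (\<sigma> f) \<le> C * ball_sup_norm f" using s.bounded by blast
  have "op_norm (\<sigma> f) \<le> \<bar>C\<bar> * mnorm f" if f: "f \<in> A_Da" for f
  proof -
    have "op_norm (\<sigma> f) \<le> C * ball_sup_norm f" by (rule C[OF sub[OF f]])
    also have "\<dots> \<le> \<bar>C\<bar> * ball_sup_norm f" using ball_sup_norm_nonneg[OF sub[OF f]] by (intro mult_right_mono) auto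
    also have "\<dots> \<le> \<bar>C\<bar> * mnorm f" by (intro mult_left_mono ball_sup_norm_le_mult_norm f) simp
    finally show ?thesis .
  qed
  then show ?thesis
    unfolding bounded_unital_reps_def
    using one s.rep_one by (auto simp: A_Da_add A_Da_scale A_Da_mult s.rep_add s.rep_scale s.rep_mult sub)
qed

text \<open>
  Polynomials that approximate \<open>f\<close> in the multiplier norm also do so uniformly, hence \<open>\<pi> f\<close> and the extension
  are limits of the same matrices.
\<close>

lemma extension_extends:
  assumes \<pi>: "\<pi> \<in> bounded_unital_reps A_Da mnorm" and f: "f \<in> A_Da"
  shows "bounded_tuple.extension (ball_rep.tuple \<pi>) f = \<pi> f"
proof -
  interpret p: ball_rep A_Da mnorm \<pi> by (rule A_Da_rep[OF \<pi>])
  interpret bounded_tuple p.tuple by unfold_locales (rule p.tuple_commuting A_Da_rep_slow_growth[OF \<pi>])+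
  have "\<exists>q. polynomial_fun q \<and> mnorm (\<lambda>z. f z - on_ball q z) < 1 / real (Suc k)" for k
    by (rule A_Da_approx[OF f]) simp
  then obtain q where q: "\<And>k. polynomial_fun (q k)" "\<And>k. mnorm (\<lambda>z. f z - on_ball (q k) z) < 1 / real (Suc k)" by metis
  note qA = polynomial_mem_A_Da[OF q(1)]
  obtain Q where Q: "\<And>k. poly_calculus p.tuple (q k) (Q k)"
    using poly_calculus_if_polynomial_fun[OF q(1) p.tuple_commuting] by metis
  note inv0 = inverse_Suc_tendsto_zero
  obtain C where C: "C \<ge> 0" "\<And>f. f \<in> A_Da \<Longrightarrow> norm (\<pi> f) \<le> C * \<bar>mnorm f\<bar>" using p.norm_bounded by blast
  have "Q \<longlonglongrightarrow> \<pi> f"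
  proof (rule LIM_zero_cancel, rule Lim_null_comparison)
    show "(\<lambda>k. C * (1 / real (Suc k))) \<longlonglongrightarrow> 0" by (rule tendsto_mult_right_zero[OF inv0])
    have "norm (Q k - \<pi> f) \<le> C * (1 / real (Suc k))" for k
    proof -
      have "\<pi> f = \<pi> (\<lambda>z. f z - on_ball (q k) z) + \<pi> (on_ball (q k))"
        using p.rep_add[OF A_Da_diff[OF f qA] qA, of k k] by simp
      then have "norm (Q k - \<pi> f) = norm (\<pi> (\<lambda>z. f z - on_ball (q k) z))" using p.calculus[OF Q[of k]] by simp
      also have "\<dots> \<le> C * \<bar>mnorm (\<lambda>z. f z - on_ball (q k) z)\<bar>" by (rule C(2)[OF A_Da_diff[OF f qA]])
      also have "\<dots> \<le> C * (1 / real (Suc k))"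
        using q(2)[of k] mult_norm_nonneg[OF A_Da_multiplier[OF A_Da_diff[OF f qA[of k]]]] C(1)
        by (intro mult_left_mono) auto
      finally show ?thesis .
    qed
    then show "\<forall>\<^sub>F k in sequentially. norm (Q k - \<pi> f) \<le> C * (1 / real (Suc k))" by simp
  qed
  moreover have "uniform_limit unit_ball q f sequentially"
  proof (rule uniform_limit_if_le_inverse)
    fix k and z :: "complex ^ 'd" assume z: "z \<in> unit_ball"
    have "cmod (f z - on_ball (q k) z) \<le> mnorm (\<lambda>z. f z - on_ball (q k) z)"
      by (rule cmod_le_mult_norm[OF A_Da_multiplier[OF A_Da_diff[OF f qA]] z])
    then show "cmod (f z - q k z) \<le> 1 / real (Suc k)" using q(2)[of k] z by (simp add: on_ball_def)
  qed
  ultimately have "calculus_limit p.tuple f (\<pi> f)" using calculus_limitI[where g = q and G = Q, OF Q] by blast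
  then show ?thesis using extension_eq A_Da_subset_ball_algebra f by blast
qed

end

theorem theorem6p4:
  fixes a :: real
    and H :: "(complex ^ 'd \<Rightarrow> complex) set"
    and ip :: "(complex ^ 'd \<Rightarrow> complex) \<Rightarrow> (complex ^ 'd \<Rightarrow> complex) \<Rightarrow> complex"
  assumes "a > 0"
    and "is_rkhs (unit_ball :: (complex ^ 'd) set) (Da_kernel a) H ip"
  defines "A_Da \<equiv> poly_closure H ip"
    and "reps_Da \<equiv> (bounded_unital_reps (poly_closure H ip) (mult_norm H ip)
           :: ((complex ^ 'd \<Rightarrow> complex) \<Rightarrow> complex ^ 'n ^ 'n) set)"
    and "reps_ball \<equiv> (bounded_unital_reps ball_algebra ball_sup_norm
           :: ((complex ^ 'd \<Rightarrow> complex) \<Rightarrow> complex ^ 'n ^ 'n) set)"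
  shows "(\<forall>\<pi>\<in>reps_Da. \<exists>!\<sigma>. \<sigma> \<in> reps_ball \<and> (\<forall>f\<in>A_Da. \<sigma> f = \<pi> f)) \<and>
         (\<forall>\<sigma>\<in>reps_ball. restrict \<sigma> A_Da \<in> reps_Da) \<and>
         (\<forall>\<pi>\<in>reps_Da. (\<exists>!T. represents T \<pi>) \<and>
            (\<forall>T. represents T \<pi> \<longrightarrow> (\<forall>\<pi>'\<in>reps_Da. represents T \<pi>' \<longrightarrow> \<pi>' = \<pi>))) \<and>
         (\<forall>\<sigma>\<in>reps_ball. (\<exists>!T. represents T \<sigma>) \<and>
            (\<forall>T. represents T \<sigma> \<longrightarrow> (\<forall>\<sigma>'\<in>reps_ball. represents T \<sigma>' \<longrightarrow> \<sigma>' = \<sigma>)))"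
proof -
  interpret Da: Da_space a H ip by unfold_locales (rule assms(1,2))+
  have mem_Da: "poly_on_ball p \<in> A_Da" for p :: "'d cpoly"
    unfolding A_Da_def on_ball_poly_eval[symmetric]
    by (rule Da.polynomial_mem_A_Da) (auto simp: polynomial_fun_def)
  have ext: "\<exists>!\<sigma>. \<sigma> \<in> reps_ball \<and> (\<forall>f\<in>A_Da. \<sigma> f = \<pi> f)" if \<pi>: "\<pi> \<in> reps_Da" for \<pi>
  proof (rule ex_ex1I)
    note \<pi>' = \<pi>[unfolded reps_Da_def]
    interpret p: ball_rep "poly_closure H ip" "mult_norm H ip" \<pi> by (rule Da.A_Da_rep[OF \<pi>'])
    interpret bounded_tuple p.tuple by unfold_locales (rule p.tuple_commuting Da.A_Da_rep_slow_growth[OF \<pi>'])+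
    show "\<exists>\<sigma>. \<sigma> \<in> reps_ball \<and> (\<forall>f\<in>A_Da. \<sigma> f = \<pi> f)"
      unfolding reps_ball_def A_Da_def using extension_rep Da.extension_extends[OF \<pi>'] by blast
    fix \<sigma> \<sigma>' assume s: "\<sigma> \<in> reps_ball \<and> (\<forall>f\<in>A_Da. \<sigma> f = \<pi> f)" and s': "\<sigma>' \<in> reps_ball \<and> (\<forall>f\<in>A_Da. \<sigma>' f = \<pi> f)"
    show "\<sigma> = \<sigma>'"
      by (rule ball_algebra_rep_eqI) (use s s' mem_Da in \<open>auto simp: reps_ball_def\<close>)
  qed
  have res: "restrict \<sigma> A_Da \<in> reps_Da" if "\<sigma> \<in> reps_ball" for \<sigma>
    using Da.restrict_rep that unfolding A_Da_def reps_Da_def reps_ball_def by blast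
  have tuple_Da: "\<exists>!T. represents T \<pi>" if \<pi>: "\<pi> \<in> reps_Da" for \<pi>
  proof -
    note \<pi>' = \<pi>[unfolded reps_Da_def]
    interpret p: ball_rep "poly_closure H ip" "mult_norm H ip" \<pi> by (rule Da.A_Da_rep[OF \<pi>'])
    show ?thesis
      using p.represents_tuple[OF Da.A_Da_rep_slow_growth[OF \<pi>']] p.eq_tuple_if_represents by (rule ex1I)
  qed
  have tuple_ball: "\<exists>!T. represents T \<sigma>" if \<sigma>: "\<sigma> \<in> reps_ball" for \<sigma>
  proof -
    note \<sigma>' = \<sigma>[unfolded reps_ball_def]
    interpret p: ball_rep ball_algebra ball_sup_norm \<sigma> by (rule ball_algebra_rep[OF \<sigma>'])
    show ?thesis
      using p.represents_tuple[OF ball_algebra_rep_slow_growth[OF \<sigma>']] p.eq_tuple_if_represents by (rule ex1I)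
  qed
  have uniq_Da: "\<pi>' = \<pi>" if "\<pi> \<in> reps_Da" "\<pi>' \<in> reps_Da" "represents T \<pi>" "represents T \<pi>'" for \<pi> \<pi>' T
    by (rule Da.A_Da_rep_eqI) (use that in \<open>auto simp: reps_Da_def represents_def\<close>)
  have uniq_ball: "\<sigma>' = \<sigma>" if "\<sigma> \<in> reps_ball" "\<sigma>' \<in> reps_ball" "represents T \<sigma>" "represents T \<sigma>'" for \<sigma> \<sigma>' T
    by (rule ball_algebra_rep_eqI) (use that in \<open>auto simp: reps_ball_def represents_def\<close>)
  show ?thesis
    by (intro conjI ballI allI impI; rule ext res tuple_Da tuple_ball uniq_Da uniq_ball; assumption)
qed

end
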